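(* Let $\Sigma\subset\mathbb{R}^2$ be a closed discrete $R$-dense set for some $R>0$, and let $\mathcal{C}=(U_n)_{n\in\mathbb{N}}$ be an eventually $\Sigma$-free chain of arcwise connected subsets of $\mathbb{R}^2$. Then $\mathcal{C}$ is eventually $r$-quasiconvex for any $r>R$. In addition, one of the following holds: (1) there is $n\in\mathbb{N}$ and $w\in\Sigma$ such that $U_n$ is $\Sigma\setminus(\mathbb{R}w)$-free; (2) $\mathcal{C}$ has an asymptotic direction; or (3) $\mathcal{C}$ has bounded deviation in some direction $v\in\mathbb{R}^2\setminus\{(0,0)\}$, and moreover there is $M>0$ such that $E=\bigcap_{n\in\mathbb{N}}\overline{U}_n$ separates the half-planes $\{z\in\mathbb{R}^2:\langle z;v\rangle\ge M\}$ and $\{z\in\mathbb{R}^2:\langle z;v\rangle\le -M\}$.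
   Context: $\mathbb{N}$ is the set of positive integers, $\langle\cdot;\cdot\rangle$ the standard inner product, $T_v(x)=x+v$, $\mathbb{S}^1$ the unit circle in $\mathbb{R}^2$. - A set $S\subset\mathbb{R}^2$ is $R$-dense if it intersects every open ball of radius $R$ in $\mathbb{R}^2$; $S$ is $r$-quasiconvex if $S$ intersects every open ball of radius $r$ contained in the convex hull of $S$. - For $\Sigma\subset\mathbb{R}^2$, a set $U$ is $\Sigma$-free if $T_v(U)\cap U=\emptyset$ for all $v\in\Sigma$. - A chain is a sequence $\mathcal{C}=(U_n)_{n\in\mathbb{N}}$ of arcwise connected subsets of $\mathbb{R}^2$ with $U_{n+1}\subset U_n$ for all $n$. It is eventually $\Sigma$-free if for each $v\in\Sigma$ there is $n\in\mathbb{N}$ with $T_v(U_n)\cap U_n=\emptyset$; it is eventually $r$-quasiconvex if $\bigcap_{n}\overline{U}_n$ is $r$-quasiconvex. - For $X\subset\mathbb{R}^2$, $\partial_\infty X\subset\mathbb{S}^1$ is the set of all $v\in\mathbb{S}^1$ for which there is a sequence $x_n\in X$ with $\|x_n\|\to\infty$ and $x_n/\|x_n\|\to v$. $\mathcal{C}$ has an asymptotic direction if there is $v\in\mathbb{S}^1$ with $\bigcap_{n}\partial_\infty U_n=\{v\}$. - $\mathcal{C}$ has bounded deviation in the direction $v\neq(0,0)$ if $\bigcap_n\overline{U}_n$ is contained in a strip $\{z:-M'\le\langle z;v\rangle\le M'\}$ for some $M'$. - $E$ separates two sets if they are contained in different connected components of $\mathbb{R}^2\setminus E$. *)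

theory Defs
  imports "HOL-Analysis.Analysis"
begin

definition R_dense :: "real \<Rightarrow> (real^2) set \<Rightarrow> bool" where
  "R_dense R S \<longleftrightarrow> (\<forall>c. S \<inter> ball c R \<noteq> {})"

definition quasiconvex :: "real \<Rightarrow> (real^2) set \<Rightarrow> bool" where
  "quasiconvex r S \<longleftrightarrow> (\<forall>c. ball c r \<subseteq> convex hull S \<longrightarrow> S \<inter> ball c r \<noteq> {})"

definition translate :: "real^2 \<Rightarrow> real^2 \<Rightarrow> real^2" where
  "translate v x = x + v"

definition free :: "(real^2) set \<Rightarrow> (real^2) set \<Rightarrow> bool" where
  "free \<Sigma> U \<longleftrightarrow> (\<forall>v\<in>\<Sigma>. translate v ` U \<inter> U = {})"

text \<open>Arcwise connectedness is \<^const>\<open>path_connected\<close>: by the library theorem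
  \<open>path_connected_arcwise\<close> the connecting paths may be taken to be arcs.
  Sequences are indexed from 0 instead of 1.\<close>

definition chain :: "(nat \<Rightarrow> (real^2) set) \<Rightarrow> bool" where
  "chain U \<longleftrightarrow> (\<forall>n. path_connected (U n)) \<and> (\<forall>n. U (Suc n) \<subseteq> U n)"

definition eventually_free :: "(real^2) set \<Rightarrow> (nat \<Rightarrow> (real^2) set) \<Rightarrow> bool" where
  "eventually_free \<Sigma> U \<longleftrightarrow> (\<forall>v\<in>\<Sigma>. \<exists>n. translate v ` U n \<inter> U n = {})"

definition eventually_quasiconvex :: "real \<Rightarrow> (nat \<Rightarrow> (real^2) set) \<Rightarrow> bool" where
  "eventually_quasiconvex r U \<longleftrightarrow> quasiconvex r (\<Inter>n. closure (U n))"

definition boundary_at_infinity :: "(real^2) set \<Rightarrow> (real^2) set" where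
  "boundary_at_infinity X =
     {v \<in> sphere 0 1. \<exists>x :: nat \<Rightarrow> real^2. (\<forall>n. x n \<in> X) \<and>
        filterlim (\<lambda>n. norm (x n)) at_top sequentially \<and>
        (\<lambda>n. x n /\<^sub>R norm (x n)) \<longlonglongrightarrow> v}"

definition has_asymptotic_direction :: "(nat \<Rightarrow> (real^2) set) \<Rightarrow> bool" where
  "has_asymptotic_direction U \<longleftrightarrow>
     (\<exists>v\<in>sphere 0 1. (\<Inter>n. boundary_at_infinity (U n)) = {v})"

definition bounded_deviation :: "real^2 \<Rightarrow> (nat \<Rightarrow> (real^2) set) \<Rightarrow> bool" where
  "bounded_deviation v U \<longleftrightarrow>
     v \<noteq> 0 \<and> (\<exists>M'. (\<Inter>n. closure (U n)) \<subseteq> {z. - M' \<le> z \<bullet> v \<and> z \<bullet> v \<le> M'})"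

definition separates :: "(real^2) set \<Rightarrow> (real^2) set \<Rightarrow> (real^2) set \<Rightarrow> bool" where
  "separates E A B \<longleftrightarrow>
     (\<exists>C\<in>components (- E). \<exists>D\<in>components (- E). C \<noteq> D \<and> A \<subseteq> C \<and> B \<subseteq> D)"

end

theory Submission
  imports Defs "HOL-Complex_Analysis.Winding_Numbers"
begin

text \<open>
  Everything rests on two facts about a path connected plane set \<open>X\<close>.
  First, if \<open>X\<close> misses a disc contained in the convex hull of finitely many of its points, then
  there is a point \<open>y\<close> of that hull such that every vector \<open>d - y\<close>, with \<open>d\<close> in the disc, is a
  difference of two points of \<open>X\<close>. If the disc has radius larger than \<open>R\<close>, one of these vectors
  lies in \<open>\<Sigma>\<close>; only finitely many vectors of \<open>\<Sigma>\<close> can occur, so quasiconvexity of \<open>E\<close> follows by compactness.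
  Second, if \<open>X\<close> is disjoint from \<open>X + w\<close> and extends beyond a connected compact set \<open>A\<close> on both sides in the direction
  transverse to \<open>w\<close>, and \<open>A\<close> is disjoint from \<open>X\<close>, then \<open>A\<close> cannot meet both the forward and the backward
  \<open>w\<close>-translates of \<open>X\<close>.

  Let all \<open>U n\<close> be unbounded, let alternative (1) fail, and let \<open>D\<close> be the set of common asymptotic directions.
  If \<open>D\<close> contained two independent directions, take \<open>v \<in> \<Sigma>\<close> in the open cone they span. By the second fact
  \<open>E\<close> stays near \<open>U n\<close>, so by quasiconvexity \<open>U m\<close> meets every ball far away in direction \<open>v\<close>.
  Failure of (1) gives a continuum \<open>K\<close> in \<open>U n\<close> with two independent chords \<open>w1, w2 \<in> \<Sigma>\<close>, and the second fact
  makes \<open>U m\<close> avoid a large grid of translates of \<open>K\<close> by combinations of \<open>\<plusminus>w1\<close>, \<open>\<plusminus>w2\<close> far away in direction \<open>v\<close>.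
  The grid traps the points of \<open>U m\<close> in its centre, which is absurd. Hence \<open>D\<close> is \<open>{u}\<close> or \<open>{u, -u}\<close>;
  in the latter case \<open>U n\<close> lies in arbitrarily thin cones around \<open>\<plusminus>u\<close>, so any path far above or below can be
  used to build a set \<open>A\<close> contradicting the second fact, both if \<open>E\<close> is unbounded transversally to \<open>u\<close> and if it does not separate.
\<close>

section \<open>Chords of plane arcs\<close>

text \<open>Take an arc from \<open>p\<close> to \<open>p + k w\<close> and in it a shortest subarc whose ends differ by some \<open>n w\<close> with \<open>n \<noteq> 0\<close>.
  Under \<open>exp (2 \<pi> \<i> z / w)\<close> it becomes a simple closed curve with winding number \<open>n\<close> around \<open>0\<close>, so \<open>n = \<plusminus>1\<close>.\<close>

lemma chord_of_multiple_complex: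
  fixes U :: "complex set" and k :: nat
  assumes U: "path_connected U" and w: "w \<noteq> 0" and k: "k \<ge> 1"
    and p: "p \<in> U" "p + of_nat k * w \<in> U"
  shows "\<exists>q\<in>U. q + w \<in> U"
proof -
  have "p \<noteq> p + of_nat k * w" using w k by simp
  then obtain g where g: "arc g" "path_image g \<subseteq> U" "pathstart g = p" "pathfinish g = p + of_nat k * w"
    using U p unfolding path_connected_arcwise by metis
  have gU: "g t \<in> U" if "t \<in> {0..1}" for t using g(2) that unfolding path_image_def by auto
  have cg: "continuous_on {0..1} g" using g(1) by (simp add: arc_def path_def)
  have injg: "inj_on g {0..1}" using g(1) by (simp add: arc_def)
  \<comment> \<open>\<open>h\<close> measures chords of the arc in units of \<open>w\<close>, and
    \<open>T\<close> collects the parameter pairs whose chord is a nonzero integer multiple of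
    \<open>w\<close>. The nonzero integers are closed in the plane, so \<open>T\<close> is compact
    and the least parameter distance is attained.\<close>
  define h where "h = (\<lambda>x::real\<times>real. (g (snd x) - g (fst x)) / w)"
  define Z where "Z = (of_int ` (UNIV - {0::int}) :: complex set)"
  define T where "T = {x \<in> {0..1}\<times>{0..1}. h x \<in> Z}"
  have ch: "continuous_on ({0..1}\<times>{0..1}) h" unfolding h_def
    by (intro continuous_intros continuous_on_compose2[OF cg]) (use w in auto)
  have "closed Z" unfolding Z_def by (rule closed_of_int_image)
  then have "closedin (top_of_set ({0..1}\<times>{0..1})) T"
    using continuous_closedin_preimage[OF ch] unfolding T_def vimage_def Int_def by simp
  then have cT: "compact T"
    using closedin_compact[of "{0..1::real}\<times>{0..1::real}" T] by (simp add: compact_Times)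
  have "(0,1) \<in> T"
  proof -
    have "h (0,1) = of_nat k" using g(3,4) w by (simp add: h_def pathstart_def pathfinish_def)
    also have "\<dots> = of_int (int k)" by simp
    finally have "h (0,1) \<in> Z" using k unfolding Z_def by (metis DiffI UNIV_I imageI not_one_le_zero of_nat_eq_0_iff singletonD)
    then show ?thesis unfolding T_def by auto
  qed
  then have "T \<noteq> {}" by auto
  then obtain x where x: "x \<in> T" "\<And>y. y \<in> T \<Longrightarrow> \<bar>snd x - fst x\<bar> \<le> \<bar>snd y - fst y\<bar>"
    using continuous_attains_inf[OF cT, of "\<lambda>x. \<bar>snd x - fst x\<bar>"] by (force intro: continuous_intros)
  have swap: "(b,a) \<in> T" if "(a,b) \<in> T" for a b
  proof -
    from that obtain n where n: "n \<noteq> 0" "h (a,b) = of_int n" unfolding T_def Z_def by auto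
    have "h (b,a) = - h (a,b)" unfolding h_def by (metis fst_conv minus_diff_eq minus_divide_left snd_conv)
    then have "h (b,a) = of_int (-n)" using n by simp
    then have "h (b,a) \<in> Z" using n(1) unfolding Z_def by (intro image_eqI[of _ _ "-n"]) auto
    then show ?thesis using that unfolding T_def by simp
  qed
  have "\<exists>s t. s < t \<and> (s,t) \<in> T \<and> \<bar>t-s\<bar> = \<bar>snd x - fst x\<bar>"
  proof -
    have "fst x \<noteq> snd x" using x(1) unfolding T_def Z_def h_def by auto
    then consider "fst x < snd x" | "snd x < fst x" by linarith
    then show ?thesis
    proof cases
      case 1 then show ?thesis using x(1) by (metis prod.collapse)
    next
      case 2 then show ?thesis using swap x(1) by (metis abs_minus_commute prod.collapse)
    qed
  qed
  then obtain s t where st: "s < t" "(s,t) \<in> T" and stx: "\<bar>t-s\<bar> = \<bar>snd x - fst x\<bar>" by auto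
  have min: "t - s \<le> \<bar>b - a\<bar>" if "(a,b) \<in> T" for a b using x(2)[OF that] stx st(1) by simp
  have st01: "s \<in> {0..1}" "t \<in> {0..1}" using st(2) unfolding T_def by auto
  obtain n where n: "n \<noteq> 0" "h (s,t) = of_int n" using st(2) unfolding T_def Z_def by auto
  define l where "l = (\<lambda>u. s + u * (t - s))"
  have l01: "l u \<in> {s..t}" "l u \<in> {0..1}" if "u \<in> {0..1}" for u
  proof -
    have "0 \<le> u * (t-s)" "u * (t-s) \<le> 1 * (t-s)" using that st(1) by (auto intro!: mult_right_mono)
    then show "l u \<in> {s..t}" unfolding l_def by auto
    then show "l u \<in> {0..1}" using st01 by auto
  qed
  define q where "q = (\<lambda>u. 2 * complex_of_real pi * \<i> * g (l u) / w)"
  have pq: "path q" unfolding path_def q_def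
    by (intro continuous_intros continuous_on_compose2[OF cg]) (use w l01 in \<open>auto simp: l_def intro!: continuous_intros\<close>)
  have expq: "\<exists>m::int. h (l u, l v) = of_int m"
    if "exp (q u) = exp (q v)" for u v
  proof -
    from that[symmetric] obtain m :: int where m: "q v = q u + (of_int (2*m) * pi) * \<i>"
      unfolding exp_eq by auto
    have "q v - q u = (2 * complex_of_real pi * \<i>) * h (l u, l v)" using w unfolding q_def h_def by (simp add: field_simps)
    moreover have "q v - q u = (2 * complex_of_real pi * \<i>) * of_int m" using m by simp
    ultimately have "h (l u, l v) = of_int m" by simp
    then show ?thesis by auto
  qed
  \<comment> \<open>If \<open>exp \<circ> q\<close> agrees at \<open>u\<close> and \<open>v\<close>,
    the chord between them is an integer multiple \<open>m w\<close>. For \<open>m = 0\<close>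
    injectivity of the arc gives \<open>u = v\<close>; otherwise the pair lies in \<open>T\<close>,
    and minimality of \<open>t - s\<close> forces \<open>u\<close> and \<open>v\<close> to be the
    two ends.\<close>
  have simple: "simple_path (exp \<circ> q)"
    unfolding simple_path_def loop_free_def
  proof (intro conjI ballI impI)
    show "path (exp \<circ> q)" by (intro path_continuous_image pq continuous_intros)
    fix u v :: real assume uv: "u \<in> {0..1}" "v \<in> {0..1}" "(exp \<circ> q) u = (exp \<circ> q) v"
    then have "exp (q u) = exp (q v)" by simp
    from expq[OF this] obtain m :: int where m: "h (l u, l v) = of_int m" by blast
    show "u = v \<or> u = 0 \<and> v = 1 \<or> u = 1 \<and> v = 0"
    proof (cases "m = 0")
      case True
      then have "g (l u) = g (l v)" using m w unfolding h_def by simp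
      then have "l u = l v" using injg l01(2) uv by (meson inj_onD)
      then show ?thesis using st(1) unfolding l_def by simp
    next
      case False
      then have "(l u, l v) \<in> T" using m l01(2) uv(1,2) unfolding T_def Z_def by auto
      then have "t - s \<le> \<bar>l v - l u\<bar>" using min by auto
      also have "l v - l u = (v - u) * (t - s)" by (simp add: l_def algebra_simps)
      finally have "t - s \<le> \<bar>v - u\<bar> * (t - s)" using st(1) by (simp add: abs_mult)
      then have "\<bar>v - u\<bar> \<ge> 1" using st(1) by simp
      then show ?thesis using uv(1,2) by auto
    qed
  qed
  have q10: "q 1 - q 0 = 2 * complex_of_real pi * \<i> * of_int n"
    using n(2) w unfolding q_def h_def l_def by (simp add: field_simps)
  have "exp (q 1) = exp (q 0 + 2 * complex_of_real pi * \<i> * of_int n)" using q10 by (simp add: algebra_simps)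
  also have "\<dots> = exp (q 0)" unfolding exp_eq by (intro exI[of _ n]) (simp add: algebra_simps)
  finally have closed: "pathfinish (exp \<circ> q) = pathstart (exp \<circ> q)" by (simp add: pathstart_def pathfinish_def)
  have "0 \<notin> path_image (exp \<circ> q)" by (auto simp: path_image_def)
  then have "winding_number (exp \<circ> q) 0 \<in> {-1,0,1}"
    using simple_closed_path_winding_number_cases[OF simple closed] by auto
  moreover have "winding_number (exp \<circ> q) 0 = of_int n"
    using winding_number_compose_exp[OF pq] q10 by (simp add: pathstart_def pathfinish_def)
  ultimately have "of_int n = (-1::complex) \<or> of_int n = (1::complex)" using n(1) by auto
  then have "n = -1 \<or> n = 1" by (metis of_int_1 of_int_eq_iff of_int_minus)
  have gst: "g t - g s = of_int n * w" using n(2) w unfolding h_def by (simp add: field_simps)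
  from \<open>n = -1 \<or> n = 1\<close> show ?thesis
  proof
    assume "n = 1"
    then have "g s + w = g t" using gst by (simp add: algebra_simps)
    then show ?thesis using gU[OF st01(1)] gU[OF st01(2)] by metis
  next
    assume "n = -1"
    then have "g t + w = g s" using gst by (simp add: algebra_simps)
    then show ?thesis using gU[OF st01(1)] gU[OF st01(2)] by metis
  qed
qed

section \<open>Translates as barriers\<close>

text \<open>The determinant of \<open>z\<close> and \<open>w\<close>. For fixed \<open>w\<close> it
  is the coordinate transverse to \<open>w\<close>: it is constant on lines parallel to
  \<open>w\<close>, so translating by multiples of \<open>w\<close> does not change it.\<close>

definition cross2 :: "real^2 \<Rightarrow> real^2 \<Rightarrow> real" where
  "cross2 z w = z$1 * w$2 - z$2 * w$1"

text \<open>Extending \<open>g\<close> by horizontal rays gives a curve joining the vertical sides of a box. The translates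
  \<open>K - k e\<close> and \<open>K + l e\<close>, the set \<open>A\<close> and rays starting at the translates of \<open>b\<close> give a curve joining the horizontal
  sides; the two curves are disjoint, against the lemma \<open>fashoda\<close>.\<close>

lemma barrier_normal_form:
  fixes K A \<Gamma> :: "(real^2) set"
  assumes K: "compact K" "path_connected K" and A: "compact A" "path_connected A"
    and \<Gamma>: "path g" "path_image g \<subseteq> K" "pathstart g = a" "pathfinish g = b"
    and amin: "\<And>z. z \<in> K \<Longrightarrow> a$1 \<le> z$1" and bmax: "\<And>z. z \<in> K \<Longrightarrow> z$1 \<le> b$1"
    and slab: "\<And>z. z \<in> A \<Longrightarrow> a$1 < z$1 \<and> z$1 < b$1"
    and disj: "A \<inter> K = {}" and k: "k > 0" "l > 0"
    and freek: "\<And>z. z \<in> K \<Longrightarrow> z - k *\<^sub>R axis 2 1 \<notin> K"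
    and freel: "\<And>z. z \<in> K \<Longrightarrow> z + l *\<^sub>R axis 2 1 \<notin> K"
    and p: "p \<in> K" "p - k *\<^sub>R axis 2 1 \<in> A" and q: "q \<in> K" "q + l *\<^sub>R axis 2 1 \<in> A"
  shows False
proof -
  define e :: "real^2" where "e = axis 2 1"
  have e: "e$1 = 0" "e$2 = 1" by (simp_all add: e_def axis_def)
  have aK: "a \<in> K" and bK: "b \<in> K" using \<Gamma> by (auto simp: path_image_def pathstart_def pathfinish_def)
  obtain g1 where g1: "path g1" "path_image g1 \<subseteq> K" "pathstart g1 = b" "pathfinish g1 = p"
    using K(2) bK p(1) unfolding path_connected_def by metis
  obtain g2 where g2: "path g2" "path_image g2 \<subseteq> A" "pathstart g2 = p - k *\<^sub>R e" "pathfinish g2 = q + l *\<^sub>R e"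
    using A(2) p(2) q(2) unfolding path_connected_def e_def by metis
  obtain g3 where g3: "path g3" "path_image g3 \<subseteq> K" "pathstart g3 = q" "pathfinish g3 = b"
    using K(2) bK q(1) unfolding path_connected_def by metis
  have "bounded (K \<union> A)" using K A by (simp add: compact_imp_bounded)
  then obtain B where B: "\<And>z. z \<in> K \<union> A \<Longrightarrow> norm z \<le> B" unfolding bounded_iff by blast
  have comp: "\<bar>z$i\<bar> \<le> B" if "z \<in> K \<union> A" for z i using B[OF that] component_le_norm_cart[of z i] by linarith
  have "B \<ge> 0" using B[of a] aK norm_ge_zero[of a] by (meson UnI1 order_trans)
  \<comment> \<open>\<open>L\<close> exceeds every abscissa in \<open>K\<close> and
    \<open>A\<close>, and \<open>Y\<close> every ordinate even after the shifts by \<open>k\<close>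
    and \<open>l\<close>; so all curves below stay in the box, and its right side misses the sets
    and their translates.\<close>
  define L where "L = B + 1"
  define Y where "Y = B + k + l + 1"
  define la :: "real^2" where "la = vector [-L, a$2]"
  define rb :: "real^2" where "rb = vector [L, b$2]"
  define lo :: "real^2" where "lo = vector [L, -Y]"
  define hi :: "real^2" where "hi = vector [L, Y]"
  define f where "f = linepath la a +++ g +++ linepath b rb"
  \<comment> \<open>\<open>h1\<close> climbs the right side to height \<open>b$2 - k\<close> and
    enters \<open>K - k e\<close> at its rightmost point; \<open>h2\<close> leaves
    \<open>K + l e\<close> at its rightmost point and climbs on from height \<open>b$2 + l\<close>.
    The right end of \<open>f\<close> lies in the gap between these heights.\<close>
  define h1 where "h1 = linepath lo (rb - k *\<^sub>R e) +++ linepath (rb - k *\<^sub>R e) (b - k *\<^sub>R e) +++ ((\<lambda>z. z - k *\<^sub>R e) \<circ> g1)"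
  define h2 where "h2 = ((\<lambda>z. z + l *\<^sub>R e) \<circ> g3) +++ linepath (b + l *\<^sub>R e) (rb + l *\<^sub>R e) +++ linepath (rb + l *\<^sub>R e) hi"
  define h where "h = h1 +++ g2 +++ h2"
  have vs: "la$1 = -L" "la$2 = a$2" "rb$1 = L" "rb$2 = b$2" "lo$1 = L" "lo$2 = -Y" "hi$1 = L" "hi$2 = Y"
    by (simp_all add: la_def rb_def lo_def hi_def)
  have pg1: "path ((\<lambda>z. z - k *\<^sub>R e) \<circ> g1)" by (intro path_continuous_image g1 continuous_intros)
  have pg3: "path ((\<lambda>z. z + l *\<^sub>R e) \<circ> g3)" by (intro path_continuous_image g3 continuous_intros)
  have ends1: "pathstart ((\<lambda>z. z - k *\<^sub>R e) \<circ> g1) = b - k *\<^sub>R e" "pathfinish ((\<lambda>z. z - k *\<^sub>R e) \<circ> g1) = p - k *\<^sub>R e"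
    using g1 by (simp_all add: pathstart_compose pathfinish_compose)
  have ends3: "pathstart ((\<lambda>z. z + l *\<^sub>R e) \<circ> g3) = q + l *\<^sub>R e" "pathfinish ((\<lambda>z. z + l *\<^sub>R e) \<circ> g3) = b + l *\<^sub>R e"
    using g3 by (simp_all add: pathstart_compose pathfinish_compose)
  have pf: "path f" unfolding f_def using \<Gamma> by (intro path_join_imp) (auto simp: )
  have ph1: "path h1" "pathstart h1 = lo" "pathfinish h1 = p - k *\<^sub>R e" unfolding h1_def using pg1 ends1 by auto
  have ph2: "path h2" "pathstart h2 = q + l *\<^sub>R e" "pathfinish h2 = hi" unfolding h2_def using pg3 ends3 by auto
  have ph: "path h" "pathstart h = lo" "pathfinish h = hi" unfolding h_def using ph1 ph2 g2 by auto
  have imf: "path_image f = closed_segment la a \<union> path_image g \<union> closed_segment b rb"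
    unfolding f_def using \<Gamma> by (simp add: path_image_join Un_assoc)
  have imh: "path_image h \<subseteq> closed_segment lo (rb - k *\<^sub>R e) \<union> closed_segment (rb - k *\<^sub>R e) (b - k *\<^sub>R e)
      \<union> (\<lambda>z. z - k *\<^sub>R e) ` K \<union> A \<union> (\<lambda>z. z + l *\<^sub>R e) ` K
      \<union> closed_segment (b + l *\<^sub>R e) (rb + l *\<^sub>R e) \<union> closed_segment (rb + l *\<^sub>R e) hi"
    unfolding h_def h1_def h2_def using g1 g2 g3
    by (intro order_trans[OF path_image_join_subset] Un_least) (auto simp: path_image_compose)
  have bnd: "\<bar>z$1\<bar> \<le> B \<and> \<bar>z$2\<bar> \<le> B" if "z \<in> K \<or> z \<in> A" for z using comp that by auto
  have aB: "\<bar>a$1\<bar> \<le> B" "\<bar>a$2\<bar> \<le> B" "\<bar>b$1\<bar> \<le> B" "\<bar>b$2\<bar> \<le> B" using bnd aK bK by auto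
  have seg: "z$1 = (1-u) * x$1 + u * y$1" "z$2 = (1-u) * x$2 + u * y$2" if "z = (1-u) *\<^sub>R x + u *\<^sub>R y" for z x y :: "real^2" and u
    using that by auto
  have segE: "\<exists>u. 0 \<le> u \<and> u \<le> 1 \<and> z$1 = (1-u) * x$1 + u * y$1 \<and> z$2 = (1-u) * x$2 + u * y$2"
    if "z \<in> closed_segment x y" for z x y :: "real^2" using that seg unfolding in_segment by blast
  have cv: "min s t \<le> (1-u) * s + u * t \<and> (1-u) * s + u * t \<le> max s t" if "0 \<le> u" "u \<le> 1" for s t u :: real
  proof -
    have "(1-u) * min s t + u * min s t \<le> (1-u) * s + u * t"
      using that by (intro add_mono mult_left_mono) auto
    moreover have "(1-u) * s + u * t \<le> (1-u) * max s t + u * max s t"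
      using that by (intro add_mono mult_left_mono) auto
    ultimately show ?thesis by (simp add: algebra_simps)
  qed
  have segI: "min (x$1) (y$1) \<le> z$1 \<and> z$1 \<le> max (x$1) (y$1) \<and> min (x$2) (y$2) \<le> z$2 \<and> z$2 \<le> max (x$2) (y$2)"
    if "z \<in> closed_segment x y" for z x y :: "real^2" using segE[OF that] cv by metis
  have f1: "z$2 = a$2 \<and> z$1 \<le> a$1 \<and> -L \<le> z$1" if "z \<in> closed_segment la a" for z
    using segI[OF that] vs aB L_def by auto
  have f3: "z$2 = b$2 \<and> b$1 \<le> z$1 \<and> z$1 \<le> L" if "z \<in> closed_segment b rb" for z
    using segI[OF that] vs aB L_def by auto
  have k1: "z$1 = L \<and> -Y \<le> z$2 \<and> z$2 \<le> b$2 - k" if "z \<in> closed_segment lo (rb - k *\<^sub>R e)" for z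
    using segI[OF that] vs aB e k by (auto simp: Y_def)
  have k2: "z$2 = b$2 - k \<and> b$1 \<le> z$1 \<and> z$1 \<le> L" if "z \<in> closed_segment (rb - k *\<^sub>R e) (b - k *\<^sub>R e)" for z
    using segI[OF that] vs aB e by (auto simp: L_def)
  have k6: "z$2 = b$2 + l \<and> b$1 \<le> z$1 \<and> z$1 \<le> L" if "z \<in> closed_segment (b + l *\<^sub>R e) (rb + l *\<^sub>R e)" for z
    using segI[OF that] vs aB e by (auto simp: L_def)
  have k7: "z$1 = L \<and> b$2 + l \<le> z$2 \<and> z$2 \<le> Y" if "z \<in> closed_segment (rb + l *\<^sub>R e) hi" for z
    using segI[OF that] vs aB e k by (auto simp: Y_def)
  have k3: "\<exists>x\<in>K. z$1 = x$1 \<and> z$2 = x$2 - k" if "z \<in> (\<lambda>z. z - k *\<^sub>R e) ` K" for z using that e by auto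
  have k5: "\<exists>x\<in>K. z$1 = x$1 \<and> z$2 = x$2 + l" if "z \<in> (\<lambda>z. z + l *\<^sub>R e) ` K" for z using that e by auto
  have fbox: "path_image f \<subseteq> cbox (vector [-L,-Y]) (vector [L,Y])"
  proof
    fix z assume "z \<in> path_image f"
    then have "z \<in> closed_segment la a \<or> z \<in> K \<or> z \<in> closed_segment b rb" using imf \<Gamma>(2) by auto
    then have "-L \<le> z$1 \<and> z$1 \<le> L \<and> -Y \<le> z$2 \<and> z$2 \<le> Y"
      using f1[of z] f3[of z] bnd[of z] aB k \<open>B \<ge> 0\<close> unfolding L_def Y_def by auto
    then show "z \<in> cbox (vector [-L,-Y]) (vector [L,Y])" by (simp add: mem_box_cart forall_2)
  qed
  have hbox: "path_image h \<subseteq> cbox (vector [-L,-Y]) (vector [L,Y])"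
  proof
    fix z assume "z \<in> path_image h"
    then have z: "z \<in> closed_segment lo (rb - k *\<^sub>R e) \<or> z \<in> closed_segment (rb - k *\<^sub>R e) (b - k *\<^sub>R e)
      \<or> z \<in> (\<lambda>z. z - k *\<^sub>R e) ` K \<or> z \<in> A \<or> z \<in> (\<lambda>z. z + l *\<^sub>R e) ` K
      \<or> z \<in> closed_segment (b + l *\<^sub>R e) (rb + l *\<^sub>R e) \<or> z \<in> closed_segment (rb + l *\<^sub>R e) hi" using imh by blast
    have LY: "B \<le> L" "B + k + l \<le> Y" unfolding L_def Y_def by auto
    have "-L \<le> z$1 \<and> z$1 \<le> L \<and> -Y \<le> z$2 \<and> z$2 \<le> Y" using z
    proof (elim disjE)
      assume "z \<in> (\<lambda>z. z - k *\<^sub>R e) ` K" then show ?thesis using k3[of z] bnd LY k by fastforce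
    next
      assume "z \<in> (\<lambda>z. z + l *\<^sub>R e) ` K" then show ?thesis using k5[of z] bnd LY k by fastforce
    next
      assume "z \<in> closed_segment lo (rb - k *\<^sub>R e)" then show ?thesis using k1[of z] LY k aB \<open>B \<ge> 0\<close> by auto
    next
      assume "z \<in> closed_segment (rb - k *\<^sub>R e) (b - k *\<^sub>R e)" then show ?thesis using k2[of z] LY k aB by auto
    next
      assume "z \<in> A" then show ?thesis using bnd[of z] LY k by auto
    next
      assume "z \<in> closed_segment (b + l *\<^sub>R e) (rb + l *\<^sub>R e)" then show ?thesis using k6[of z] LY k aB by auto
    next
      assume "z \<in> closed_segment (rb + l *\<^sub>R e) hi" then show ?thesis using k7[of z] LY k aB \<open>B \<ge> 0\<close> by auto
    qed
    then show "z \<in> cbox (vector [-L,-Y]) (vector [L,Y])" by (simp add: mem_box_cart forall_2)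
  qed
  have "pathstart f = la" "pathfinish f = rb" unfolding f_def by simp_all
  then obtain z where z: "z \<in> path_image f" "z \<in> path_image h"
    using fashoda[OF pf ph(1) fbox hbox] vs ph(2,3) by auto
  have no: "z$1 = x$1 \<Longrightarrow> z$2 = x$2 \<Longrightarrow> z = x" for x :: "real^2" by (simp add: vec_eq_iff forall_2)
  have hz: "z \<in> closed_segment lo (rb - k *\<^sub>R e) \<or> z \<in> closed_segment (rb - k *\<^sub>R e) (b - k *\<^sub>R e)
      \<or> z \<in> (\<lambda>z. z - k *\<^sub>R e) ` K \<or> z \<in> A \<or> z \<in> (\<lambda>z. z + l *\<^sub>R e) ` K
      \<or> z \<in> closed_segment (b + l *\<^sub>R e) (rb + l *\<^sub>R e) \<or> z \<in> closed_segment (rb + l *\<^sub>R e) hi" using imh z(2) by blast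
  have slabz: "a$1 \<le> z$1 \<and> (z$1 = a$1 \<longrightarrow> False) \<or> z \<notin> A" using slab[of z] by auto
  have kK: "z \<notin> K" if "z \<in> (\<lambda>z. z - k *\<^sub>R e) ` K" using that freek unfolding e_def by auto
  have lK: "z \<notin> K" if "z \<in> (\<lambda>z. z + l *\<^sub>R e) ` K" using that freel unfolding e_def by auto
  have ab: "a$1 < b$1" using slab[OF p(2)] by auto
  have zK: "z \<in> (\<lambda>z. z - k *\<^sub>R e) ` K \<or> z \<in> (\<lambda>z. z + l *\<^sub>R e) ` K \<Longrightarrow> a$1 \<le> z$1 \<and> z$1 \<le> b$1"
    using k3[of z] k5[of z] amin bmax by fastforce
  have "z \<in> closed_segment la a \<or> z \<in> K \<or> z \<in> closed_segment b rb" using imf \<Gamma>(2) z(1) by auto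
  then show False
  proof (elim disjE)
    \<comment> \<open>The horizontal pieces of \<open>h\<close> lie at abscissas at least
      \<open>b$1\<close>, the maximum over \<open>K\<close>, so they can touch \<open>K\<close> only
      in \<open>b - k e\<close> or \<open>b + l e\<close>.\<close>
    assume "z \<in> K"
    then have "z \<notin> (\<lambda>z. z - k *\<^sub>R e) ` K" "z \<notin> (\<lambda>z. z + l *\<^sub>R e) ` K" "z \<notin> A" "z$1 \<le> b$1" "b$1 < L"
      using kK lK disj bmax aB unfolding L_def by auto
    then have "z \<in> closed_segment (rb - k *\<^sub>R e) (b - k *\<^sub>R e) \<or> z \<in> closed_segment (b + l *\<^sub>R e) (rb + l *\<^sub>R e)"
      using hz k1[of z] k7[of z] by auto
    then have "z$1 = b$1 \<and> (z$2 = b$2 - k \<or> z$2 = b$2 + l)" using k2[of z] k6[of z] \<open>z$1 \<le> b$1\<close> by auto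
    then have "z = b - k *\<^sub>R e \<or> z = b + l *\<^sub>R e" using no[of "b - k *\<^sub>R e"] no[of "b + l *\<^sub>R e"] e by auto
    then show False using \<open>z \<in> K\<close> freek[OF bK] freel[OF bK] unfolding e_def by auto
  next
    assume "z \<in> closed_segment la a"
    from f1[OF this] have za: "z$2 = a$2" "z$1 \<le> a$1" by auto
    have "b$1 < L" using aB unfolding L_def by auto
    have n1: "z \<notin> closed_segment lo (rb - k *\<^sub>R e)" using k1[of z] \<open>b$1 < L\<close> za ab by fastforce
    have n2: "z \<notin> closed_segment (rb - k *\<^sub>R e) (b - k *\<^sub>R e)" using k2[of z] \<open>b$1 < L\<close> za ab by fastforce
    have n3: "z \<notin> A" using slab[of z] \<open>b$1 < L\<close> za ab by fastforce
    have n4: "z \<notin> closed_segment (b + l *\<^sub>R e) (rb + l *\<^sub>R e)" using k6[of z] \<open>b$1 < L\<close> za ab by fastforce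
    have n5: "z \<notin> closed_segment (rb + l *\<^sub>R e) hi" using k7[of z] \<open>b$1 < L\<close> za ab by fastforce
    have "z \<in> (\<lambda>z. z - k *\<^sub>R e) ` K \<or> z \<in> (\<lambda>z. z + l *\<^sub>R e) ` K"
      using hz n1 n2 n3 n4 n5 by blast
    \<comment> \<open>Only the translates of \<open>K\<close> can reach the left ray, and their
      abscissas are at least \<open>a$1\<close>; so \<open>z\<close> is \<open>a\<close> itself,
      which lies in \<open>K\<close>.\<close>
    then have "z$1 = a$1" using zK za by auto
    then have "z = a" using za no[of a] by auto
    then show False using kK lK aK \<open>z \<in> _ \<or> z \<in> _\<close> by blast
  next
    assume "z \<in> closed_segment b rb"
    from f3[OF this] have zb: "z$2 = b$2" "b$1 \<le> z$1" by auto
    have n1: "z \<notin> closed_segment lo (rb - k *\<^sub>R e)" using k1[of z] zb k by fastforce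
    have n2: "z \<notin> closed_segment (rb - k *\<^sub>R e) (b - k *\<^sub>R e)" using k2[of z] zb k by fastforce
    have n3: "z \<notin> A" using slab[of z] zb k by fastforce
    have n4: "z \<notin> closed_segment (b + l *\<^sub>R e) (rb + l *\<^sub>R e)" using k6[of z] zb k by fastforce
    have n5: "z \<notin> closed_segment (rb + l *\<^sub>R e) hi" using k7[of z] zb k by fastforce
    have "z \<in> (\<lambda>z. z - k *\<^sub>R e) ` K \<or> z \<in> (\<lambda>z. z + l *\<^sub>R e) ` K"
      using hz n1 n2 n3 n4 n5 by blast
    then have "z$1 = b$1" using zK zb by auto
    then have "z = b" using zb no[of b] by auto
    then show False using kK lK bK \<open>z \<in> _ \<or> z \<in> _\<close> by blast
  qed
qed

text \<open>Adding a path from each new point to the set built so far keeps it compact and path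
  connected. The lemma replaces a set that need not be closed by a continuum through the finitely
  many points that matter, on which extrema are attained.\<close>

lemma finite_subset_compact_path_connected:
  fixes U :: "'a::real_normed_vector set"
  assumes U: "path_connected U" and F: "finite F" "F \<subseteq> U"
  obtains K where "compact K" "path_connected K" "F \<subseteq> K" "K \<subseteq> U"
proof -
  have "\<exists>K. compact K \<and> path_connected K \<and> F \<subseteq> K \<and> K \<subseteq> U \<and> (F \<noteq> {} \<longrightarrow> K \<noteq> {})" using F
  proof (induction F rule: finite_induct)
    case empty
    then show ?case by (intro exI[of _ "{}"]) auto
  next
    case (insert x F)
    then obtain K where K: "compact K" "path_connected K" "F \<subseteq> K" "K \<subseteq> U" by auto
    show ?case
    proof (cases "K = {}")
      case True
      then show ?thesis using insert K by (intro exI[of _ "{x}"]) auto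
    next
      case False
      then obtain y where y: "y \<in> K" by auto
      obtain g where g: "path g" "path_image g \<subseteq> U" "pathstart g = x" "pathfinish g = y"
        using U y K(4) insert.prems unfolding path_connected_def by blast
      have "path_connected (K \<union> path_image g)"
        using y K g pathfinish_in_path_image[of g] by (intro path_connected_Un path_connected_path_image) auto
      then show ?thesis using K g pathstart_in_path_image[of g]
        by (intro exI[of _ "K \<union> path_image g"]) (auto simp: compact_path_image compact_Un)
    qed
  qed
  then show ?thesis using that by blast
qed

section \<open>The plane as \<open>real^2\<close> and as \<open>complex\<close>, where winding
  numbers live\<close>

definition to_complex :: "real^2 \<Rightarrow> complex" where "to_complex z = Complex (z$1) (z$2)"

lemma linear_to_complex: "linear to_complex"
  by (rule linearI) (auto simp: to_complex_def complex_eq_iff)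

lemma inj_to_complex: "inj to_complex"
  by (auto simp: inj_def to_complex_def vec_eq_iff forall_2)

lemma norm_to_complex [simp]: "norm (to_complex z) = norm z"
  by (simp add: to_complex_def cmod_def norm_vec_def L2_set_def sum_2)

lemma to_complex_add: "to_complex (x + y) = to_complex x + to_complex y"
  using linear_to_complex by (rule linear_add)

lemma to_complex_diff: "to_complex (x - y) = to_complex x - to_complex y"
  using linear_to_complex by (rule linear_diff)

lemma to_complex_scaleR: "to_complex (c *\<^sub>R x) = c *\<^sub>R to_complex x"
  using linear_to_complex by (rule linear_scale)

lemma to_complex_eq_iff: "to_complex x = to_complex y \<longleftrightarrow> x = y"
  using inj_to_complex by (rule inj_eq)

lemma surj_to_complex: "surj to_complex"
proof (rule surjI)
  show "to_complex (vector [Re c, Im c]) = c" for c by (simp add: to_complex_def)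
qed

lemma continuous_on_to_complex: "continuous_on S to_complex"
  by (intro linear_continuous_on linear_conv_bounded_linear[THEN iffD1] linear_to_complex)

text \<open>Were \<open>k w\<close> a chord of \<open>U\<close>,
  \<open>chord_of_multiple_complex\<close> would produce the chord \<open>w\<close>. Freeness for a
  single vector thus controls whole sequences of translates.\<close>

lemma free_multiple:
  fixes U :: "(real^2) set" and k :: nat
  assumes U: "path_connected U" and w: "w \<noteq> 0" and k: "k \<ge> 1"
    and free: "\<And>z. z \<in> U \<Longrightarrow> z + w \<notin> U" and z: "z \<in> U"
  shows "z + real k *\<^sub>R w \<notin> U"
proof
  assume "z + real k *\<^sub>R w \<in> U"
  then have "to_complex z + of_nat k * to_complex w \<in> to_complex ` U"
    by (metis imageI of_real_of_nat_eq scaleR_conv_of_real to_complex_add to_complex_scaleR)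
  moreover have "to_complex w \<noteq> 0" using w by (metis norm_eq_zero norm_to_complex)
  moreover have "path_connected (to_complex ` U)"
    using path_connected_continuous_image[OF continuous_on_to_complex U] .
  ultimately obtain q where q: "q \<in> to_complex ` U" "q + to_complex w \<in> to_complex ` U"
    using chord_of_multiple_complex k z by blast
  then obtain x y where "x \<in> U" "y \<in> U" "to_complex x + to_complex w = to_complex y" by auto
  then have "x + w = y" by (metis to_complex_add to_complex_eq_iff)
  then show False using free \<open>x \<in> U\<close> \<open>y \<in> U\<close> by blast
qed

lemma cross2_simps:
  "cross2 (x + y) w = cross2 x w + cross2 y w" "cross2 (x - y) w = cross2 x w - cross2 y w"
  "cross2 (c *\<^sub>R x) w = c * cross2 x w" "cross2 (- x) w = - cross2 x w" "cross2 w w = 0" "cross2 0 w = 0"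
  "cross2 x (y + w) = cross2 x y + cross2 x w" "cross2 x (c *\<^sub>R w) = c * cross2 x w" "cross2 x (- w) = - cross2 x w"
  "cross2 x (y - w) = cross2 x y - cross2 x w"
  by (simp_all add: cross2_def algebra_simps)

lemma linear_cross2: "linear (\<lambda>z. cross2 z w)"
  by (rule linearI) (simp_all add: cross2_simps)

lemma continuous_on_cross2: "continuous_on S (\<lambda>z. cross2 z w)"
  by (intro linear_continuous_on linear_conv_bounded_linear[THEN iffD1] linear_cross2)

text \<open>Take a continuum in \<open>U\<close> through the four given points, and in it a path
  from a point with least to a point with largest \<open>cross2 z w\<close>; it extends beyond
  \<open>A\<close> on both sides. The linear map \<open>M\<close>, which makes \<open>w\<close>
  vertical, reduces the claim to \<open>barrier_normal_form\<close>.\<close>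

lemma translation_barrier:
  fixes U A :: "(real^2) set" and k l :: nat
  assumes U: "path_connected U" and free: "\<And>z. z \<in> U \<Longrightarrow> z + w \<notin> U"
    and A: "compact A" "path_connected A" "A \<inter> U = {}"
    and y: "y \<in> U" "\<And>z. z \<in> A \<Longrightarrow> cross2 y w < cross2 z w"
    and y': "y' \<in> U" "\<And>z. z \<in> A \<Longrightarrow> cross2 z w < cross2 y' w"
    and p: "p \<in> U" "p + real k *\<^sub>R w \<in> A" and q: "q \<in> U" "q - real l *\<^sub>R w \<in> A"
  shows False
proof -
  have w: "w \<noteq> 0" using y(2)[OF p(2)] by (auto simp: cross2_def)
  have "k \<noteq> 0" using p A(3) by auto
  have "l \<noteq> 0" using q A(3) by auto
  obtain K where K: "compact K" "path_connected K" "{y,y',p,q} \<subseteq> K" "K \<subseteq> U"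
    using finite_subset_compact_path_connected[OF U, of "{y,y',p,q}"] y y' p q by blast
  have "K \<noteq> {}" using K(3) by auto
  obtain a where a: "a \<in> K" "\<And>z. z \<in> K \<Longrightarrow> cross2 a w \<le> cross2 z w"
    using continuous_attains_inf[OF K(1) \<open>K \<noteq> {}\<close> continuous_on_cross2] by blast
  obtain b where b: "b \<in> K" "\<And>z. z \<in> K \<Longrightarrow> cross2 z w \<le> cross2 b w"
    using continuous_attains_sup[OF K(1) \<open>K \<noteq> {}\<close> continuous_on_cross2] by blast
  obtain g where g: "path g" "path_image g \<subseteq> K" "pathstart g = a" "pathfinish g = b"
    using K(2) a(1) b(1) unfolding path_connected_def by blast
  define M :: "real^2 \<Rightarrow> real^2" where "M = (\<lambda>z. vector [cross2 z w, (z \<bullet> w) / (w \<bullet> w)])"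
  have M: "M z $ 1 = cross2 z w" "M z $ 2 = (z \<bullet> w) / (w \<bullet> w)" for z by (simp_all add: M_def)
  have lM: "linear M"
    by (rule linearI) (simp_all add: vec_eq_iff forall_2 M cross2_simps inner_add_left add_divide_distrib)
  have Mw: "M w = axis 2 1" using w by (simp add: vec_eq_iff forall_2 M cross2_simps axis_def)
  have inj: "inj M"
  proof (rule injI)
    fix x z assume "M x = M z"
    then have "M (x - z) = 0" using lM by (simp add: linear_diff)
    then have *: "cross2 (x - z) w = 0" "(x - z) \<bullet> w = 0" using M[of "x - z"] w by auto
    define d where "d = x - z"
    have "d$1 * w$2 = d$2 * w$1" "d$1 * w$1 + d$2 * w$2 = 0"
      using * unfolding d_def[symmetric] by (auto simp: cross2_def inner_vec_def sum_2)
    then have "d$1 * (w$1^2 + w$2^2) = 0" "d$2 * (w$1^2 + w$2^2) = 0" by algebra+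
    moreover have "w$1^2 + w$2^2 \<noteq> 0" using w by (auto simp: vec_eq_iff forall_2 sum_power2_eq_zero_iff)
    ultimately have "d$1 = 0" "d$2 = 0" by (metis mult_eq_0_iff)+
    then have "d = 0" by (simp add: vec_eq_iff forall_2)
    then show "x = z" by (simp add: d_def)
  qed
  have Meq: "M x = M z \<longleftrightarrow> x = z" for x z using inj by (rule inj_eq)
  have Madd: "M (z + c *\<^sub>R w) = M z + c *\<^sub>R axis 2 1" "M (z - c *\<^sub>R w) = M z - c *\<^sub>R axis 2 1" for z c
    using lM Mw by (simp_all add: linear_add linear_diff linear_scale)
  have cM: "continuous_on S M" for S using lM linear_continuous_on linear_conv_bounded_linear by blast
  have fk: "z + real k *\<^sub>R w \<notin> K" "z - real l *\<^sub>R w \<notin> K" if "z \<in> K" for z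
  proof -
    show "z + real k *\<^sub>R w \<notin> K"
      using free_multiple[OF U w _ free, of k z] \<open>k \<noteq> 0\<close> that K(4) by auto
    show "z - real l *\<^sub>R w \<notin> K"
      using free_multiple[OF U w _ free, of l "z - real l *\<^sub>R w"] \<open>l \<noteq> 0\<close> that K(4) by auto
  qed
  show False
  \<comment> \<open>In the normal form \<open>p\<close> is the point that is shifted backwards, so
    \<open>q\<close> and \<open>l\<close> take the roles of \<open>p\<close> and \<open>k\<close>
    there, and conversely.\<close>
  proof (rule barrier_normal_form[where K="M ` K" and A="M ` A" and g="M \<circ> g" and a="M a" and b="M b"
      and k="real l" and l="real k" and p="M q" and q="M p"])
    show "compact (M ` K)" "compact (M ` A)" using K(1) A(1) cM by (auto intro: compact_continuous_image)
    show "path_connected (M ` K)" "path_connected (M ` A)" using K(2) A(2) cM by (auto intro: path_connected_continuous_image)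
    show "path (M \<circ> g)" by (intro path_continuous_image g cM)
    show "path_image (M \<circ> g) \<subseteq> M ` K" using g(2) by (auto simp: path_image_compose)
    show "pathstart (M \<circ> g) = M a" "pathfinish (M \<circ> g) = M b" using g by (auto simp: pathstart_compose pathfinish_compose)
    show "M a $ 1 \<le> z $ 1" "z $ 1 \<le> M b $ 1" if "z \<in> M ` K" for z using that a b by (auto simp: M)
    show "M a $ 1 < z $ 1 \<and> z $ 1 < M b $ 1" if "z \<in> M ` A" for z
    proof -
      from that obtain x where x: "x \<in> A" "z = M x" by auto
      have "cross2 a w < cross2 x w" "cross2 x w < cross2 b w"
        using y(2)[OF x(1)] y'(2)[OF x(1)] a(2)[of y] b(2)[of y'] K(3) by auto
      then show ?thesis by (simp add: x M)
    qed
    show "M ` A \<inter> M ` K = {}" using A(3) K(4) by (auto simp: Meq)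
    show "real k > 0" "real l > 0" using \<open>k \<noteq> 0\<close> \<open>l \<noteq> 0\<close> by auto
    show "z - real l *\<^sub>R axis 2 1 \<notin> M ` K" if "z \<in> M ` K" for z
      using that fk(2) by (auto simp: Madd(2)[symmetric] Meq)
    show "z + real k *\<^sub>R axis 2 1 \<notin> M ` K" if "z \<in> M ` K" for z
      using that fk(1) by (auto simp: Madd(1)[symmetric] Meq)
    show "M q \<in> M ` K" "M p \<in> M ` K" using K(3) by auto
    show "M q - real l *\<^sub>R axis 2 1 \<in> M ` A" "M p + real k *\<^sub>R axis 2 1 \<in> M ` A"
      using p(2) q(2) by (auto simp: Madd[symmetric])
  qed
qed

section \<open>Discs missed by a path connected set\<close>

text \<open>The path need not be closed: the winding number is then the complex number given by the
  change of a continuous logarithm of \<open>g - c\<close>. This allows arcs and segments to be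
  treated separately and added.\<close>

lemma winding_number_from_log:
  assumes g: "path g" and q: "continuous_on {0..1} q" "\<And>t. t \<in> {0..1} \<Longrightarrow> g t = c + exp (q t)"
  shows "winding_number g c = (q 1 - q 0) / (2 * complex_of_real pi * \<i>)"
proof -
  have "winding_number g c = winding_number (\<lambda>t. g t - c) 0" by (rule winding_number_offset)
  also have "\<dots> = winding_number (exp \<circ> q) 0" by (intro winding_number_cong) (simp add: q)
  also have "\<dots> = (q 1 - q 0) / (2 * complex_of_real pi * \<i>)"
    using winding_number_compose_exp[of q] q(1) by (simp add: path_def pathstart_def pathfinish_def)
  finally show ?thesis .
qed

text \<open>If the arc misses its translate, \<open>\<gamma> s - \<gamma> t - v\<close> has a logarithm on the unit square.
  Following it along two sides of the square relates the two winding numbers.\<close>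

lemma winding_number_chord_reflection:
  fixes \<gamma> :: "real \<Rightarrow> complex"
  assumes \<gamma>: "path \<gamma>" "pathstart \<gamma> = x" "pathfinish \<gamma> = y"
    and free: "\<And>z. z \<in> path_image \<gamma> \<Longrightarrow> z + (c - y) \<notin> path_image \<gamma>"
    and c: "c \<notin> closed_segment x y"
  shows "winding_number (\<gamma> +++ linepath y x) (x + y - c) = - winding_number (\<gamma> +++ linepath y x) c"
    and "c \<notin> path_image (\<gamma> +++ linepath y x)" and "x + y - c \<notin> path_image (\<gamma> +++ linepath y x)"
proof -
  define v where "v = c - y"
  define c' where "c' = x + y - c"
  have v: "c = y + v" "c' = x - v" by (auto simp: v_def c'_def)
  have cg: "continuous_on {0..1} \<gamma>" using \<gamma>(1) by (simp add: path_def)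
  have im: "\<gamma> t \<in> path_image \<gamma>" if "t \<in> {0..1}" for t using that by (auto simp: path_image_def)
  have xy: "\<gamma> 0 = x" "\<gamma> 1 = y" using \<gamma> by (auto simp: pathstart_def pathfinish_def)
  define F where "F = (\<lambda>z::real\<times>real. \<gamma> (fst z) - \<gamma> (snd z) - v)"
  have cF: "continuous_on ({0..1}\<times>{0..1}) F" unfolding F_def
    by (intro continuous_intros continuous_on_compose2[OF cg]) auto
  have F0: "F z \<noteq> 0" if "z \<in> {0..1}\<times>{0..1}" for z
  proof
    assume "F z = 0"
    then have "\<gamma> (fst z) = \<gamma> (snd z) + (c - y)" by (simp add: F_def v algebra_simps)
    then show False using free[of "\<gamma> (snd z)"] im[of "fst z"] im[of "snd z"] that by (auto simp: mem_Times_iff)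
  qed
  have "contractible ({0..1::real}\<times>{0..1::real})" by (intro convex_imp_contractible convex_Times) auto
  then obtain L where L: "continuous_on ({0..1}\<times>{0..1}) L" "\<And>z. z \<in> {0..1}\<times>{0..1} \<Longrightarrow> F z = exp (L z)"
    using continuous_logarithm_on_contractible[OF cF _ F0] by metis
  have cL: "continuous_on {0..1} (\<lambda>t. L (f t))" if "continuous_on {0..1} f" "f ` {0..1} \<subseteq> {0..1}\<times>{0..1}" for f :: "real \<Rightarrow> real\<times>real"
    using continuous_on_compose2[OF L(1) that] .
  \<comment> \<open>On the side with second parameter 1, \<open>F\<close> is
    \<open>\<gamma> s - c\<close>.\<close>
  have w1: "winding_number \<gamma> c = (L (1,1) - L (0,1)) / (2 * complex_of_real pi * \<i>)"
  proof (rule winding_number_from_log[OF \<gamma>(1)])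
    show "continuous_on {0..1} (\<lambda>s. L (s, 1))" by (rule cL) (auto intro!: continuous_intros)
    show "\<gamma> t = c + exp (L (t,1))" if "t \<in> {0..1}" for t
      using L(2)[of "(t,1)"] that by (auto simp: F_def v xy algebra_simps)
  qed
  \<comment> \<open>On the side with first parameter 0, \<open>F\<close> is
    \<open>c' - \<gamma> s\<close>; adding \<open>\<i> * pi\<close> to the logarithm corrects the
    sign.\<close>
  have w2: "winding_number \<gamma> c' = (L (0,1) - L (0,0)) / (2 * complex_of_real pi * \<i>)"
  proof -
    have "winding_number \<gamma> c' = ((L (0,1) + \<i> * pi) - (L (0,0) + \<i> * pi)) / (2 * complex_of_real pi * \<i>)"
    proof (rule winding_number_from_log[OF \<gamma>(1)])
      show "continuous_on {0..1} (\<lambda>s. L (0, s) + \<i> * pi)" by (intro continuous_intros cL) (auto intro!: continuous_intros)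
      show "\<gamma> t = c' + exp (L (0,t) + \<i> * pi)" if "t \<in> {0..1}" for t
        using L(2)[of "(0,t)"] that by (auto simp: F_def v xy algebra_simps exp_add)
    qed
    then show ?thesis by simp
  qed
  \<comment> \<open>\<open>F\<close> has the constant value \<open>- v\<close> on the diagonal, so
    its logarithm does not change there.\<close>
  have w3: "L (1,1) = L (0,0)"
  proof -
    have p: "path (\<lambda>t. L (t,t))" unfolding path_def by (rule cL) (auto intro!: continuous_intros)
    have "v \<noteq> 0" using F0[of "(0,0)"] by (auto simp: F_def)
    have "winding_number (exp \<circ> (\<lambda>t. L (t,t))) 0 = winding_number (linepath (- v) (- v)) 0"
    proof (rule winding_number_cong)
      fix t :: real assume "0 \<le> t" "t \<le> 1"
      then show "(exp \<circ> (\<lambda>t. L (t,t))) t = linepath (- v) (- v) t"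
        using L(2)[of "(t,t)"] by (simp add: F_def linepath_refl)
    qed
    also have "\<dots> = 0" using \<open>v \<noteq> 0\<close> by (intro winding_number_trivial) simp
    finally show ?thesis using winding_number_compose_exp[OF p] by (simp add: pathstart_def pathfinish_def)
  qed
  have cg1: "c \<notin> path_image \<gamma>" using free[of y] \<gamma> pathfinish_in_path_image[of \<gamma>] by auto
  have cg2: "c' \<notin> path_image \<gamma>"
    using free[of c'] \<gamma> pathstart_in_path_image[of \<gamma>] by (auto simp: c'_def)
  have refl: "x + y - z \<in> closed_segment x y" if "z \<in> closed_segment x y" for z
  proof -
    from that obtain u where "0 \<le> u" "u \<le> 1" "z = (1-u) *\<^sub>R x + u *\<^sub>R y" by (auto simp: in_segment)
    then show ?thesis unfolding in_segment by (intro exI[of _ "1-u"]) (auto simp: algebra_simps)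
  qed
  have c2: "c' \<notin> closed_segment x y" using refl[of c'] c by (auto simp: c'_def)
  show ni: "c \<notin> path_image (\<gamma> +++ linepath y x)" "x + y - c \<notin> path_image (\<gamma> +++ linepath y x)"
    using \<gamma> cg1 cg2 c c2 by (auto simp: path_image_join closed_segment_commute c'_def)
  \<comment> \<open>The point reflection in the midpoint of \<open>x\<close> and \<open>y\<close>
    reverses the segment and exchanges \<open>c\<close> with \<open>c'\<close>, and winding numbers
    do not change under a half-turn.\<close>
  have l1: "winding_number (linepath y x) c' = winding_number (linepath x y) c"
  proof -
    have "winding_number (linepath y x) c' = winding_number (uminus \<circ> (\<lambda>t. linepath x y t - c)) 0"
      unfolding winding_number_offset[of _ c'] by (intro winding_number_cong) (simp add: linepath_def c'_def algebra_simps)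
    also have "\<dots> = winding_number (\<lambda>t. linepath x y t - c) 0"
    proof (rule winding_number_negatepath)
      have eq: "(\<lambda>t. linepath x y t - c) = linepath (x - c) (y - c)" by (auto simp: linepath_def algebra_simps)
      show "valid_path (\<lambda>t. linepath x y t - c)" unfolding eq by simp
      show "0 \<notin> path_image (\<lambda>t. linepath x y t - c)" using c by (auto simp: path_image_def linepath_image_01[symmetric])
    qed
    also have "\<dots> = winding_number (linepath x y) c" by (rule winding_number_offset[symmetric])
    finally show ?thesis .
  qed
  have l2: "winding_number (linepath x y) c = - winding_number (linepath y x) c"
    using winding_number_reversepath[of "linepath y x" c] c by (simp add: closed_segment_commute)
  have j: "winding_number (\<gamma> +++ linepath y x) d = winding_number \<gamma> d + winding_number (linepath y x) d"
    if "d \<notin> path_image \<gamma>" "d \<notin> closed_segment x y" for d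
    using that \<gamma> by (intro winding_number_join) (auto simp: closed_segment_commute)
  show "winding_number (\<gamma> +++ linepath y x) (x + y - c) = - winding_number (\<gamma> +++ linepath y x) c"
  proof -
    have "winding_number \<gamma> c' = - winding_number \<gamma> c" using w1 w2 w3 by (simp add: diff_divide_distrib)
    then show ?thesis using j[OF cg1 c] j[OF cg2 c2] l1 l2 unfolding c'_def by simp
  qed
qed

text \<open>Otherwise \<open>c\<close> and its reflection \<open>x + y - c\<close> would both lie
  inside a simple closed curve with opposite nonzero winding numbers, while all inside points of
  such a curve have the same one.\<close>

lemma chord_of_enclosed_point:
  fixes \<gamma> :: "real \<Rightarrow> complex"
  assumes \<gamma>: "arc \<gamma>" "pathstart \<gamma> = x" "pathfinish \<gamma> = y"
    and seg: "path_image \<gamma> \<inter> open_segment x y = {}"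
    and c: "c \<notin> closed_segment x y"
    and wn: "winding_number (\<gamma> +++ linepath y x) c \<noteq> 0"
  shows "\<exists>z\<in>path_image \<gamma>. z + (c - y) \<in> path_image \<gamma>"
proof (rule ccontr)
  assume "\<not> ?thesis"
  then have free: "\<And>z. z \<in> path_image \<gamma> \<Longrightarrow> z + (c - y) \<notin> path_image \<gamma>" by blast
  let ?J = "\<gamma> +++ linepath y x"
  note r = winding_number_chord_reflection[OF arc_imp_path[OF \<gamma>(1)] \<gamma>(2,3) free c]
  have "x \<noteq> y" using \<gamma> arc_distinct_ends by blast
  have J: "simple_path ?J"
  proof (rule simple_path_join_loop)
    show "path_image \<gamma> \<inter> path_image (linepath y x) \<subseteq> {pathstart \<gamma>, pathstart (linepath y x)}"
      using seg \<gamma> by (auto simp: open_segment_def closed_segment_commute)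
  qed (use \<gamma> \<open>x \<noteq> y\<close> in \<open>auto simp: arc_linepath\<close>)
  have cl: "pathfinish ?J = pathstart ?J" using \<gamma> by simp
  have ins: "d \<in> inside (path_image ?J)" if "winding_number ?J d \<noteq> 0" "d \<notin> path_image ?J" for d
    using winding_number_zero_in_outside[OF simple_path_imp_path[OF J] cl] that inside_Un_outside[of "path_image ?J"] by blast
  have i1: "c \<in> inside (path_image ?J)" using ins wn r(2) by blast
  have i2: "x + y - c \<in> inside (path_image ?J)" using ins r wn by simp
  show False
    using simple_closed_path_winding_number_inside[OF J] i1 i2 r(1) wn by (metis add.inverse_inverse neg_equal_zero one_neq_zero one_neq_neg_one)
qed

section \<open>Supporting edges and inconsistent arguments\<close>

lemma finite_attains_Max:
  fixes h :: "'a \<Rightarrow> real"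
  assumes "finite S" "S \<noteq> {}"
  obtains x where "x \<in> S" "\<And>y. y \<in> S \<Longrightarrow> h y \<le> h x"
proof -
  have "Max (h ` S) \<in> h ` S" using assms by (intro Max_in) auto
  then obtain x where "x \<in> S" "Max (h ` S) = h x" by auto
  then show ?thesis using that[of x] assms by (metis Max_ge finite_imageI imageI)
qed

text \<open>Among the points of \<open>F\<close> that lie on a supporting line of the hull,
  \<open>f\<close> has the largest \<open>\<theta>\<close>. The next such point \<open>g\<close>,
  counterclockwise as seen from \<open>c\<close>, is found by taking the smallest turn from the
  outward direction \<open>f - c\<close>. The line through \<open>f\<close> and \<open>g\<close>
  supports the hull at \<open>g\<close> too, so \<open>g\<close> took part in the maximum.\<close>

lemma finite_hull_supporting_edge:
  fixes F :: "complex set" and \<theta> :: "complex \<Rightarrow> real"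
  assumes F: "finite F" and c: "c \<in> interior (convex hull F)"
  obtains f g where "f \<in> F" "g \<in> F" "\<theta> g \<le> \<theta> f" "0 < Im (cnj (f - c) * (g - f))"
    "\<And>z. z \<in> convex hull F \<Longrightarrow> 0 \<le> Im (cnj (g - f) * (z - f))"
proof -
  have "F \<noteq> {}" using c by auto
  obtain e where e: "e > 0" "cball c e \<subseteq> convex hull F"
    using c unfolding mem_interior_cball by auto
  define F0 where "F0 = {f\<in>F. \<exists>n. n \<noteq> 0 \<and> (\<forall>h\<in>F. n \<bullet> (h - f) \<le> 0)}"
  have hull_le: "n \<bullet> z \<le> B" if "z \<in> convex hull F" "\<And>h. h \<in> F \<Longrightarrow> n \<bullet> h \<le> B" for n z :: complex and B
  proof -
    have "convex hull F \<subseteq> {z. n \<bullet> z \<le> B}"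
      using that(2) by (intro hull_minimal convex_halfspace_le) auto
    then show ?thesis using that(1) by auto
  qed
  have "F0 \<noteq> {}"
  proof -
    obtain f where f: "f \<in> F" "\<And>h. h \<in> F \<Longrightarrow> Re h \<le> Re f"
      using finite_attains_Max[OF F \<open>F \<noteq> {}\<close>, of Re] by blast
    then have "f \<in> F0" unfolding F0_def by (auto intro!: exI[of _ 1] simp: inner_complex_def)
    then show ?thesis by auto
  qed
  have "finite F0" using F unfolding F0_def by auto
  then obtain f where f: "f \<in> F0" "\<And>h. h \<in> F0 \<Longrightarrow> \<theta> h \<le> \<theta> f"
    using finite_attains_Max[of F0 \<theta>] \<open>F0 \<noteq> {}\<close> by blast
  then obtain n where n: "n \<noteq> 0" "\<And>h. h \<in> F \<Longrightarrow> n \<bullet> (h - f) \<le> 0" and fF: "f \<in> F" unfolding F0_def by auto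
  define u where "u = f - c"
  define A where "A = (\<lambda>h. u \<bullet> (h - f))"
  define B where "B = (\<lambda>h. Im (cnj u * (h - f)))"
  have Bin: "B h = (\<i> * u) \<bullet> (h - f)" for h by (simp add: B_def inner_complex_def)
  have shift: "c + s *\<^sub>R d \<in> convex hull F" if "\<bar>s\<bar> * norm d \<le> e" for s d
    using that e(2) by (auto simp: dist_norm subset_iff)
  have nu: "n \<bullet> u > 0"
  proof -
    have "n \<bullet> (c + (e / norm n) *\<^sub>R n) \<le> n \<bullet> f"
      using n e(1) by (intro hull_le[OF shift]) (auto simp: inner_diff_right)
    moreover have "(e / norm n) * (n \<bullet> n) > 0" using n e(1) by simp
    ultimately show ?thesis by (simp add: u_def inner_diff_right inner_add_right)
  qed
  then have "u \<noteq> 0" by auto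
  have ex: "\<exists>h\<in>F. B h > 0"
  proof (rule ccontr)
    assume "\<not> ?thesis"
    then have le: "(\<i> * u) \<bullet> h \<le> (\<i> * u) \<bullet> f" if "h \<in> F" for h
      using that Bin[of h] by (auto simp: inner_diff_right not_less)
    have "(\<i> * u) \<bullet> (c + (e / norm u) *\<^sub>R (\<i> * u)) \<le> (\<i> * u) \<bullet> f"
      using e(1) \<open>u \<noteq> 0\<close> le by (intro hull_le[OF shift]) (auto simp: norm_mult)
    then have "(\<i> * u) \<bullet> (c - f) + (e / norm u) * ((\<i> * u) \<bullet> (\<i> * u)) \<le> 0"
      by (simp add: inner_diff_right inner_add_right)
    moreover have "(\<i> * u) \<bullet> (c - f) = 0" by (simp add: u_def inner_complex_def algebra_simps)
    moreover have "(e / norm u) * ((\<i> * u) \<bullet> (\<i> * u)) > 0" using e(1) \<open>u \<noteq> 0\<close> by simp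
    ultimately show False by linarith
  qed
  \<comment> \<open>\<open>A h / B h\<close> is the cotangent of the angle from \<open>u\<close> to
    \<open>h - f\<close>, so its maximum over the points to the left of \<open>u\<close> picks the
    smallest angle.\<close>
  define H where "H = {h\<in>F. B h > 0}"
  have "finite H" "H \<noteq> {}" using F ex unfolding H_def by auto
  then obtain g where g: "g \<in> H" "\<And>h. h \<in> H \<Longrightarrow> A h / B h \<le> A g / B g"
    using finite_attains_Max[of H "\<lambda>h. A h / B h"] by blast
  have gF: "g \<in> F" and Bg: "B g > 0" using g(1) unfolding H_def by auto
  \<comment> \<open>This expands \<open>n\<close> in the orthogonal basis \<open>u\<close>,
    \<open>\<i> * u\<close>, without dividing by the squared length of \<open>u\<close>.\<close>
  have nid: "(n \<bullet> z) * (u \<bullet> u) = (n \<bullet> u) * (u \<bullet> z) + (n \<bullet> (\<i> * u)) * Im (cnj u * z)" for z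
    by (simp add: inner_complex_def algebra_simps power2_eq_square)
  have nA: "(n \<bullet> u) * A h + (n \<bullet> (\<i> * u)) * B h \<le> 0" if "h \<in> F" for h
    using n(2)[OF that] nid[of "h - f"] \<open>u \<noteq> 0\<close> unfolding A_def B_def
    by (metis inner_ge_zero mult_nonpos_nonneg)
  have AB: "A g * B h - B g * A h \<ge> 0" if h: "h \<in> F" for h
  proof (cases "B h > 0")
    case True
    then have "A h / B h \<le> A g / B g" using g(2) h unfolding H_def by auto
    then show ?thesis using True Bg by (simp add: field_simps)
  next
    \<comment> \<open>To the right of \<open>u\<close> the supporting normal \<open>n\<close> at
      \<open>f\<close> decides: the bounds \<open>nA\<close> for \<open>g\<close> and
      \<open>h\<close> are weighted by \<open>B h\<close> and \<open>B g\<close>, and the positive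
      factor \<open>n \<bullet> u\<close> is cancelled.\<close>
    case False
    let ?N1 = "n \<bullet> u" and ?N2 = "n \<bullet> (\<i> * u)"
    have "(?N1 * A g) * B h \<ge> (- ?N2 * B g) * B h"
      using nA[OF gF] False by (intro mult_right_mono_neg) auto
    moreover have "B g * (?N1 * A h) \<le> B g * (- ?N2 * B h)"
      using nA[OF h] Bg by (intro mult_left_mono) auto
    ultimately have "?N1 * (A g * B h - B g * A h) \<ge> 0" by (simp add: algebra_simps)
    then show ?thesis using nu by (simp add: zero_le_mult_iff)
  qed
  have id: "A g * B h - B g * A h = (u \<bullet> u) * Im (cnj (g - f) * (h - f))" for h
    by (simp add: A_def B_def inner_complex_def algebra_simps power2_eq_square)
  have pos: "0 \<le> Im (cnj (g - f) * (h - f))" if "h \<in> F" for h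
  proof -
    have "u \<bullet> u > 0" using \<open>u \<noteq> 0\<close> by simp
    moreover have "0 \<le> (u \<bullet> u) * Im (cnj (g - f) * (h - f))" using AB[OF that] unfolding id .
    ultimately show ?thesis by (simp only: zero_le_mult_iff) linarith
  qed
  have in_id: "Im (cnj (g - f) * z) = (\<i> * (g - f)) \<bullet> z" for z by (simp add: inner_complex_def)
  have posi: "(\<i> * (g - f)) \<bullet> f \<le> (\<i> * (g - f)) \<bullet> h" if "h \<in> F" for h
    using pos[OF that] unfolding in_id inner_diff_right by simp
  have pos': "0 \<le> Im (cnj (g - f) * (z - f))" if "z \<in> convex hull F" for z
  proof -
    have "(- (\<i> * (g - f))) \<bullet> z \<le> (- (\<i> * (g - f))) \<bullet> f"
      using posi by (intro hull_le[OF that]) auto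
    then show ?thesis unfolding in_id inner_diff_right by simp
  qed
  have "g \<noteq> f" using Bg by (auto simp: B_def)
  have "g \<in> F0" unfolding F0_def
  proof (intro CollectI conjI exI ballI gF)
    show "- (\<i> * (g - f)) \<noteq> 0" using \<open>g \<noteq> f\<close> by simp
    fix h assume "h \<in> F"
    have "(\<i> * (g - f)) \<bullet> (h - g) = (\<i> * (g - f)) \<bullet> (h - f)"
      by (simp add: inner_complex_def algebra_simps)
    then show "- (\<i> * (g - f)) \<bullet> (h - g) \<le> 0" using posi[OF \<open>h \<in> F\<close>] by (simp add: inner_diff_right)
  qed
  then have "\<theta> g \<le> \<theta> f" using f(2) by blast
  then show ?thesis using that[of f g] fF gF Bg pos' unfolding B_def u_def by blast
qed

text \<open>The points of \<open>T\<close> where \<open>\<eta>\<close> equals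
  \<open>\<eta> a\<close> and those where it differs by at least 1 form two compact sets that cover
  \<open>T\<close>. A closest pair, one from each set, has no point of \<open>T\<close> in
  between.\<close>

lemma compact_jump:
  fixes T :: "real set" and \<eta> :: "real \<Rightarrow> real"
  assumes T: "compact T" and \<eta>: "continuous_on T \<eta>" and ab: "a \<in> T" "b \<in> T" "\<eta> a \<noteq> \<eta> b"
    and gap: "\<And>t. t \<in> T \<Longrightarrow> \<eta> t \<noteq> \<eta> a \<Longrightarrow> \<bar>\<eta> t - \<eta> a\<bar> \<ge> 1"
  obtains s t where "s \<in> T" "t \<in> T" "\<eta> s \<noteq> \<eta> t" "open_segment s t \<inter> T = {}"
proof -
  define T0 where "T0 = T \<inter> \<eta> -` {\<eta> a}"
  define T1 where "T1 = T \<inter> \<eta> -` {x. 1 \<le> \<bar>x - \<eta> a\<bar>}"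
  have cl: "closed {x. 1 \<le> \<bar>x - \<eta> a\<bar>}" by (intro closed_Collect_le continuous_intros)
  have "compact (T \<inter> \<eta> -` S)" if "closed S" for S
    using closedin_compact[OF T continuous_closedin_preimage[OF \<eta> that]] .
  from this[OF closed_singleton] this[OF cl] have "compact T0" "compact T1" unfolding T0_def T1_def .
  then have c: "compact (T0 \<times> T1)" by (rule compact_Times)
  have "a \<in> T0" "b \<in> T1" using ab gap[of b] by (auto simp: T0_def T1_def)
  then have ne: "T0 \<times> T1 \<noteq> {}" by blast
  have "continuous_on (T0 \<times> T1) (\<lambda>x. \<bar>fst x - snd x\<bar>)" by (intro continuous_intros)
  from continuous_attains_inf[OF c ne this]
  obtain x where x: "x \<in> T0 \<times> T1" "\<forall>y \<in> T0 \<times> T1. \<bar>fst x - snd x\<bar> \<le> \<bar>fst y - snd y\<bar>" by blast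
  define s where "s = fst x"
  define t where "t = snd x"
  have s0: "s \<in> T0" and t1: "t \<in> T1" using x(1) unfolding s_def t_def by (simp_all add: mem_Times_iff)
  have min: "\<bar>s - t\<bar> \<le> \<bar>y - z\<bar>" if "y \<in> T0" "z \<in> T1" for y z
    using bspec[OF x(2), of "(y,z)"] that unfolding s_def t_def by simp
  have s: "s \<in> T" "\<eta> s = \<eta> a" using s0 unfolding T0_def by simp_all
  have t: "t \<in> T" "1 \<le> \<bar>\<eta> t - \<eta> a\<bar>" using t1 unfolding T1_def by simp_all
  have "\<tau> \<notin> T" if "\<tau> \<in> open_segment s t" for \<tau>
  proof
    assume "\<tau> \<in> T"
    have "\<bar>s - \<tau>\<bar> < \<bar>s - t\<bar>" "\<bar>\<tau> - t\<bar> < \<bar>s - t\<bar>"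
      using dist_in_open_segment[OF that] by (simp_all add: dist_real_def abs_minus_commute)
    moreover have "\<tau> \<in> T0 \<or> \<tau> \<in> T1"
      using \<open>\<tau> \<in> T\<close> gap[of \<tau>] unfolding T0_def T1_def by blast
    ultimately show False using min[of \<tau> t] min[of s \<tau>] s0 t1 by linarith
  qed
  moreover have "\<eta> s \<noteq> \<eta> t" using s t by auto
  ultimately show ?thesis using that[of s t] s(1) t(1) by blast
qed

text \<open>Let \<open>\<phi>\<close> be the argument around \<open>c\<close> along the segment,
  measured from \<open>f\<close>; it is positive at \<open>g\<close>, whereas
  \<open>\<theta>\<close> has not increased there. So \<open>\<theta> - \<phi>\<close>, which on
  \<open>K\<close> varies by multiples of \<open>2 * pi\<close>, changes between two points
  \<open>x\<close>, \<open>y\<close> of \<open>K\<close> with no point of \<open>K\<close> in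
  between. This change, divided by \<open>2 * pi\<close>, is the winding number of an arc in
  \<open>K\<close> closed by the chord.\<close>

lemma inconsistent_chord:
  fixes K :: "complex set" and \<theta> :: "complex \<Rightarrow> real"
  assumes K: "compact K" "path_connected K" and fg: "f \<in> K" "g \<in> K"
    and \<theta>: "continuous_on K \<theta>" "\<And>z. z \<in> K \<Longrightarrow> z - c = of_real (norm (z - c)) * exp (\<i> * \<theta> z)"
    and le: "\<theta> g \<le> \<theta> f" and ccw: "0 < Im (cnj (f - c) * (g - f))" and cK: "c \<notin> K"
  obtains x y \<gamma> where "x \<in> closed_segment f g" "y \<in> closed_segment f g"
    "arc \<gamma>" "pathstart \<gamma> = x" "pathfinish \<gamma> = y" "path_image \<gamma> \<subseteq> K"
    "open_segment x y \<inter> K = {}" "winding_number (\<gamma> +++ linepath y x) c \<noteq> 0"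
proof -
  define u where "u = f - c"
  have "u \<noteq> 0" using ccw by (auto simp: u_def)
  \<comment> \<open>Dividing by \<open>u\<close> sends \<open>f\<close> to 1 and the rest of the
    segment into the upper half-plane, so the principal logarithm is continuous along it.\<close>
  define \<rho> where "\<rho> = (\<lambda>z. (z - c) / u)"
  define \<phi> where "\<phi> = (\<lambda>z. Im (Ln (\<rho> z)))"
  have Im\<rho>: "Im (\<rho> (linepath f g t)) = t * Im (cnj u * (g - f)) / (norm u)^2" for t
  proof -
    have "linepath f g t - c = u + t *\<^sub>R (g - f)" by (simp add: linepath_def u_def algebra_simps)
    then have "\<rho> (linepath f g t) = (cnj u * (u + t *\<^sub>R (g - f))) / of_real ((norm u)^2)"
      unfolding \<rho>_def by (metis complex_div_cnj mult.commute of_real_power)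
    also have "Im \<dots> = Im (cnj u * (u + t *\<^sub>R (g - f))) / (norm u)^2"
      by (simp only: Im_divide_of_real)
    also have "Im (cnj u * (u + t *\<^sub>R (g - f))) = t * Im (cnj u * (g - f))"
      by (simp add: algebra_simps)
    finally show ?thesis .
  qed
  have ccw': "Im (cnj u * (g - f)) / (norm u)^2 > 0" using ccw \<open>u \<noteq> 0\<close> by (simp add: u_def)
  have \<rho>f: "\<rho> f = 1" using \<open>u \<noteq> 0\<close> by (simp add: \<rho>_def u_def)
  have nonneg: "\<rho> (linepath f g t) \<notin> \<real>\<^sub>\<le>\<^sub>0" if "t \<in> {0..1}" for t
  proof (cases "t = 0")
    case True
    then show ?thesis using \<rho>f by (simp add: linepath_def)
  next
    case False
    then have "Im (\<rho> (linepath f g t)) > 0" using that ccw' Im\<rho>[of t] mult_pos_pos[OF _ ccw', of t] by simp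
    then show ?thesis by (auto simp: complex_nonpos_Reals_iff)
  qed
  have segt: "\<exists>t\<in>{0..1}. z = linepath f g t" if "z \<in> closed_segment f g" for z
    using that by (auto simp: linepath_image_01[symmetric])
  have non: "\<rho> z \<notin> \<real>\<^sub>\<le>\<^sub>0" if "z \<in> closed_segment f g" for z using segt[OF that] nonneg by auto
  have cs: "c \<notin> closed_segment f g" using non[of c] by (auto simp: \<rho>_def)
  have c\<rho>: "continuous_on S \<rho>" for S unfolding \<rho>_def by (intro continuous_intros) (use \<open>u \<noteq> 0\<close> in auto)
  have cLn: "continuous_on (closed_segment f g) (\<lambda>z. Ln (\<rho> z))"
    by (intro continuous_intros c\<rho>) (use non in auto)
  have c\<phi>: "continuous_on (closed_segment f g) \<phi>" unfolding \<phi>_def by (intro continuous_intros cLn)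
  define T where "T = {0..1} \<inter> linepath f g -` K"
  have "compact T" unfolding T_def
    using closedin_compact[OF _ continuous_closedin_preimage[of "{0..1}" "linepath f g" K]] K(1)
    by (auto intro: compact_imp_closed continuous_on_linepath)
  define \<eta> where "\<eta> = (\<lambda>t. \<theta> (linepath f g t) - \<phi> (linepath f g t))"
  have lseg: "linepath f g t \<in> closed_segment f g" if "t \<in> {0..1}" for t using that by (rule linepath_in_path)
  have c\<eta>: "continuous_on T \<eta>" unfolding \<eta>_def
    by (intro continuous_intros continuous_on_compose2[OF \<theta>(1) continuous_on_linepath]
        continuous_on_compose2[OF c\<phi> continuous_on_linepath]) (auto simp: T_def lseg)
  have exp\<eta>: "exp (\<i> * \<eta> t) = exp (\<i> * \<theta> f)" if "t \<in> T" for t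
  proof -
    define z where "z = linepath f g t"
    have z: "z \<in> K" "z \<in> closed_segment f g" using that lseg by (auto simp: T_def z_def)
    then have zc: "z \<noteq> c" using cK by auto
    have "\<rho> z \<noteq> 0" using non[OF z(2)] by auto
    have "\<rho> z = of_real (norm (\<rho> z)) * exp (\<i> * \<phi> z)"
      unfolding \<phi>_def using \<open>\<rho> z \<noteq> 0\<close>
      by (metis Arg_eq_Im_Ln Arg_eq)
    moreover have "\<rho> z = of_real (norm (z - c)) * exp (\<i> * \<theta> z) / (of_real (norm u) * exp (\<i> * \<theta> f))"
      unfolding \<rho>_def using \<theta>(2)[OF z(1)] \<theta>(2)[OF fg(1)] by (simp add: u_def)
    moreover have "norm (\<rho> z) = norm (z - c) / norm u" by (simp add: \<rho>_def norm_divide)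
    ultimately have eq: "of_real (norm (z - c)) / of_real (norm u) * exp (\<i> * \<phi> z) =
        of_real (norm (z - c)) * exp (\<i> * \<theta> z) / (of_real (norm u) * exp (\<i> * \<theta> f))" by simp
    have cancel: "e1 = e2 / e3" if "a \<noteq> 0" "b \<noteq> 0" "e3 \<noteq> 0" "a / b * e1 = a * e2 / (b * e3)" for a b e1 e2 e3 :: complex
      using that by (simp add: field_simps)
    have "exp (\<i> * \<phi> z) = exp (\<i> * \<theta> z) / exp (\<i> * \<theta> f)"
      by (rule cancel[OF _ _ _ eq]) (use zc \<open>u \<noteq> 0\<close> in auto)
    then have "exp (\<i> * \<theta> f) = exp (\<i> * \<theta> z) / exp (\<i> * \<phi> z)"
      by (simp add: field_simps)
    also have "\<dots> = exp (\<i> * \<theta> z - \<i> * \<phi> z)" by (simp add: exp_diff)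
    finally show ?thesis by (simp add: \<eta>_def z_def algebra_simps)
  qed
  have T01: "0 \<in> T" "1 \<in> T" using fg by (auto simp: T_def linepath_def)
  have \<eta>0: "\<eta> 0 = \<theta> f" by (simp add: \<eta>_def \<phi>_def \<rho>f linepath_def)
  have "\<phi> g > 0"
  proof -
    have "Im (\<rho> g) > 0" using Im\<rho>[of 1] ccw' by (simp add: linepath_def)
    then show ?thesis unfolding \<phi>_def by (metis Im_Ln_pos_lt_imp Im_Ln_pos_lt less_irrefl zero_complex.sel(2))
  qed
  then have \<eta>1: "\<eta> 0 \<noteq> \<eta> 1" using le \<eta>0 by (simp add: \<eta>_def linepath_def)
  have gap: "\<bar>\<eta> t - \<eta> 0\<bar> \<ge> 1" if tT: "t \<in> T" "\<eta> t \<noteq> \<eta> 0" for t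
  proof -
    obtain m :: int where m: "\<i> * \<eta> t = \<i> * \<theta> f + (of_int (2 * m) * pi) * \<i>" using exp\<eta>[OF tT(1)] unfolding exp_eq by blast
    then have "\<i> * complex_of_real (\<eta> t) = \<i> * complex_of_real (\<theta> f + 2 * of_int m * pi)" by (simp add: algebra_simps)
    then have "complex_of_real (\<eta> t) = complex_of_real (\<theta> f + 2 * of_int m * pi)" by simp
    then have eq: "\<eta> t - \<eta> 0 = 2 * of_int m * pi" unfolding of_real_eq_iff \<eta>0 by simp
    then have "m \<noteq> 0" using tT(2) by auto
    then have "\<bar>real_of_int m\<bar> \<ge> 1" by linarith
    then have "\<bar>real_of_int m\<bar> * (2 * pi) \<ge> 1 * 1" using pi_gt3 by (intro mult_mono) auto
    moreover have "\<bar>\<eta> t - \<eta> 0\<bar> = \<bar>real_of_int m\<bar> * (2 * pi)" unfolding eq by (simp add: abs_mult)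
    ultimately show ?thesis by simp
  qed
  obtain s t where st: "s \<in> T" "t \<in> T" "\<eta> s \<noteq> \<eta> t" "open_segment s t \<inter> T = {}"
    using compact_jump[OF \<open>compact T\<close> c\<eta> T01 \<eta>1 gap] by metis
  define x where "x = linepath f g s"
  define y where "y = linepath f g t"
  have xyK: "x \<in> K" "y \<in> K" using st by (auto simp: T_def x_def y_def)
  have st01: "s \<in> {0..1}" "t \<in> {0..1}" using st by (auto simp: T_def)
  have xys: "x \<in> closed_segment f g" "y \<in> closed_segment f g" using lseg st01 by (auto simp: x_def y_def)
  have "x \<noteq> y" using st(3) by (auto simp: \<eta>_def x_def y_def)
  have os: "open_segment x y \<inter> K = {}"
  proof -
    have False if z: "z \<in> open_segment x y" "z \<in> K" for z
    proof -
      obtain r where r: "0 < r" "r < 1" "z = (1-r) *\<^sub>R x + r *\<^sub>R y" using z(1) by (auto simp: in_segment)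
      define \<tau> where "\<tau> = (1-r) * s + r * t"
      have "s \<noteq> t" using st(3) by auto
      then have \<tau>: "\<tau> \<in> open_segment s t" using r by (auto simp: in_segment \<tau>_def)
      moreover have "\<tau> \<in> {0..1}"
        using \<tau> st01 by (auto simp: open_segment_eq_real_ivl split: if_splits)
      moreover have "z = linepath f g \<tau>" unfolding r(3) x_def y_def \<tau>_def linepath_def by (simp add: algebra_simps)
      ultimately show False using st(4) z(2) by (auto simp: T_def)
    qed
    then show ?thesis by blast
  qed
  obtain \<gamma> where \<gamma>: "arc \<gamma>" "path_image \<gamma> \<subseteq> K" "pathstart \<gamma> = x" "pathfinish \<gamma> = y"
    using K(2) xyK \<open>x \<noteq> y\<close> unfolding path_connected_arcwise by metis
  have p\<gamma>: "path \<gamma>" using \<gamma>(1) by (rule arc_imp_path)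
  have c\<gamma>: "c \<notin> path_image \<gamma>" using \<gamma>(2) cK by auto
  have \<gamma>K: "\<gamma> \<tau> \<in> K" if "\<tau> \<in> {0..1}" for \<tau> using \<gamma>(2) that by (auto simp: path_image_def)
  have ends: "\<gamma> 0 = x" "\<gamma> 1 = y" using \<gamma>(3,4) by (auto simp: pathstart_def pathfinish_def)
  define q where "q = (\<lambda>\<tau>. of_real (ln (norm (\<gamma> \<tau> - c))) + \<i> * \<theta> (\<gamma> \<tau>))"
  have w1: "winding_number \<gamma> c = (q 1 - q 0) / (2 * complex_of_real pi * \<i>)"
  proof (rule winding_number_from_log[OF p\<gamma>])
    have cg: "continuous_on {0..1} \<gamma>" using p\<gamma> by (simp add: path_def)
    show "continuous_on {0..1} q" unfolding q_def
      by (intro continuous_intros cg continuous_on_compose2[OF \<theta>(1) cg]) (use \<gamma>K cK in auto)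
    fix \<tau> :: real assume "\<tau> \<in> {0..1}"
    then have "\<gamma> \<tau> \<in> K" by (rule \<gamma>K)
    then have "\<gamma> \<tau> \<noteq> c" using cK by auto
    then have "exp (complex_of_real (ln (norm (\<gamma> \<tau> - c)))) = of_real (norm (\<gamma> \<tau> - c))"
      by (simp add: exp_of_real)
    then show "\<gamma> \<tau> = c + exp (q \<tau>)" using \<theta>(2)[OF \<open>\<gamma> \<tau> \<in> K\<close>] by (simp add: q_def exp_add algebra_simps)
  qed
  \<comment> \<open>A logarithm of \<open>z - c\<close> along the chord: the principal one of the
    quotient by \<open>u\<close>, plus the constant \<open>Ln u\<close>.\<close>
  define q' where "q' = (\<lambda>\<tau>. Ln (\<rho> (linepath y x \<tau>)) + Ln u)"
  have sub: "closed_segment y x \<subseteq> closed_segment f g" using xys by (simp add: subset_closed_segment)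
  have w2: "winding_number (linepath y x) c = (q' 1 - q' 0) / (2 * complex_of_real pi * \<i>)"
  proof (rule winding_number_from_log)
    show "continuous_on {0..1} q'" unfolding q'_def
      by (intro continuous_intros continuous_on_compose2[OF cLn continuous_on_linepath])
        (use sub linepath_in_path in blast)
    fix \<tau> :: real assume "\<tau> \<in> {0..1}"
    then have "linepath y x \<tau> \<in> closed_segment f g" using sub linepath_in_path by blast
    then have "\<rho> (linepath y x \<tau>) \<noteq> 0" using non by fastforce
    then show "linepath y x \<tau> = c + exp (q' \<tau>)" using \<open>u \<noteq> 0\<close> by (simp add: q'_def exp_add \<rho>_def)
  qed auto
  have "winding_number (\<gamma> +++ linepath y x) c \<noteq> 0"
  proof
    assume W: "winding_number (\<gamma> +++ linepath y x) c = 0"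
    have "c \<notin> closed_segment y x" using sub cs by blast
    then have "winding_number \<gamma> c + winding_number (linepath y x) c = 0"
      using W winding_number_join[OF p\<gamma> c\<gamma>, of "linepath y x"] \<gamma> by simp
    then have "(q 1 - q 0) + (q' 1 - q' 0) = 0" unfolding w1 w2 by (simp flip: add_divide_distrib)
    then have "Im ((q 1 - q 0) + (q' 1 - q' 0)) = 0" by simp
    then have "\<theta> y - \<theta> x + (\<phi> x - \<phi> y) = 0" by (simp add: q_def q'_def ends \<phi>_def linepath_def)
    then show False using st(3) by (simp add: \<eta>_def x_def y_def)
  qed
  then show ?thesis using that[of x y \<gamma>] xys \<gamma> os by blast
qed

text \<open>If \<open>c\<close> lies in a bounded component of the complement of \<open>K\<close>, any \<open>y \<in> F\<close> works: a translate of \<open>K\<close> disjoint from \<open>K\<close>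
  that meets the disc would lie in the hull of \<open>K\<close>. Otherwise \<open>K\<close> carries a continuous argument \<open>\<theta>\<close> around \<open>c\<close>;
  it is inconsistent along the hull edge leaving the supporting point with the largest \<open>\<theta>\<close>,
  hence an arc in \<open>K\<close> and a chord of \<open>K\<close> on this edge enclose the disc, and \<open>y\<close> is an end of that chord.\<close>

lemma chord_from_missed_ball_complex:
  fixes U F :: "complex set"
  assumes U: "path_connected U" and F: "finite F" "F \<subseteq> U" and r: "r > 0"
    and ball: "ball c r \<subseteq> convex hull F" "U \<inter> ball c r = {}"
  shows "\<exists>y\<in>convex hull F. \<forall>d\<in>ball c r. \<exists>p\<in>U. p + (d - y) \<in> U"
proof -
  obtain K where K: "compact K" "path_connected K" "F \<subseteq> K" "K \<subseteq> U"
    using finite_subset_compact_path_connected[OF U F] by blast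
  have KB: "K \<inter> ball c r = {}" using K(4) ball(2) by auto
  have cB: "c \<in> ball c r" using r by simp
  have cK: "c \<notin> K" using KB cB by auto
  have cI: "c \<in> interior (convex hull F)" using ball(1) r by (auto simp: mem_interior)
  have "F \<noteq> {}" using cI by auto
  show ?thesis
  proof (cases "c \<in> inside K")
    case True
    obtain f where f: "f \<in> F" using \<open>F \<noteq> {}\<close> by auto
    have "\<exists>p\<in>U. p + (d - f) \<in> U" if d: "d \<in> ball c r" for d
    proof (rule ccontr)
      assume no: "\<not> ?thesis"
      define v where "v = d - f"
      define K' where "K' = (\<lambda>z. z + v) ` K"
      have K'K: "K' \<inter> K = {}" using no K(4) unfolding K'_def v_def by auto
      have "d \<in> K'" unfolding K'_def v_def using f K(3) by (auto intro!: image_eqI[of _ _ f])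
      have "connected K'" unfolding K'_def
        using K(2) by (intro connected_continuous_image continuous_intros path_connected_imp_connected)
      then have conn: "connected (ball c r \<union> K')" using d \<open>d \<in> K'\<close> by (intro connected_Un) auto
      have sub: "ball c r \<union> K' \<subseteq> - K" using K'K KB by auto
      have "K' \<subseteq> inside K"
      proof
        fix z assume z: "z \<in> K'"
        have "connected_component (- K) c z"
          using conn sub cB z unfolding connected_component_def by blast
        then have "connected_component_set (- K) c = connected_component_set (- K) z"
          by (simp add: connected_component_eq_eq connected_component_in connected_component_eq)
        then show "z \<in> inside K" using True z sub unfolding inside_def by auto
      qed
      moreover have "inside K \<subseteq> convex hull K"
        using outside_subset_convex[OF convex_convex_hull hull_subset] inside_Int_outside[of K] by blast
      ultimately have K'h: "K' \<subseteq> convex hull K" by blast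
      \<comment> \<open>The translation moves the point of \<open>K\<close> farthest in direction
        \<open>v\<close> out of the hull unless \<open>v = 0\<close>; but then \<open>K'\<close> is
        \<open>K\<close>, which is not disjoint from itself.\<close>
      have "K \<noteq> {}" using f K(3) by auto
      then obtain z0 where z0: "z0 \<in> K" "\<And>z. z \<in> K \<Longrightarrow> v \<bullet> z \<le> v \<bullet> z0"
        using continuous_attains_sup[OF K(1), of "\<lambda>z. v \<bullet> z"] by (force intro: continuous_intros)
      have "convex hull K \<subseteq> {z. v \<bullet> z \<le> v \<bullet> z0}" using z0 by (intro hull_minimal convex_halfspace_le) auto
      moreover have "z0 + v \<in> K'" using z0 by (auto simp: K'_def)
      ultimately have "v \<bullet> (z0 + v) \<le> v \<bullet> z0" using K'h by auto
      then have "v \<bullet> v \<le> 0" by (simp add: inner_add_right)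
      then have "v = 0" by (metis inner_gt_zero_iff not_less)
      then show False using K'K z0 by (auto simp: K'_def)
    qed
    then show ?thesis using f by (intro bexI[of _ f]) (auto simp: hull_inc)
  next
    case False
    \<comment> \<open>By Borsuk's criterion the radial projection of \<open>K\<close> from
      \<open>c\<close> to the circle is null-homotopic, hence has a continuous argument.\<close>
    then have "\<not> bounded (connected_component_set (- K) c)" using cK unfolding inside_def by auto
    then obtain a where "homotopic_with_canon (\<lambda>x. True) K (sphere 0 1) (\<lambda>x. (x - c) /\<^sub>R norm (x - c)) (\<lambda>x. a)"
      using Borsuk_map_essential_bounded_component[OF K(1) cK] by blast
    then obtain \<theta> where \<theta>: "continuous_on K \<theta>" "\<forall>z\<in>K. (z - c) /\<^sub>R norm (z - c) = exp (\<i> * complex_of_real (\<theta> z))"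
      using inessential_eq_continuous_logarithm_circle[of K "\<lambda>x. (x - c) /\<^sub>R norm (x - c)"] by blast
    have \<theta>': "z - c = of_real (norm (z - c)) * exp (\<i> * \<theta> z)" if "z \<in> K" for z
    proof -
      have "norm (z - c) \<noteq> 0" using that cK by auto
      then have "z - c = norm (z - c) *\<^sub>R ((z - c) /\<^sub>R norm (z - c))" by simp
      also have "\<dots> = norm (z - c) *\<^sub>R exp (\<i> * \<theta> z)" using \<theta>(2) that by simp
      finally show ?thesis by (simp add: scaleR_conv_of_real)
    qed
    obtain f g where fg: "f \<in> F" "g \<in> F" "\<theta> g \<le> \<theta> f" "0 < Im (cnj (f - c) * (g - f))"
      "\<And>z. z \<in> convex hull F \<Longrightarrow> 0 \<le> Im (cnj (g - f) * (z - f))"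
      using finite_hull_supporting_edge[OF F(1) cI, of \<theta>] by metis
    obtain x y \<gamma> where xy: "x \<in> closed_segment f g" "y \<in> closed_segment f g"
      and \<gamma>: "arc \<gamma>" "pathstart \<gamma> = x" "pathfinish \<gamma> = y" "path_image \<gamma> \<subseteq> K"
      and os: "open_segment x y \<inter> K = {}" and wn: "winding_number (\<gamma> +++ linepath y x) c \<noteq> 0"
      by (rule inconsistent_chord[OF K(1,2) subsetD[OF K(3) fg(1)] subsetD[OF K(3) fg(2)] \<theta>(1) \<theta>' fg(3,4) cK])
    have "g \<noteq> f" using fg(4) by auto
    \<comment> \<open>A point of the disc on the edge could be pushed outwards across the edge
      within the disc, and so within the hull, which lies on the inner side.\<close>
    have segB: "z \<notin> closed_segment f g" if z: "z \<in> ball c r" for z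
    proof
      assume "z \<in> closed_segment f g"
      then obtain t where t: "z = (1 - t) *\<^sub>R f + t *\<^sub>R g" by (auto simp: in_segment)
      then have "z - f = t *\<^sub>R (g - f)" by (simp add: algebra_simps)
      have lin: "Im (cnj d * (t *\<^sub>R d)) = 0" "Im (cnj d * (X - s *\<^sub>R (\<i> * d))) = Im (cnj d * X) - s * (norm d)\<^sup>2"
        for d X s unfolding cmod_power2 by (simp_all add: algebra_simps power2_eq_square)
      have z0: "Im (cnj (g - f) * (z - f)) = 0" unfolding \<open>z - f = _\<close> by (rule lin)
      obtain e where e: "e > 0" "cball z e \<subseteq> ball c r" using z open_ball open_contains_cball by blast
      define d where "d = z - (e / norm (g - f)) *\<^sub>R (\<i> * (g - f))"
      have "d \<in> cball z e" using \<open>g \<noteq> f\<close> e(1) by (simp add: d_def dist_norm norm_mult)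
      then have "d \<in> convex hull F" using e(2) ball(1) by auto
      then have "0 \<le> Im (cnj (g - f) * (d - f))" by (rule fg(5))
      also have "d - f = (z - f) - (e / norm (g - f)) *\<^sub>R (\<i> * (g - f))" by (simp add: d_def)
      also have "Im (cnj (g - f) * \<dots>) = - (e / norm (g - f)) * (norm (g - f))\<^sup>2"
        unfolding lin z0 by simp
      finally show False using \<open>g \<noteq> f\<close> e(1) by (simp add: zero_le_mult_iff mult_le_0_iff power2_eq_square)
    qed
    have xysub: "closed_segment x y \<subseteq> closed_segment f g" using xy by (simp add: subset_closed_segment)
    let ?J = "\<gamma> +++ linepath y x"
    have "ball c r \<inter> path_image ?J = {}"
      using KB \<gamma> segB xysub by (auto simp: path_image_join closed_segment_commute)
    \<comment> \<open>Constancy on the disc is what lets the same \<open>y\<close> serve for every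
      \<open>d\<close>.\<close>
    then have "winding_number ?J constant_on ball c r"
      using \<gamma> by (intro winding_number_constant) (auto simp: arc_imp_path)
    then have wd: "winding_number ?J d \<noteq> 0" if "d \<in> ball c r" for d
      using wn that cB unfolding constant_on_def by metis
    have "\<exists>p\<in>U. p + (d - y) \<in> U" if d: "d \<in> ball c r" for d
    proof -
      have "path_image \<gamma> \<inter> open_segment x y = {}" using os \<gamma>(4) by auto
      moreover have "d \<notin> closed_segment x y" using segB[OF d] xysub by auto
      ultimately obtain p where "p \<in> path_image \<gamma>" "p + (d - y) \<in> path_image \<gamma>"
        using chord_of_enclosed_point[OF \<gamma>(1-3) _ _ wd[OF d]] by blast
      then show ?thesis using \<gamma>(4) K(4) by blast
    qed
    moreover have "y \<in> convex hull F"
      using xy(2) fg(1,2) closed_segment_subset_convex_hull[of f F g] by (auto simp: hull_inc)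
    ultimately show ?thesis by blast
  qed
qed

section \<open>Grids of translates\<close>

text \<open>Extend \<open>f\<close> horizontally to the left, and a path in \<open>V\<close> from
  \<open>zb\<close> to \<open>zt\<close> vertically down and up. By \<open>fashoda\<close> the
  extended curves meet; the bounds on \<open>f\<close> and \<open>V\<close> keep each added segment
  away from the other curve, so the meeting point lies on \<open>f\<close> and in
  \<open>V\<close>.\<close>

lemma path_crosses_barrier:
  fixes f :: "real \<Rightarrow> real^2" and V :: "(real^2) set"
  assumes f: "path f" "\<And>z. z \<in> path_image f \<Longrightarrow> z$1 \<le> \<beta> \<and> zb$2 < z$2 \<and> z$2 < zt$2"
    and ends: "pathstart f $ 1 < \<alpha>" "pathfinish f $ 1 = \<beta>"
    and V: "path_connected V" "\<And>z. z \<in> V \<Longrightarrow> \<alpha> \<le> z$1 \<and> z$1 \<le> \<beta>" "zb \<in> V" "zt \<in> V"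
  shows "path_image f \<inter> V \<noteq> {}"
proof
  assume disj: "path_image f \<inter> V = {}"
  obtain g where g: "path g" "path_image g \<subseteq> V" "pathstart g = zb" "pathfinish g = zt"
    using V(1,3,4) unfolding path_connected_def by blast
  have "bounded (path_image f \<union> path_image g)" using f(1) g(1) by (simp add: bounded_path_image)
  then obtain B where B: "\<And>z. z \<in> path_image f \<union> path_image g \<Longrightarrow> norm z \<le> B" unfolding bounded_iff by blast
  have comp: "\<bar>z$i\<bar> \<le> B" if "z \<in> path_image f \<union> path_image g" for z i
    using B[OF that] component_le_norm_cart[of z i] by linarith
  define p where "p = pathstart f"
  have pf: "p \<in> path_image f" unfolding p_def by (rule pathstart_in_path_image)
  define lp :: "real^2" where "lp = vector [-B-1, p$2]"
  define zb' :: "real^2" where "zb' = vector [zb$1, -B-1]"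
  define zt' :: "real^2" where "zt' = vector [zt$1, B+1]"
  have vs: "lp$1 = -B-1" "lp$2 = p$2" "zb'$1 = zb$1" "zb'$2 = -B-1" "zt'$1 = zt$1" "zt'$2 = B+1"
    by (simp_all add: lp_def zb'_def zt'_def)
  have z01: "zb \<in> path_image g" "zt \<in> path_image g" using g pathstart_in_path_image pathfinish_in_path_image by metis+
  have b0: "\<bar>zb$2\<bar> \<le> B" "\<bar>zt$2\<bar> \<le> B" "\<bar>zb$1\<bar> \<le> B" "\<bar>zt$1\<bar> \<le> B" "\<bar>p$1\<bar> \<le> B" "\<bar>p$2\<bar> \<le> B" using comp z01 pf by auto
  have segI: "min (x$1) (y$1) \<le> z$1 \<and> z$1 \<le> max (x$1) (y$1) \<and> min (x$2) (y$2) \<le> z$2 \<and> z$2 \<le> max (x$2) (y$2)"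
    if z: "z \<in> closed_segment x y" for z x y :: "real^2"
  proof -
    have "z$i \<in> closed_segment (x$i) (y$i)" for i
      using z by (auto simp: in_segment)
    then show ?thesis by (auto simp: closed_segment_eq_real_ivl split: if_splits dest!: spec[of _ 1] spec[of _ 2])
        (smt (verit) atLeastAtMost_iff)+
  qed
  have s1: "z$2 = p$2 \<and> -B-1 \<le> z$1 \<and> z$1 \<le> p$1" if "z \<in> closed_segment lp p" for z
    using segI[OF that] vs b0 by auto
  have s2: "z$1 = zb$1 \<and> -B-1 \<le> z$2 \<and> z$2 \<le> zb$2" if "z \<in> closed_segment zb' zb" for z
    using segI[OF that] vs b0 by auto
  have s3: "z$1 = zt$1 \<and> zt$2 \<le> z$2 \<and> z$2 \<le> B+1" if "z \<in> closed_segment zt zt'" for z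
    using segI[OF that] vs b0 by auto
  define f' where "f' = linepath lp p +++ f"
  define g' where "g' = linepath zb' zb +++ g +++ linepath zt zt'"
  have imf: "path_image f' = closed_segment lp p \<union> path_image f" unfolding f'_def by (simp add: path_image_join p_def)
  have img: "path_image g' = closed_segment zb' zb \<union> path_image g \<union> closed_segment zt zt'"
    unfolding g'_def using g by (simp add: path_image_join Un_assoc)
  have \<alpha>: "\<alpha> \<le> zb$1" "zb$1 \<le> \<beta>" "\<alpha> \<le> zt$1" "zt$1 \<le> \<beta>" using V by auto
  have p\<beta>: "p$1 < \<alpha>" "zb$2 < p$2" "p$2 < zt$2" using ends(1) f(2)[OF pf] by (auto simp: p_def)
  have "\<exists>z. z \<in> path_image f' \<and> z \<in> path_image g'"
  proof -
    define lo :: "real^2" where "lo = vector [-B-1, -B-1]"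
    define hi :: "real^2" where "hi = vector [\<beta>, B+1]"
    have lh: "lo$1 = -B-1" "lo$2 = -B-1" "hi$1 = \<beta>" "hi$2 = B+1" by (simp_all add: lo_def hi_def)
    have "path_image f' \<subseteq> cbox lo hi"
    proof
      fix z assume "z \<in> path_image f'"
      then have "z \<in> closed_segment lp p \<or> z \<in> path_image f" unfolding imf by blast
      then have "-B-1 \<le> z$1 \<and> z$1 \<le> \<beta> \<and> -B-1 \<le> z$2 \<and> z$2 \<le> B+1"
      proof
        assume "z \<in> closed_segment lp p"
        from s1[OF this] show ?thesis using b0 \<alpha> p\<beta> by linarith
      next
        assume zf: "z \<in> path_image f"
        then have "\<bar>z$1\<bar> \<le> B" "\<bar>z$2\<bar> \<le> B" using comp[of z] by auto
        then show ?thesis using f(2)[OF zf] by linarith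
      qed
      then show "z \<in> cbox lo hi" by (simp add: mem_box_cart forall_2 lh)
    qed
    moreover have "path_image g' \<subseteq> cbox lo hi"
    proof
      fix z assume "z \<in> path_image g'"
      then have "z \<in> closed_segment zb' zb \<or> z \<in> path_image g \<or> z \<in> closed_segment zt zt'" unfolding img by blast
      then have "-B-1 \<le> z$1 \<and> z$1 \<le> \<beta> \<and> -B-1 \<le> z$2 \<and> z$2 \<le> B+1"
      proof (elim disjE)
        assume "z \<in> closed_segment zb' zb"
        from s2[OF this] show ?thesis using b0 \<alpha> by linarith
      next
        assume "z \<in> closed_segment zt zt'"
        from s3[OF this] show ?thesis using b0 \<alpha> by linarith
      next
        assume zg: "z \<in> path_image g"
        then have "\<bar>z$1\<bar> \<le> B" "\<bar>z$2\<bar> \<le> B" using comp[of z] by auto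
        then show ?thesis using V(2)[of z] zg g(2) by (smt (verit) subsetD)
      qed
      then show "z \<in> cbox lo hi" by (simp add: mem_box_cart forall_2 lh)
    qed
    moreover have "path f'" "path g'" unfolding f'_def g'_def using f(1) g by (auto simp: p_def)
    moreover have "pathstart f' $ 1 = lo $ 1" "pathfinish f' $ 1 = hi $ 1" "pathstart g' $ 2 = lo $ 2" "pathfinish g' $ 2 = hi $ 2"
      unfolding f'_def g'_def using ends vs lh by auto
    ultimately show ?thesis using fashoda by metis
  qed
  then obtain z where z: "z \<in> closed_segment lp p \<or> z \<in> path_image f"
      "z \<in> closed_segment zb' zb \<or> z \<in> path_image g \<or> z \<in> closed_segment zt zt'"
    unfolding imf img by blast
  have n1: "\<not> (z \<in> closed_segment lp p \<and> z \<in> closed_segment zb' zb)"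
    using s1[of z] s2[of z] \<alpha> p\<beta> by linarith
  have n2: "\<not> (z \<in> closed_segment lp p \<and> z \<in> closed_segment zt zt')"
    using s1[of z] s3[of z] \<alpha> p\<beta> by linarith
  have n3: "\<not> (z \<in> closed_segment lp p \<and> z \<in> path_image g)"
    using s1[of z] V(2)[of z] g(2) p\<beta> by (smt (verit) subsetD)
  have n4: "\<not> (z \<in> path_image f \<and> z \<in> closed_segment zb' zb)"
    using f(2)[of z] s2[of z] by linarith
  have n5: "\<not> (z \<in> path_image f \<and> z \<in> closed_segment zt zt')"
    using f(2)[of z] s3[of z] by linarith
  have n6: "\<not> (z \<in> path_image f \<and> z \<in> path_image g)" using disj g(2) by blast
  show False using z n1 n2 n3 n4 n5 n6 by blast
qed

text \<open>This reflection and the next carry the left, upper and lower sides of a square to a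
  right-hand side, so that \<open>path_crosses_barrier\<close> covers all four.\<close>

definition swap2 :: "real^2 \<Rightarrow> real^2" where "swap2 z = vector [z$2, z$1]"
definition flip2 :: "real^2 \<Rightarrow> real^2" where "flip2 z = vector [- (z$1), z$2]"

lemma swap2_simps [simp]: "swap2 z $ 1 = z $ 2" "swap2 z $ 2 = z $ 1"
  by (simp_all add: swap2_def)
lemma flip2_simps [simp]: "flip2 z $ 1 = - (z $ 1)" "flip2 z $ 2 = z $ 2"
  by (simp_all add: flip2_def)

lemma linear_swap2: "linear swap2" and linear_flip2: "linear flip2"
  by (auto intro!: linearI simp: vec_eq_iff forall_2)

lemma path_crosses_barrier_image:
  fixes f :: "real \<Rightarrow> real^2" and V :: "(real^2) set" and T :: "real^2 \<Rightarrow> real^2"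
  assumes T: "linear T" "inj T"
    and f: "path f" "\<And>z. z \<in> path_image f \<Longrightarrow> T z$1 \<le> \<beta> \<and> T zb$2 < T z$2 \<and> T z$2 < T zt$2"
    and ends: "T (pathstart f) $ 1 < \<alpha>" "T (pathfinish f) $ 1 = \<beta>"
    and V: "path_connected V" "\<And>z. z \<in> V \<Longrightarrow> \<alpha> \<le> T z$1 \<and> T z$1 \<le> \<beta>" "zb \<in> V" "zt \<in> V"
  shows "path_image f \<inter> V \<noteq> {}"
proof -
  have cT: "continuous_on S T" for S using T(1) linear_continuous_on linear_conv_bounded_linear by blast
  have "path_image (T \<circ> f) \<inter> T ` V \<noteq> {}"
  proof (rule path_crosses_barrier)
    show "path (T \<circ> f)" by (intro path_continuous_image f cT)
    show "path_connected (T ` V)" by (intro path_connected_continuous_image V cT)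
    show "z$1 \<le> \<beta> \<and> T zb$2 < z$2 \<and> z$2 < T zt$2" if "z \<in> path_image (T \<circ> f)" for z
      using that f(2) by (auto simp: path_image_compose)
    show "\<alpha> \<le> z$1 \<and> z$1 \<le> \<beta>" if "z \<in> T ` V" for z using that V(2) by auto
  qed (use V ends in \<open>auto simp: pathstart_compose pathfinish_compose\<close>)
  then show ?thesis using inj_eq[OF T(2)] by (auto simp: path_image_compose)
qed

text \<open>A path leaving the square of half-width \<open>b\<close> around \<open>c\<close> first
  reaches its frontier on one of the four sides. Up to then it stays in the square, and it must
  cross the strip between half-widths \<open>a\<close> and \<open>b\<close> on that side, where a
  barrier longer than the square blocks it.\<close>

lemma trapped_between_barriers:
  fixes W VR VL HT HB :: "(real^2) set"
  assumes W: "path_connected W" and p: "p \<in> W" "\<bar>p$1 - c$1\<bar> < a" "\<bar>p$2 - c$2\<bar> < a" and ab: "a \<le> b"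
    and VR: "path_connected VR" "\<And>z. z \<in> VR \<Longrightarrow> c$1 + a \<le> z$1 \<and> z$1 \<le> c$1 + b"
      "r0 \<in> VR" "r0$2 < c$2 - b" "r1 \<in> VR" "c$2 + b < r1$2"
    and VL: "path_connected VL" "\<And>z. z \<in> VL \<Longrightarrow> c$1 - b \<le> z$1 \<and> z$1 \<le> c$1 - a"
      "l0 \<in> VL" "l0$2 < c$2 - b" "l1 \<in> VL" "c$2 + b < l1$2"
    and HT: "path_connected HT" "\<And>z. z \<in> HT \<Longrightarrow> c$2 + a \<le> z$2 \<and> z$2 \<le> c$2 + b"
      "t0 \<in> HT" "t0$1 < c$1 - b" "t1 \<in> HT" "c$1 + b < t1$1"
    and HB: "path_connected HB" "\<And>z. z \<in> HB \<Longrightarrow> c$2 - b \<le> z$2 \<and> z$2 \<le> c$2 - a"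
      "b0 \<in> HB" "b0$1 < c$1 - b" "b1 \<in> HB" "c$1 + b < b1$1"
    and disj: "W \<inter> (VR \<union> VL \<union> HT \<union> HB) = {}"
    and q: "q \<in> W"
  shows "\<bar>q$1 - c$1\<bar> \<le> b \<and> \<bar>q$2 - c$2\<bar> \<le> b"
proof (rule ccontr)
  assume far: "\<not> ?thesis"
  define lo :: "real^2" where "lo = vector [c$1 - b, c$2 - b]"
  define hi :: "real^2" where "hi = vector [c$1 + b, c$2 + b]"
  have lh: "lo$1 = c$1 - b" "lo$2 = c$2 - b" "hi$1 = c$1 + b" "hi$2 = c$2 + b" by (simp_all add: lo_def hi_def)
  have box: "z \<in> cbox lo hi \<longleftrightarrow> \<bar>z$1 - c$1\<bar> \<le> b \<and> \<bar>z$2 - c$2\<bar> \<le> b" for z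
    by (auto simp: mem_box_cart forall_2 lh)
  obtain g where g: "path g" "path_image g \<subseteq> W" "pathstart g = p" "pathfinish g = q"
    using W p(1) q unfolding path_connected_def by blast
  have "pathstart g \<in> cbox lo hi" "pathfinish g \<notin> cbox lo hi" using p ab far g unfolding box by auto
  then obtain f where f: "path f" "pathstart f = p" "path_image f \<subseteq> path_image g \<inter> cbox lo hi"
      "pathfinish f \<in> frontier (cbox lo hi)"
    using exists_path_subpath_to_frontier_closed[OF closed_cbox g(1)] g(3) by metis
  have fz: "\<bar>z$1 - c$1\<bar> \<le> b \<and> \<bar>z$2 - c$2\<bar> \<le> b" if "z \<in> path_image f" for z using f(3) that box by blast
  have fW: "path_image f \<inter> (VR \<union> VL \<union> HT \<union> HB) = {}" using f(3) g(2) disj by blast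
  define e where "e = pathfinish f"
  have "e \<in> cbox lo hi - box lo hi" using f(4) by (simp add: e_def frontier_cbox)
  then have e: "e$1 = c$1 + b \<or> e$1 = c$1 - b \<or> e$2 = c$2 + b \<or> e$2 = c$2 - b"
    by (auto simp: mem_box_cart forall_2 lh)
  have injs: "inj swap2" "inj flip2" "inj (flip2 \<circ> swap2)"
    by (auto simp: inj_def vec_eq_iff forall_2 comp_def)
  have lfs: "linear (flip2 \<circ> swap2)" by (intro linear_compose linear_swap2 linear_flip2)
  from e show False
  proof (elim disjE)
    assume e1: "e$1 = c$1 + b"
    have "path_image f \<inter> VR \<noteq> {}"
    proof (rule path_crosses_barrier[where zb=r0 and zt=r1 and \<alpha>="c$1+a" and \<beta>="c$1+b"])
      show "z$1 \<le> c$1+b \<and> r0$2 < z$2 \<and> z$2 < r1$2" if "z \<in> path_image f" for z using fz[OF that] VR by linarith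
    qed (use f VR p e1 in \<open>auto simp: e_def\<close>)
    then show False using fW by blast
  next
    assume e1: "e$1 = c$1 - b"
    have "path_image f \<inter> VL \<noteq> {}"
    proof (rule path_crosses_barrier_image[OF linear_flip2 injs(2), where zb=l0 and zt=l1 and \<alpha>="-c$1+a" and \<beta>="-c$1+b"])
      show "flip2 z$1 \<le> -c$1+b \<and> flip2 l0$2 < flip2 z$2 \<and> flip2 z$2 < flip2 l1$2" if "z \<in> path_image f" for z
        using fz[OF that] VL by (simp, linarith)
      show "-c$1+a \<le> flip2 z$1 \<and> flip2 z$1 \<le> -c$1+b" if "z \<in> VL" for z using VL(2)[OF that] by simp
    qed (use f VL p e1 in \<open>auto simp: e_def\<close>)
    then show False using fW by blast
  next
    assume e1: "e$2 = c$2 + b"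
    have "path_image f \<inter> HT \<noteq> {}"
    proof (rule path_crosses_barrier_image[OF linear_swap2 injs(1), where zb=t0 and zt=t1 and \<alpha>="c$2+a" and \<beta>="c$2+b"])
      show "swap2 z$1 \<le> c$2+b \<and> swap2 t0$2 < swap2 z$2 \<and> swap2 z$2 < swap2 t1$2" if "z \<in> path_image f" for z
        using fz[OF that] HT by (simp, linarith)
      show "c$2+a \<le> swap2 z$1 \<and> swap2 z$1 \<le> c$2+b" if "z \<in> HT" for z using HT(2)[OF that] by simp
    qed (use f HT p e1 in \<open>auto simp: e_def\<close>)
    then show False using fW by blast
  next
    assume e1: "e$2 = c$2 - b"
    have "path_image f \<inter> HB \<noteq> {}"
    proof (rule path_crosses_barrier_image[OF lfs injs(3), where zb=b0 and zt=b1 and \<alpha>="-c$2+a" and \<beta>="-c$2+b"])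
      show "(flip2 \<circ> swap2) z$1 \<le> -c$2+b \<and> (flip2 \<circ> swap2) b0$2 < (flip2 \<circ> swap2) z$2 \<and> (flip2 \<circ> swap2) z$2 < (flip2 \<circ> swap2) b1$2"
        if "z \<in> path_image f" for z
        using fz[OF that] HB by (simp, linarith)
      show "-c$2+a \<le> (flip2 \<circ> swap2) z$1 \<and> (flip2 \<circ> swap2) z$1 \<le> -c$2+b" if "z \<in> HB" for z using HB(2)[OF that] by simp
    qed (use f HB p e1 in \<open>auto simp: e_def\<close>)
    then show False using fW by blast
  qed
qed

text \<open>Consecutive translates share a translate of \<open>x + d\<close>, so they form one
  connected row. These rows are the barriers of the grid.\<close>

lemma path_connected_Union_translates:
  fixes A :: "'a::real_normed_vector set"
  assumes A: "path_connected A" "x \<in> A" "x + d \<in> A"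
  shows "path_connected (\<Union>k\<le>N::nat. (\<lambda>z. z + b + real k *\<^sub>R d) ` A)"
proof (induction N)
  case 0
  have "path_connected ((\<lambda>z. z + b + real 0 *\<^sub>R d) ` A)"
    by (intro path_connected_continuous_image continuous_intros A)
  then show ?case by simp
next
  case (Suc N)
  have "path_connected ((\<lambda>z. z + b + real (Suc N) *\<^sub>R d) ` A)"
    by (intro path_connected_continuous_image continuous_intros A)
  moreover have "x + b + real (Suc N) *\<^sub>R d \<in> (\<lambda>z. z + b + real (Suc N) *\<^sub>R d) ` A" using A(2) by blast
  moreover have "x + b + real (Suc N) *\<^sub>R d \<in> (\<lambda>z. z + b + real N *\<^sub>R d) ` A"
    using A(3) by (intro image_eqI[of _ _ "x + d"]) (auto simp: algebra_simps)
  ultimately show ?case using Suc.IH unfolding atMost_Suc UN_insert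
    by (intro path_connected_Un) auto
qed

text \<open>In coordinates with basis \<open>d1\<close>, \<open>d2\<close> the rows and columns of
  the grid stay within \<open>H\<close> of straight lines. Those with index \<open>n\<close> and
  \<open>3 n\<close> surround the centre at \<open>2 n\<close>, and they run from 0 to
  \<open>4 n\<close>, beyond the corners of the frame. A connected set that meets the central ball
  and avoids them is bounded.\<close>

lemma grid_trap:
  fixes A :: "(real^2) set"
  assumes A: "compact A" "path_connected A" "x1 \<in> A" "x1 + d1 \<in> A" "x2 \<in> A" "x2 + d2 \<in> A"
    and indep: "cross2 d1 d2 \<noteq> 0" and a: "a \<in> A"
  shows "\<exists>n0::nat. \<forall>n\<ge>n0. \<forall>W b. path_connected W \<longrightarrow> \<not> bounded W \<longrightarrow>
     (\<forall>i\<le>4*n. \<forall>j\<le>4*n. W \<inter> (\<lambda>z. z + b + real i *\<^sub>R d1 + real j *\<^sub>R d2) ` A = {}) \<longrightarrow>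
     W \<inter> ball (a + b + real (2*n) *\<^sub>R (d1 + d2)) r = {}"
proof -
  define \<delta> where "\<delta> = cross2 d1 d2"
  \<comment> \<open>The coordinates in the basis \<open>d1\<close>, \<open>d2\<close>, by Cramer's
    rule.\<close>
  define M :: "real^2 \<Rightarrow> real^2" where "M = (\<lambda>z. vector [cross2 z d2 / \<delta>, cross2 d1 z / \<delta>])"
  have M: "M z $ 1 = cross2 z d2 / \<delta>" "M z $ 2 = cross2 d1 z / \<delta>" for z by (simp_all add: M_def)
  have \<delta>: "\<delta> \<noteq> 0" using indep by (simp add: \<delta>_def)
  have lM: "linear M"
    by (rule linearI) (simp_all add: vec_eq_iff forall_2 M cross2_simps add_divide_distrib)
  have Md: "M d1 $ 1 = 1" "M d1 $ 2 = 0" "M d2 $ 1 = 0" "M d2 $ 2 = 1" using \<delta> by (simp_all add: M cross2_simps \<delta>_def)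
  have repr: "z = M z $ 1 *\<^sub>R d1 + M z $ 2 *\<^sub>R d2" for z
  proof -
    have "\<delta> * z$1 = cross2 z d2 * d1$1 + cross2 d1 z * d2$1" "\<delta> * z$2 = cross2 z d2 * d1$2 + cross2 d1 z * d2$2"
      by (simp_all add: \<delta>_def cross2_def algebra_simps)
    then show ?thesis using \<delta> by (simp add: vec_eq_iff forall_2 M field_simps)
  qed
  have cM: "continuous_on S M" for S using lM linear_continuous_on linear_conv_bounded_linear by blast
  have Mlin: "M (z + u) $ i = M z $ i + M u $ i" "M (z - u) $ i = M z $ i - M u $ i" "M (s *\<^sub>R u) $ i = s * M u $ i" for z u s i
    using lM by (simp_all add: linear_add linear_diff linear_scale)
  have "bounded (M ` A)" using A(1) cM by (intro compact_imp_bounded compact_continuous_image) auto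
  then obtain H0 where H0: "\<And>z. z \<in> A \<Longrightarrow> norm (M z) \<le> H0" unfolding bounded_iff by auto
  define H where "H = 2 * H0"
  have H: "\<bar>M z $ i - M a $ i\<bar> \<le> H" if "z \<in> A" for z i
    using H0[OF that] H0[OF a] component_le_norm_cart[of "M z" i] component_le_norm_cart[of "M a" i] by (simp add: H_def)
  obtain C where C: "\<And>z. norm (M z) \<le> norm z * C" "C > 0" using lM linear_conv_bounded_linear bounded_linear.pos_bounded by metis
  define \<rho> where "\<rho> = \<bar>r\<bar> * C + 1"
  have \<rho>: "\<bar>M z $ i\<bar> < \<rho>" if "norm z < r" for z i
  proof -
    have "\<bar>M z $ i\<bar> \<le> norm z * C" using component_le_norm_cart[of "M z" i] C(1)[of z] by linarith
    also have "\<dots> \<le> \<bar>r\<bar> * C" using that C(2) by (intro mult_right_mono) auto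
    finally show ?thesis by (simp add: \<rho>_def)
  qed
  have "H \<ge> 0" using H[OF a, of 1] by linarith
  have "\<rho> \<ge> 0" using C(2) by (simp add: \<rho>_def)
  \<comment> \<open>This puts the central ball inside the inner square, of half-width
    \<open>n - H\<close>, and makes the ends of the rows, at distance \<open>2 n\<close> from the
    centre, lie outside the outer square, of half-width \<open>n + H\<close>.\<close>
  obtain n0 :: nat where n0: "real n0 > 2 * H + \<rho>" using reals_Archimedean2 by blast
  show ?thesis
  proof (intro exI[of _ n0] allI impI)
    fix n W b
    assume n: "n0 \<le> n" and W: "path_connected W" "\<not> bounded W"
      and free: "\<forall>i\<le>4*n. \<forall>j\<le>4*n. W \<inter> (\<lambda>z. z + b + real i *\<^sub>R d1 + real j *\<^sub>R d2) ` A = {}"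
    have nn: "real n > 2 * H + \<rho>" using n n0 by linarith
    define c0 where "c0 = a + b + real (2*n) *\<^sub>R (d1 + d2)"
    define c where "c = M c0"
    have c: "c$1 = M a $1 + M b $1 + 2 * real n" "c$2 = M a $2 + M b $2 + 2 * real n"
      using Md by (simp_all add: c_def c0_def Mlin)
    define Ver where "Ver = (\<lambda>i. \<Union>j\<le>4*n. (\<lambda>z. z + (b + real i *\<^sub>R d1) + real j *\<^sub>R d2) ` A)"
    define Hor where "Hor = (\<lambda>j. \<Union>i\<le>4*n. (\<lambda>z. z + (b + real j *\<^sub>R d2) + real i *\<^sub>R d1) ` A)"
    have pcV: "path_connected (M ` Ver i)" for i
      unfolding Ver_def by (intro path_connected_continuous_image cM path_connected_Union_translates[OF A(2,5,6)])
    have pcH: "path_connected (M ` Hor i)" for i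
      unfolding Hor_def by (intro path_connected_continuous_image cM path_connected_Union_translates[OF A(2,3,4)])
    have VerW: "W \<inter> Ver i = {}" if "i \<le> 4*n" for i
    proof -
      have "W \<inter> (\<lambda>z. z + (b + real i *\<^sub>R d1) + real j *\<^sub>R d2) ` A = {}" if "j \<le> 4*n" for j
        using free[rule_format, OF \<open>i \<le> 4*n\<close> that] by (simp add: add.assoc)
      then show ?thesis unfolding Ver_def by auto
    qed
    have HorW: "W \<inter> Hor j = {}" if "j \<le> 4*n" for j
    proof -
      have "W \<inter> (\<lambda>z. z + (b + real j *\<^sub>R d2) + real i *\<^sub>R d1) ` A = {}" if "i \<le> 4*n" for i
        using free[rule_format, OF that \<open>j \<le> 4*n\<close>] by (simp add: add_ac)
      then show ?thesis unfolding Hor_def by auto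
    qed
    have "inj M" using repr by (metis injI)
    have V1: "\<bar>z$1 - (M a $1 + M b $1 + real i)\<bar> \<le> H" if "z \<in> M ` Ver i" for z i
    proof -
      from that obtain y j where y: "y \<in> A" "z = M (y + (b + real i *\<^sub>R d1) + real j *\<^sub>R d2)" unfolding Ver_def by auto
      show ?thesis using H[OF y(1), of 1] Md by (simp add: y(2) Mlin)
    qed
    have V2: "\<bar>z$2 - (M a $2 + M b $2 + real i)\<bar> \<le> H" if "z \<in> M ` Hor i" for z i
    proof -
      from that obtain y j where y: "y \<in> A" "z = M (y + (b + real i *\<^sub>R d2) + real j *\<^sub>R d1)" unfolding Hor_def by auto
      show ?thesis using H[OF y(1), of 2] Md by (simp add: y(2) Mlin)
    qed
    have Vp: "M (a + (b + real i *\<^sub>R d1) + real j *\<^sub>R d2) \<in> M ` Ver i"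
      "M (a + (b + real i *\<^sub>R d1) + real j *\<^sub>R d2) $ 2 = M a $ 2 + M b $ 2 + real j" if "j \<le> 4*n" for i j
    proof -
      show "M (a + (b + real i *\<^sub>R d1) + real j *\<^sub>R d2) \<in> M ` Ver i" using that a unfolding Ver_def by blast
      show "M (a + (b + real i *\<^sub>R d1) + real j *\<^sub>R d2) $ 2 = M a $ 2 + M b $ 2 + real j" using Md by (simp add: Mlin)
    qed
    have Hp: "M (a + (b + real i *\<^sub>R d2) + real j *\<^sub>R d1) \<in> M ` Hor i"
      "M (a + (b + real i *\<^sub>R d2) + real j *\<^sub>R d1) $ 1 = M a $ 1 + M b $ 1 + real j" if "j \<le> 4*n" for i j
    proof -
      show "M (a + (b + real i *\<^sub>R d2) + real j *\<^sub>R d1) \<in> M ` Hor i" using that a unfolding Hor_def by blast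
      show "M (a + (b + real i *\<^sub>R d2) + real j *\<^sub>R d1) $ 1 = M a $ 1 + M b $ 1 + real j" using Md by (simp add: Mlin)
    qed
    show "W \<inter> ball (a + b + real (2*n) *\<^sub>R (d1 + d2)) r = {}"
    proof (rule ccontr)
      assume "\<not> ?thesis"
      then obtain p where p: "p \<in> W" "norm (p - c0) < r" by (auto simp: c0_def dist_norm norm_minus_commute)
      have pc': "\<bar>M p $ i - c $ i\<bar> < \<rho>" for i using \<rho>[OF p(2), of i] by (simp add: c_def Mlin)
      have disj: "M ` W \<inter> (M ` Ver (3*n) \<union> M ` Ver n \<union> M ` Hor (3*n) \<union> M ` Hor n) = {}"
        using VerW[of "3*n"] VerW[of n] HorW[of "3*n"] HorW[of n] by (simp add: Int_Un_distrib flip: image_Int[OF \<open>inj M\<close>])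
      have main: "\<bar>q$1 - c$1\<bar> \<le> real n + H \<and> \<bar>q$2 - c$2\<bar> \<le> real n + H" if q: "q \<in> M ` W" for q
      proof (rule trapped_between_barriers[where W="M ` W" and p="M p" and a="real n - H"
          and VR="M ` Ver (3*n)" and VL="M ` Ver n" and HT="M ` Hor (3*n)" and HB="M ` Hor n"])
        show "path_connected (M ` W)" by (intro path_connected_continuous_image cM W)
        show "\<bar>M p $ 1 - c $ 1\<bar> < real n - H" "\<bar>M p $ 2 - c $ 2\<bar> < real n - H"
          using pc'[of 1] pc'[of 2] nn \<open>H \<ge> 0\<close> by linarith+
        show "c$1 + (real n - H) \<le> z$1 \<and> z$1 \<le> c$1 + (real n + H)" if "z \<in> M ` Ver (3*n)" for z
          using V1[OF that] by (simp add: c abs_le_iff algebra_simps)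
        show "c$1 - (real n + H) \<le> z$1 \<and> z$1 \<le> c$1 - (real n - H)" if "z \<in> M ` Ver n" for z
          using V1[OF that] by (simp add: c abs_le_iff algebra_simps)
        show "c$2 + (real n - H) \<le> z$2 \<and> z$2 \<le> c$2 + (real n + H)" if "z \<in> M ` Hor (3*n)" for z
          using V2[OF that] by (simp add: c abs_le_iff algebra_simps)
        show "c$2 - (real n + H) \<le> z$2 \<and> z$2 \<le> c$2 - (real n - H)" if "z \<in> M ` Hor n" for z
          using V2[OF that] by (simp add: c abs_le_iff algebra_simps)
        show "M (a + (b + real (3*n) *\<^sub>R d1) + real 0 *\<^sub>R d2) \<in> M ` Ver (3*n)"
          "M (a + (b + real (3*n) *\<^sub>R d1) + real (4*n) *\<^sub>R d2) \<in> M ` Ver (3*n)"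
          "M (a + (b + real n *\<^sub>R d1) + real 0 *\<^sub>R d2) \<in> M ` Ver n"
          "M (a + (b + real n *\<^sub>R d1) + real (4*n) *\<^sub>R d2) \<in> M ` Ver n" by (rule Vp(1), simp)+
        show "M (a + (b + real (3*n) *\<^sub>R d2) + real 0 *\<^sub>R d1) \<in> M ` Hor (3*n)"
          "M (a + (b + real (3*n) *\<^sub>R d2) + real (4*n) *\<^sub>R d1) \<in> M ` Hor (3*n)"
          "M (a + (b + real n *\<^sub>R d2) + real 0 *\<^sub>R d1) \<in> M ` Hor n"
          "M (a + (b + real n *\<^sub>R d2) + real (4*n) *\<^sub>R d1) \<in> M ` Hor n" by (rule Hp(1), simp)+
        have big: "real n > H" using nn \<open>H \<ge> 0\<close> \<open>\<rho> \<ge> 0\<close> by linarith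
        show "M (a + (b + real (3*n) *\<^sub>R d1) + real 0 *\<^sub>R d2) $ 2 < c$2 - (real n + H)"
          "M (a + (b + real n *\<^sub>R d1) + real 0 *\<^sub>R d2) $ 2 < c$2 - (real n + H)"
          unfolding Vp(2)[OF le0] using big by (simp_all add: c)
        show "M (a + (b + real (3*n) *\<^sub>R d2) + real 0 *\<^sub>R d1) $ 1 < c$1 - (real n + H)"
          "M (a + (b + real n *\<^sub>R d2) + real 0 *\<^sub>R d1) $ 1 < c$1 - (real n + H)"
          unfolding Hp(2)[OF le0] using big by (simp_all add: c)
        show "c$2 + (real n + H) < M (a + (b + real (3*n) *\<^sub>R d1) + real (4*n) *\<^sub>R d2) $ 2"
          "c$2 + (real n + H) < M (a + (b + real n *\<^sub>R d1) + real (4*n) *\<^sub>R d2) $ 2"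
          unfolding Vp(2)[OF order_refl] using big by (simp_all add: c)
        show "c$1 + (real n + H) < M (a + (b + real (3*n) *\<^sub>R d2) + real (4*n) *\<^sub>R d1) $ 1"
          "c$1 + (real n + H) < M (a + (b + real n *\<^sub>R d2) + real (4*n) *\<^sub>R d1) $ 1"
          unfolding Hp(2)[OF order_refl] using big by (simp_all add: c)
      qed (use p(1) q disj pcV pcH \<open>H \<ge> 0\<close> in auto)
      have "bounded W"
      proof -
        define B where "B = (\<bar>c$1\<bar> + real n + H) * norm d1 + (\<bar>c$2\<bar> + real n + H) * norm d2"
        have "norm z \<le> B" if "z \<in> W" for z
        proof -
          have m: "\<bar>M z $ 1\<bar> \<le> \<bar>c$1\<bar> + real n + H" "\<bar>M z $ 2\<bar> \<le> \<bar>c$2\<bar> + real n + H" using main[of "M z"] that by auto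
          have "norm z \<le> norm (M z $ 1 *\<^sub>R d1) + norm (M z $ 2 *\<^sub>R d2)" by (metis repr norm_triangle_ineq)
          also have "\<dots> \<le> B" unfolding B_def norm_scaleR using m by (intro add_mono mult_right_mono) auto
          finally show ?thesis .
        qed
        then show ?thesis unfolding bounded_iff by blast
      qed
      then show False using W(2) by blast
    qed
  qed
qed

section \<open>Quasiconvexity of the limit set\<close>

lemma chord_from_missed_ball:
  fixes U F :: "(real^2) set"
  assumes U: "path_connected U" and F: "finite F" "F \<subseteq> U" and r: "r > 0"
    and ball: "ball c r \<subseteq> convex hull F" "U \<inter> ball c r = {}"
  shows "\<exists>y\<in>convex hull F. \<forall>d\<in>ball c r. \<exists>p\<in>U. p + (d - y) \<in> U"
proof -
  have img: "to_complex ` ball c r = ball (to_complex c) r"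
  proof (rule set_eqI)
    fix z
    obtain w where w: "z = to_complex w" using surj_to_complex by (metis surjD)
    show "z \<in> to_complex ` ball c r \<longleftrightarrow> z \<in> ball (to_complex c) r"
      unfolding w by (simp add: inj_image_mem_iff[OF inj_to_complex] dist_norm flip: to_complex_diff)
  qed
  have hull: "convex hull (to_complex ` F) = to_complex ` (convex hull F)"
    using convex_hull_linear_image[OF linear_to_complex] by simp
  have "\<exists>y\<in>convex hull (to_complex ` F). \<forall>d\<in>ball (to_complex c) r. \<exists>p\<in>to_complex ` U. p + (d - y) \<in> to_complex ` U"
  proof (rule chord_from_missed_ball_complex)
    show "path_connected (to_complex ` U)"
      using U by (intro path_connected_continuous_image continuous_on_to_complex)
    show "ball (to_complex c) r \<subseteq> convex hull (to_complex ` F)"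
      using ball(1) unfolding hull img[symmetric] by (rule image_mono)
    show "to_complex ` U \<inter> ball (to_complex c) r = {}"
      using ball(2) unfolding img[symmetric] by (simp flip: image_Int[OF inj_to_complex])
  qed (use F r in auto)
  then show ?thesis unfolding hull img[symmetric]
    by (simp add: inj_image_mem_iff[OF inj_to_complex] flip: to_complex_diff to_complex_add)
qed

section \<open>Support functions of convex hulls\<close>

lemma convex_hull_support:
  fixes S :: "'a::real_inner set"
  assumes "y \<in> convex hull S"
  obtains x where "x \<in> S" "a \<bullet> y \<le> a \<bullet> x"
proof -
  have "\<exists>x\<in>S. a \<bullet> y \<le> a \<bullet> x"
  proof (rule ccontr)
    assume "\<not> ?thesis"
    then have "convex hull S \<subseteq> {x. a \<bullet> x < a \<bullet> y}" by (intro hull_minimal convex_halfspace_lt) auto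
    then show False using assms by auto
  qed
  then show ?thesis using that by blast
qed

text \<open>A point of the ball outside the hull would be separated from it in some unit direction,
  along which a point of \<open>S\<close> reaches the far end of the ball.\<close>

lemma ball_subset_convex_hull:
  fixes S :: "'a::euclidean_space set"
  assumes "\<And>a. norm a = 1 \<Longrightarrow> \<exists>x\<in>S. a \<bullet> c + r \<le> a \<bullet> x"
  shows "ball c r \<subseteq> convex hull S"
proof
  fix z assume z: "z \<in> ball c r"
  show "z \<in> convex hull S"
  proof (rule ccontr)
    assume nz: "z \<notin> convex hull S"
    obtain e :: 'a where "e \<in> Basis" using nonempty_Basis by blast
    then have "S \<noteq> {}" using assms[of e] by auto
    then obtain a b where ab: "a \<noteq> 0" "\<forall>x\<in>convex hull S. a \<bullet> x \<le> b" "\<forall>x\<in>{z}. a \<bullet> x \<ge> b"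
      using separating_hyperplane_sets[of "convex hull S" "{z}"] nz by auto
    define u where "u = a /\<^sub>R norm a"
    have "norm u = 1" using ab(1) by (simp add: u_def)
    then obtain x where x: "x \<in> S" "u \<bullet> c + r \<le> u \<bullet> x" using assms by blast
    have "a \<bullet> x \<le> a \<bullet> z" using ab(2,3) hull_inc[OF x(1)] by force
    then have "u \<bullet> x \<le> u \<bullet> z" using ab(1) by (simp add: u_def divide_right_mono)
    moreover have "u \<bullet> (z - c) \<le> norm (z - c)" using norm_cauchy_schwarz[of u "z - c"] \<open>norm u = 1\<close> by simp
    moreover have "norm (z - c) < r" using z by (simp add: dist_norm norm_minus_commute)
    ultimately show False using x(2) by (simp add: inner_diff_right)
  qed
qed

text \<open>Cover a slightly larger closed ball by finitely many small ones. By Caratheodory's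
  theorem each of their centres lies in the hull of finitely many points of \<open>S\<close>, and
  all these points together pass the support criterion. Finiteness permits approximating all of them
  at one stage of the chain.\<close>

lemma ball_subset_convex_hull_finite:
  fixes S :: "'a::euclidean_space set"
  assumes r: "ball c r \<subseteq> convex hull S" and s: "s < r"
  obtains F where "finite F" "F \<subseteq> S" "ball c s \<subseteq> convex hull F"
proof (cases "s \<le> 0")
  case True
  then show ?thesis using that[of "{}"] by simp
next
  case False
  define \<delta> where "\<delta> = (r - s) / 3"
  have \<delta>: "\<delta> > 0" "s + 2 * \<delta> < r" using s by (simp_all add: \<delta>_def field_simps)
  have "compact (cball c (s + 2 * \<delta>))" by simp
  then obtain N where N: "N \<subseteq> cball c (s + 2 * \<delta>)" "finite N" "cball c (s + 2 * \<delta>) \<subseteq> (\<Union>y\<in>N. ball y \<delta>)"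
    by (rule compactE_image[where C="cball c (s + 2 * \<delta>)" and f="\<lambda>y. ball y \<delta>"]) (use \<delta>(1) in \<open>auto intro: centre_in_ball[THEN iffD2]\<close>)
  have "\<forall>y\<in>N. \<exists>G. finite G \<and> G \<subseteq> S \<and> y \<in> convex hull G"
  proof
    fix y assume "y \<in> N"
    then have "dist c y \<le> s + 2 * \<delta>" using N(1) by auto
    then have "y \<in> convex hull S" using \<delta>(2) r by (auto simp: subset_iff)
    then show "\<exists>G. finite G \<and> G \<subseteq> S \<and> y \<in> convex hull G" unfolding caratheodory[of S] by blast
  qed
  then obtain G where G: "\<And>y. y \<in> N \<Longrightarrow> finite (G y) \<and> G y \<subseteq> S \<and> y \<in> convex hull G y" by metis
  define F where "F = (\<Union>y\<in>N. G y)"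
  have "ball c s \<subseteq> convex hull F"
  proof (rule ball_subset_convex_hull)
    fix a :: 'a assume a: "norm a = 1"
    have "c + (s + 2 * \<delta>) *\<^sub>R a \<in> cball c (s + 2 * \<delta>)" using a False \<delta> by (simp add: dist_norm)
    then obtain y where y: "y \<in> N" "dist y (c + (s + 2 * \<delta>) *\<^sub>R a) < \<delta>" using N(3) by auto
    have "y \<in> convex hull F" using G[OF y(1)] y(1) hull_mono[of "G y" F convex] unfolding F_def by blast
    then obtain x where x: "x \<in> F" "a \<bullet> y \<le> a \<bullet> x" by (rule convex_hull_support)
    have "a \<bullet> (c + (s + 2 * \<delta>) *\<^sub>R a - y) \<le> norm (c + (s + 2 * \<delta>) *\<^sub>R a - y)"
      using norm_cauchy_schwarz[of a] a by simp
    also have "\<dots> < \<delta>" using y(2) by (simp add: dist_norm norm_minus_commute)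
    finally have "a \<bullet> c + (s + 2 * \<delta>) - a \<bullet> y < \<delta>"
      using a by (simp add: inner_diff_right inner_add_right dot_square_norm)
    then show "\<exists>x\<in>F. a \<bullet> c + s \<le> a \<bullet> x" using x \<delta> by (intro bexI[of _ x]) auto
  qed
  moreover have "finite F" "F \<subseteq> S" using G N(2) by (auto simp: F_def)
  ultimately show ?thesis using that by blast
qed

section \<open>Eventually free chains over a dense set of vectors\<close>

locale dense_free_chain =
  fixes \<Sigma> :: "(real^2) set" and R :: real and U :: "nat \<Rightarrow> (real^2) set"
  assumes R: "R > 0" and closed_\<Sigma>: "closed \<Sigma>" and discrete_\<Sigma>: "discrete \<Sigma>" and dense_\<Sigma>: "R_dense R \<Sigma>"
    and chain_U: "chain U" and eventually_free_U: "eventually_free \<Sigma> U"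
begin

definition E :: "(real^2) set" where "E = (\<Inter>n. closure (U n))"

lemma U_connected: "path_connected (U n)"
  using chain_U by (simp add: chain_def)

lemma U_mono: "m \<le> n \<Longrightarrow> U n \<subseteq> U m"
  using chain_U by (simp add: chain_def lift_Suc_antimono_le)

lemma \<Sigma>_near:
  obtains v where "v \<in> \<Sigma>" "norm (v - c) < R"
  using dense_\<Sigma> unfolding R_dense_def by (force simp: dist_norm norm_minus_commute)

lemma ex_free_index:
  assumes "v \<in> \<Sigma>"
  obtains n where "\<And>m z. m \<ge> n \<Longrightarrow> z \<in> U m \<Longrightarrow> z + v \<notin> U m"
proof -
  obtain n where n: "translate v ` U n \<inter> U n = {}"
    using eventually_free_U assms unfolding eventually_free_def by blast
  have "z + v \<notin> U m" if "m \<ge> n" "z \<in> U m" for m z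
    using n U_mono[OF that(1)] that(2) unfolding translate_def by blast
  then show ?thesis using that by blast
qed

lemma finite_\<Sigma>_cball: "finite (\<Sigma> \<inter> cball 0 L)"
proof -
  have "compact (\<Sigma> \<inter> cball 0 L)" using closed_\<Sigma> by (simp add: closed_Int_compact)
  moreover have "discrete (\<Sigma> \<inter> cball 0 L)" using discrete_\<Sigma> by (rule discrete_subset) auto
  ultimately show ?thesis using discrete_compact_finite_iff by blast
qed

text \<open>Only finitely many vectors of \<Sigma> have length at most \<open>L\<close>, so the
  largest of their indices serves all; the inserted 0 is the default when there are none.\<close>

lemma ex_common_free_index:
  obtains n where "\<And>m z v. m \<ge> n \<Longrightarrow> v \<in> \<Sigma> \<Longrightarrow> norm v \<le> L \<Longrightarrow> z \<in> U m \<Longrightarrow> z + v \<notin> U m"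
proof -
  have "\<forall>v\<in>\<Sigma>. \<exists>n. \<forall>m\<ge>n. \<forall>z\<in>U m. z + v \<notin> U m" using ex_free_index by metis
  then obtain N where N: "\<And>v m z. v \<in> \<Sigma> \<Longrightarrow> m \<ge> N v \<Longrightarrow> z \<in> U m \<Longrightarrow> z + v \<notin> U m" by metis
  define n where "n = Max (insert 0 (N ` (\<Sigma> \<inter> cball 0 L)))"
  have "N v \<le> n" if "v \<in> \<Sigma>" "norm v \<le> L" for v
    unfolding n_def using that finite_\<Sigma>_cball by (intro Max_ge) auto
  then show ?thesis using that[of n] N by (meson order_trans)
qed

text \<open>The nested compact sets \<open>C \<inter> closure (U n)\<close> have empty intersection,
  so one of them is empty.\<close>

lemma eventually_disjoint_compact:
  assumes C: "compact C" and "C \<inter> E = {}"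
  obtains n where "\<And>m. m \<ge> n \<Longrightarrow> C \<inter> closure (U m) = {}"
proof -
  have anti: "C \<inter> closure (U n) \<subseteq> C \<inter> closure (U m)" if "m \<le> n" for m n
    using closure_mono[OF U_mono[OF that]] by blast
  have "\<exists>n. C \<inter> closure (U n) = {}"
  proof (rule ccontr)
    assume "\<not> ?thesis"
    then have "\<Inter>(range (\<lambda>n. C \<inter> closure (U n))) \<noteq> {}"
      using C anti by (intro compact_nest) (auto intro: compact_Int_closed)
    then show False using assms(2) unfolding E_def by blast
  qed
  then show ?thesis using that anti by blast
qed

text \<open>If \<open>E\<close> misses the disc, a late \<open>U n\<close> misses a smaller one in
  the hull of finitely many of its own points. The translates \<open>d - y\<close> of that disc are
  chords of \<open>U n\<close>, and one lies in \<Sigma>. Its length is bounded before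
  \<open>n\<close> is chosen, which contradicts freeness of \<open>U n\<close> for short
  vectors.\<close>

lemma quasiconvex_E:
  assumes r: "r > R"
  shows "quasiconvex r E"
  unfolding quasiconvex_def
proof (intro allI impI notI)
  fix c assume hull: "ball c r \<subseteq> convex hull E" and disj: "E \<inter> ball c r = {}"
  \<comment> \<open>The radius shrinks from \<open>r\<close> to \<open>\<rho> + 2 * \<delta>\<close>
    when \<open>E\<close> is replaced by a finite subset, and to \<open>\<rho>\<close> when that
    subset is replaced by nearby points of \<open>U n\<close>; it stays above
    \<open>R\<close>.\<close>
  define \<delta> where "\<delta> = (r - R) / 5"
  define \<rho> where "\<rho> = R + \<delta>"
  have \<delta>: "\<delta> > 0" "\<rho> + 2 * \<delta> < r" "R < \<rho>" using r by (simp_all add: \<delta>_def \<rho>_def field_simps)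
  obtain F where F: "finite F" "F \<subseteq> E" "ball c (\<rho> + 2 * \<delta>) \<subseteq> convex hull F"
    using ball_subset_convex_hull_finite[OF hull \<delta>(2)] by blast
  obtain B where B: "\<And>f. f \<in> F \<Longrightarrow> norm f \<le> B" using finite_imp_bounded[OF F(1)] unfolding bounded_iff by blast
  \<comment> \<open>\<open>B + \<delta>\<close> bounds the point \<open>y\<close> to come, so
    \<open>L\<close> bounds every vector within \<open>R\<close> of \<open>c - y\<close>.\<close>
  define L where "L = norm c + R + (B + \<delta>)"
  obtain n1 where n1: "\<And>m z v. m \<ge> n1 \<Longrightarrow> v \<in> \<Sigma> \<Longrightarrow> norm v \<le> L \<Longrightarrow> z \<in> U m \<Longrightarrow> z + v \<notin> U m"
    using ex_common_free_index[of L] by blast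
  have "compact (cball c \<rho>)" "cball c \<rho> \<inter> E = {}" using disj \<delta> by (auto simp: disjoint_iff)
  then obtain n2 where n2: "\<And>m. m \<ge> n2 \<Longrightarrow> cball c \<rho> \<inter> closure (U m) = {}" using eventually_disjoint_compact by blast
  define n where "n = max n1 n2"
  have "\<forall>f\<in>F. \<exists>g\<in>U n. dist g f < \<delta>"
    using F(2) \<delta>(1) unfolding E_def by (auto simp: closure_approachable)
  then obtain g where g: "\<And>f. f \<in> F \<Longrightarrow> g f \<in> U n" "\<And>f. f \<in> F \<Longrightarrow> dist (g f) f < \<delta>" by metis
  have "ball c \<rho> \<subseteq> convex hull (g ` F)"
  proof (rule ball_subset_convex_hull)
    fix a :: "real^2" assume a: "norm a = 1"
    have "c + (\<rho> + \<delta>) *\<^sub>R a \<in> ball c (\<rho> + 2 * \<delta>)" using a \<delta> R by (simp add: dist_norm)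
    then have "c + (\<rho> + \<delta>) *\<^sub>R a \<in> convex hull F" using F(3) by blast
    then obtain f where f: "f \<in> F" "a \<bullet> (c + (\<rho> + \<delta>) *\<^sub>R a) \<le> a \<bullet> f" by (rule convex_hull_support)
    have "a \<bullet> (f - g f) \<le> norm (f - g f)" using norm_cauchy_schwarz[of a] a by simp
    then have "a \<bullet> f - a \<bullet> g f < \<delta>" using g(2)[OF f(1)] by (simp add: dist_norm norm_minus_commute inner_diff_right)
    moreover have "a \<bullet> c + (\<rho> + \<delta>) \<le> a \<bullet> f" using f(2) a by (simp add: inner_add_right dot_square_norm)
    ultimately show "\<exists>x\<in>g ` F. a \<bullet> c + \<rho> \<le> a \<bullet> x" using f(1) by (intro bexI[of _ "g f"]) auto
  qed
  moreover have "U n \<inter> ball c \<rho> = {}" using n2[of n] closure_subset[of "U n"] ball_subset_cball[of c \<rho>] by (fastforce simp: n_def)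
  ultimately have "\<exists>y\<in>convex hull (g ` F). \<forall>d\<in>ball c \<rho>. \<exists>p\<in>U n. p + (d - y) \<in> U n"
    using F(1) g(1) \<delta> R U_connected by (intro chord_from_missed_ball) auto
  then obtain y where y: "y \<in> convex hull (g ` F)" "\<And>d. d \<in> ball c \<rho> \<Longrightarrow> \<exists>p\<in>U n. p + (d - y) \<in> U n" by blast
  have "convex hull (g ` F) \<subseteq> cball 0 (B + \<delta>)"
  proof (rule hull_minimal)
    show "g ` F \<subseteq> cball 0 (B + \<delta>)"
    proof clarsimp
      fix f assume f: "f \<in> F"
      have "norm (g f) \<le> norm f + norm (g f - f)" by (metis add.commute diff_add_cancel norm_triangle_ineq)
      then show "norm (g f) \<le> B + \<delta>" using B[OF f] g(2)[OF f] by (simp add: dist_norm)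
    qed
  qed simp
  then have yb: "norm y \<le> B + \<delta>" using y(1) by auto
  obtain v where v: "v \<in> \<Sigma>" "norm (v - (c - y)) < R" by (rule \<Sigma>_near)
  have "y + v \<in> ball c \<rho>" using v(2) \<delta> by (simp add: dist_norm norm_minus_commute algebra_simps)
  then obtain p where p: "p \<in> U n" "p + v \<in> U n" using y(2)[of "y + v"] by auto
  have "norm v \<le> norm (v - (c - y)) + norm (c - y)" by (metis diff_add_cancel norm_triangle_ineq)
  also have "\<dots> \<le> L" using v(2) yb norm_triangle_ineq4[of c y] by (simp add: L_def)
  finally show False using n1[of n v p] p v(1) by (simp add: n_def)
qed

end

section \<open>Directions at infinity\<close>

lemma cross2_eq_inner: "cross2 z w = vector [w$2, - w$1] \<bullet> z"
  by (simp add: cross2_def inner_vec_def sum_2)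

lemma abs_cross2_le: "\<bar>cross2 z w\<bar> \<le> norm z * norm w"
proof -
  have "norm (vector [w$2, - w$1] :: real^2) = norm w" by (simp add: norm_vec_def L2_set_def sum_2 add.commute)
  then show ?thesis using Cauchy_Schwarz_ineq2[of "vector [w$2, - w$1]" z]
    unfolding cross2_eq_inner by (simp add: mult.commute)
qed

text \<open>Cramer's rule for the basis \<open>u\<close>, \<open>v\<close>, free of
  division.\<close>

lemma cross2_basis: "cross2 u v *\<^sub>R z = cross2 z v *\<^sub>R u + cross2 u z *\<^sub>R v"
  by (simp add: vec_eq_iff forall_2 cross2_def algebra_simps)

lemma cross2_eq_0_imp_multiple:
  assumes "cross2 u v = 0" "u \<noteq> 0"
  shows "v \<in> range (\<lambda>t::real. t *\<^sub>R u)"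
proof -
  have 1: "u$1 * v$2 = u$2 * v$1" using assms(1) by (simp add: cross2_def)
  show ?thesis
  proof (cases "u$1 = 0")
    case True
    then have "u$2 \<noteq> 0" using assms(2) by (auto simp: vec_eq_iff forall_2)
    then have "v = (v$2 / u$2) *\<^sub>R u" using True 1 by (simp add: vec_eq_iff forall_2)
    then show ?thesis by blast
  next
    case False
    then have "v = (v$1 / u$1) *\<^sub>R u" using 1 by (simp add: vec_eq_iff forall_2 field_simps)
    then show ?thesis by blast
  qed
qed

text \<open>Pair the expansion of \<open>a\<close> in the basis \<open>u1\<close>, \<open>u2\<close>
  with \<open>a\<close> itself and cancel \<open>norm a\<close>. A unit vector therefore cannot be
  nearly orthogonal to both directions, uniformly in the vector.\<close>

lemma norm_le_inner_independent:
  assumes "norm u1 = 1" "norm u2 = 1"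
  shows "\<bar>cross2 u1 u2\<bar> * norm a \<le> \<bar>a \<bullet> u1\<bar> + \<bar>a \<bullet> u2\<bar>"
proof (cases "a = 0")
  case False
  have "cross2 u1 u2 * (a \<bullet> a) = cross2 a u2 * (a \<bullet> u1) + cross2 u1 a * (a \<bullet> u2)"
    using arg_cong[OF cross2_basis[of u1 u2 a], of "inner a"] by (simp add: inner_add_right)
  then have "\<bar>cross2 u1 u2\<bar> * (norm a * norm a) = \<bar>cross2 a u2 * (a \<bullet> u1) + cross2 u1 a * (a \<bullet> u2)\<bar>"
    by (metis abs_mult abs_norm_cancel dot_square_norm power2_eq_square)
  also have "\<dots> \<le> \<bar>cross2 a u2\<bar> * \<bar>a \<bullet> u1\<bar> + \<bar>cross2 u1 a\<bar> * \<bar>a \<bullet> u2\<bar>"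
    unfolding abs_mult[symmetric] by (rule abs_triangle_ineq)
  also have "\<dots> \<le> norm a * \<bar>a \<bullet> u1\<bar> + norm a * \<bar>a \<bullet> u2\<bar>"
    using abs_cross2_le[of a u2] abs_cross2_le[of u1 a] assms by (intro add_mono mult_right_mono) auto
  finally have "norm a * (\<bar>cross2 u1 u2\<bar> * norm a) \<le> norm a * (\<bar>a \<bullet> u1\<bar> + \<bar>a \<bullet> u2\<bar>)"
    by (simp add: algebra_simps)
  then show ?thesis using False by simp
qed simp

lemma norm_boundary_at_infinity: "u \<in> boundary_at_infinity X \<Longrightarrow> norm u = 1"
  by (simp add: boundary_at_infinity_def)

lemma boundary_at_infinity_unbounded:
  assumes "u \<in> boundary_at_infinity X" "a \<bullet> u > 0"
  obtains x where "x \<in> X" "B < a \<bullet> x"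
proof -
  obtain x where x: "\<And>n::nat. x n \<in> X" "filterlim (\<lambda>n. norm (x n)) at_top sequentially"
      "(\<lambda>n. x n /\<^sub>R norm (x n)) \<longlonglongrightarrow> u"
    using assms(1) unfolding boundary_at_infinity_def by blast
  have "(\<lambda>n. a \<bullet> (x n /\<^sub>R norm (x n))) \<longlonglongrightarrow> a \<bullet> u" by (intro tendsto_intros x)
  from filterlim_tendsto_pos_mult_at_top[OF this assms(2) x(2)]
  have "filterlim (\<lambda>n. a \<bullet> (x n /\<^sub>R norm (x n)) * norm (x n)) at_top sequentially" .
  moreover have "a \<bullet> (x n /\<^sub>R norm (x n)) * norm (x n) = a \<bullet> x n" for n by (cases "x n = 0") auto
  ultimately have "filterlim (\<lambda>n. a \<bullet> x n) at_top sequentially" by (simp only:)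
  then have "eventually (\<lambda>n. B < a \<bullet> x n) sequentially" by (simp add: filterlim_at_top_dense)
  then obtain n where "B < a \<bullet> x n" by (auto simp: eventually_sequentially)
  then show ?thesis using that x(1) by blast
qed

text \<open>If \<open>a\<close> is negative on \<open>u1\<close> or \<open>u2\<close>, then
  \<open>X\<close> is unbounded below along \<open>a\<close>, and every \<open>j\<close> works.
  Otherwise \<open>a \<bullet> v\<close> is positive and the fixed point \<open>b\<close> is
  eventually below. With \<open>a\<close> orthogonal to a vector \<open>w\<close>, this supplies the
  transverse points needed for a barrier far along \<open>v\<close>.\<close>

lemma below_far_translates:
  assumes u: "u1 \<in> boundary_at_infinity X" "u2 \<in> boundary_at_infinity X" "cross2 u1 u2 \<noteq> 0"
    and v: "v = \<alpha> *\<^sub>R u1 + \<beta> *\<^sub>R u2" "\<alpha> > 0" "\<beta> > 0" and a: "a \<noteq> 0" and b: "b \<in> X"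
  obtains J :: nat where "\<And>j. j \<ge> J \<Longrightarrow> \<exists>y\<in>X. \<forall>z. norm (z - real j *\<^sub>R v) \<le> L \<longrightarrow> a \<bullet> y < a \<bullet> z"
proof -
  have cs: "\<bar>a \<bullet> (z - real j *\<^sub>R v)\<bar> \<le> norm a * L" if "norm (z - real j *\<^sub>R v) \<le> L" for z j
    using Cauchy_Schwarz_ineq2[of a "z - real j *\<^sub>R v"] that by (smt (verit) mult_left_mono norm_ge_zero)
  show ?thesis
  proof (cases "a \<bullet> u1 < 0 \<or> a \<bullet> u2 < 0")
    case True
    then have "\<exists>y\<in>X. B < (- a) \<bullet> y" for B
      using boundary_at_infinity_unbounded[OF u(1), of "- a" B] boundary_at_infinity_unbounded[OF u(2), of "- a" B]
      by fastforce
    then have un: "\<exists>y\<in>X. a \<bullet> y < B" for B by (metis inner_minus_left neg_less_iff_less add.inverse_inverse)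
    have "\<exists>y\<in>X. \<forall>z. norm (z - real j *\<^sub>R v) \<le> L \<longrightarrow> a \<bullet> y < a \<bullet> z" for j
    proof -
      obtain y where "y \<in> X" "a \<bullet> y < real j * (a \<bullet> v) - norm a * L" using un by blast
      then show ?thesis using cs[of _ j] by (intro bexI[of _ y]) (fastforce simp: inner_diff_right)+
    qed
    then show ?thesis using that[of 0] by blast
  next
    case False
    have "0 < \<bar>cross2 u1 u2\<bar> * norm a" using u(3) a by simp
    then have "a \<bullet> u1 + a \<bullet> u2 > 0"
      using norm_le_inner_independent[of u1 u2 a] u(1,2) False by (auto simp: norm_boundary_at_infinity)
    then have "a \<bullet> u1 > 0 \<and> a \<bullet> u2 \<ge> 0 \<or> a \<bullet> u1 \<ge> 0 \<and> a \<bullet> u2 > 0" using False by linarith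
    then have "\<alpha> * (a \<bullet> u1) + \<beta> * (a \<bullet> u2) > 0"
      using v(2,3) by (auto intro: add_pos_nonneg add_nonneg_pos)
    then have av: "a \<bullet> v > 0" by (simp add: v inner_add_right)
    obtain J :: nat where J: "(a \<bullet> b + norm a * L) / (a \<bullet> v) < real J" using reals_Archimedean2 by blast
    have "\<exists>y\<in>X. \<forall>z. norm (z - real j *\<^sub>R v) \<le> L \<longrightarrow> a \<bullet> y < a \<bullet> z" if "j \<ge> J" for j
    proof (intro bexI[of _ b] b allI impI)
      fix z assume z: "norm (z - real j *\<^sub>R v) \<le> L"
      have "(a \<bullet> b + norm a * L) / (a \<bullet> v) < real j" using J that by linarith
      then have "a \<bullet> b + norm a * L < real j * (a \<bullet> v)" using av by (simp add: field_simps)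
      then show "a \<bullet> b < a \<bullet> z" using cs[OF z] by (simp add: inner_diff_right)
    qed
    then show ?thesis using that by blast
  qed
qed

text \<open>By \<open>translation_barrier\<close> the forward and the backward translates of
  \<open>A\<close> cannot both meet \<open>U\<close>, so one sign of \<open>w\<close> is good for
  all \<open>k\<close> at once.\<close>

lemma barrier_dichotomy:
  fixes U A :: "(real^2) set"
  assumes U: "path_connected U" and free: "\<And>z. z \<in> U \<Longrightarrow> z + w \<notin> U"
    and A: "compact A" "path_connected A" "A \<inter> U = {}"
    and y: "y \<in> U" "\<And>z. z \<in> A \<Longrightarrow> cross2 y w < cross2 z w"
    and y': "y' \<in> U" "\<And>z. z \<in> A \<Longrightarrow> cross2 z w < cross2 y' w"
  obtains d where "d = w \<or> d = - w" "\<And>(k::nat) z. z \<in> A \<Longrightarrow> z + real k *\<^sub>R d \<notin> U"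
proof -
  have "(\<forall>(k::nat) z. z \<in> A \<longrightarrow> z + real k *\<^sub>R w \<notin> U) \<or> (\<forall>(k::nat) z. z \<in> A \<longrightarrow> z + real k *\<^sub>R (- w) \<notin> U)"
  proof (rule ccontr)
    assume "\<not> ?thesis"
    then obtain k l :: nat and z z' where "z \<in> A" "z + real k *\<^sub>R w \<in> U" "z' \<in> A" "z' + real l *\<^sub>R (- w) \<in> U" by blast
    then show False
      using translation_barrier[OF U free A y y', of "z' + real l *\<^sub>R (- w)" l "z + real k *\<^sub>R w" k] by simp
  qed
  then show ?thesis using that by blast
qed

section \<open>Common asymptotic directions of a chain\<close>

context dense_free_chain
begin

definition D :: "(real^2) set" where "D = (\<Inter>n. boundary_at_infinity (U n))"

text \<open>The chords of a bounded set have bounded length, so one common free index handles all of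
  \<Sigma>.\<close>

lemma bounded_imp_free:
  assumes "bounded (U n)"
  obtains m where "\<And>v z. v \<in> \<Sigma> \<Longrightarrow> z \<in> U m \<Longrightarrow> z + v \<notin> U m"
proof -
  obtain \<rho> where \<rho>: "\<And>z. z \<in> U n \<Longrightarrow> norm z \<le> \<rho>" using assms unfolding bounded_iff by blast
  obtain N where N: "\<And>m z v. m \<ge> N \<Longrightarrow> v \<in> \<Sigma> \<Longrightarrow> norm v \<le> 2 * \<rho> \<Longrightarrow> z \<in> U m \<Longrightarrow> z + v \<notin> U m"
    using ex_common_free_index[of "2 * \<rho>"] by blast
  have "z + v \<notin> U (max n N)" if "v \<in> \<Sigma>" "z \<in> U (max n N)" for v z
  proof
    assume zv: "z + v \<in> U (max n N)"
    have "z \<in> U n" "z + v \<in> U n" using that(2) zv U_mono[of n "max n N"] by auto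
    then have "norm v \<le> 2 * \<rho>" using \<rho>[of z] \<rho>[of "z + v"] norm_triangle_ineq4[of "z + v" z] by simp
    then show False using N[of "max n N" v z] that zv by simp
  qed
  then show ?thesis using that by blast
qed

text \<open>As \<open>x n\<close> is taken from \<open>U n\<close>, the tail of the sequence lies in
  each given \<open>U n\<close>; a single limit direction therefore belongs to the boundary of every
  member of the chain.\<close>

lemma unbounded_sequence_direction:
  assumes x: "\<And>n. x n \<in> U n" and lim: "filterlim (\<lambda>n. norm (x n)) at_top sequentially"
  obtains v s where "v \<in> D" "strict_mono (s :: nat \<Rightarrow> nat)" "(\<lambda>k. x (s k) /\<^sub>R norm (x (s k))) \<longlonglongrightarrow> v"
proof -
  have "norm (x n /\<^sub>R norm (x n)) \<le> 1" for n by (cases "x n = 0") auto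
  then have "\<forall>n. x n /\<^sub>R norm (x n) \<in> cball 0 1" by simp
  then obtain v s where vs: "strict_mono (s :: nat \<Rightarrow> nat)" "((\<lambda>n. x n /\<^sub>R norm (x n)) \<circ> s) \<longlonglongrightarrow> v"
    using compact_cball[of "0::real^2" 1] unfolding compact_def by meson
  then have lv: "(\<lambda>k. x (s k) /\<^sub>R norm (x (s k))) \<longlonglongrightarrow> v" by (simp add: o_def)
  have ls: "filterlim (\<lambda>k. norm (x (s k))) at_top sequentially"
    using filterlim_compose[OF lim filterlim_subseq[OF vs(1)]] .
  have "eventually (\<lambda>k. norm (x (s k)) > 0) sequentially" using ls unfolding filterlim_at_top_dense by blast
  then have "eventually (\<lambda>k. norm (x (s k) /\<^sub>R norm (x (s k))) = 1) sequentially"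
    by eventually_elim simp
  then have "(\<lambda>k. norm (x (s k) /\<^sub>R norm (x (s k)))) \<longlonglongrightarrow> 1" by (rule tendsto_eventually)
  then have "norm v = 1" using tendsto_norm[OF lv] LIMSEQ_unique by blast
  have "v \<in> boundary_at_infinity (U n)" for n
    unfolding boundary_at_infinity_def
  proof (intro CollectI conjI exI allI)
    show "v \<in> sphere 0 1" using \<open>norm v = 1\<close> by simp
    show "x (s (k + n)) \<in> U n" for k
      using x[of "s (k + n)"] U_mono[of n "s (k + n)"] seq_suble[OF vs(1), of "k + n"] by auto
    show "filterlim (\<lambda>k. norm (x (s (k + n)))) at_top sequentially"
      using filterlim_compose[OF ls filterlim_add_const_nat_at_top[of n]] .
    show "(\<lambda>k. x (s (k + n)) /\<^sub>R norm (x (s (k + n)))) \<longlonglongrightarrow> v"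
      using LIMSEQ_ignore_initial_segment[OF lv, of n] .
  qed
  then show ?thesis using that vs(1) lv unfolding D_def by blast
qed

lemma D_nonempty:
  assumes "\<And>n. \<not> bounded (U n)"
  shows "D \<noteq> {}"
proof -
  have "\<forall>n. \<exists>x\<in>U n. real n \<le> norm x" using assms unfolding bounded_iff by (meson linear)
  then obtain x where x: "\<And>n. x n \<in> U n" "\<And>n. real n \<le> norm (x n)" by metis
  have "filterlim (\<lambda>n. norm (x n)) at_top sequentially"
    using x(2) by (intro filterlim_at_top_mono[OF filterlim_real_sequentially]) auto
  then show ?thesis using unbounded_sequence_direction[of x] x(1) by blast
qed

lemma D_boundary: "u \<in> D \<Longrightarrow> u \<in> boundary_at_infinity (U n)"
  by (simp add: D_def)

lemma D_norm: "u \<in> D \<Longrightarrow> norm u = 1"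
  using norm_boundary_at_infinity[OF D_boundary] .

lemma \<Sigma>_in_cone:
  assumes u: "u1 \<in> D" "u2 \<in> D" "cross2 u1 u2 \<noteq> 0"
  obtains v \<alpha> \<beta> where "v \<in> \<Sigma>" "v = \<alpha> *\<^sub>R u1 + \<beta> *\<^sub>R u2" "\<alpha> > 0" "\<beta> > 0"
proof -
  define \<delta> where "\<delta> = cross2 u1 u2"
  have \<delta>: "\<delta> \<noteq> 0" using u(3) by (simp add: \<delta>_def)
  \<comment> \<open>In the basis \<open>u1\<close>, \<open>u2\<close> a vector shorter than
    \<open>R\<close> has coordinates at most \<open>R / \<bar>\<delta>\<bar>\<close> in absolute
    value, so the disc of radius \<open>R\<close> around \<open>T *\<^sub>R (u1 + u2)\<close> lies
    in the open cone.\<close>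
  define T where "T = R / \<bar>\<delta>\<bar> + 1"
  obtain v where v: "v \<in> \<Sigma>" "norm (v - T *\<^sub>R (u1 + u2)) < R" by (rule \<Sigma>_near)
  define z where "z = v - T *\<^sub>R (u1 + u2)"
  define \<alpha> where "\<alpha> = T + cross2 z u2 / \<delta>"
  define \<beta> where "\<beta> = T + cross2 u1 z / \<delta>"
  have zR: "norm z < R" using v(2) by (simp add: z_def)
  have small: "\<bar>c / \<delta>\<bar> < T" if "\<bar>c\<bar> \<le> norm z" for c
  proof -
    have "\<bar>c\<bar> / \<bar>\<delta>\<bar> \<le> R / \<bar>\<delta>\<bar>" using that zR by (intro divide_right_mono) auto
    then show ?thesis by (simp add: T_def)
  qed
  have "\<bar>cross2 z u2 / \<delta>\<bar> < T" "\<bar>cross2 u1 z / \<delta>\<bar> < T"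
    using abs_cross2_le[of z u2] abs_cross2_le[of u1 z] D_norm[OF u(1)] D_norm[OF u(2)] by (simp_all only: small mult_1 mult_1_right)
  then have "\<alpha> > 0" "\<beta> > 0" unfolding \<alpha>_def \<beta>_def by linarith+
  moreover have "v = \<alpha> *\<^sub>R u1 + \<beta> *\<^sub>R u2"
  proof -
    have "z = (1 / \<delta>) *\<^sub>R (cross2 z u2 *\<^sub>R u1 + cross2 u1 z *\<^sub>R u2)"
      unfolding cross2_basis[symmetric] \<delta>_def[symmetric] using \<delta> by simp
    then have "v = T *\<^sub>R (u1 + u2) + (1 / \<delta>) *\<^sub>R (cross2 z u2 *\<^sub>R u1 + cross2 u1 z *\<^sub>R u2)"
      by (metis z_def diff_add_cancel add.commute)
    then show ?thesis by (simp add: \<alpha>_def \<beta>_def scaleR_add_right scaleR_add_left)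
  qed
  ultimately show ?thesis using that v(1) by blast
qed

text \<open>If \<open>U m\<close> missed the segment, then a continuum \<open>K\<close> from \<open>x\<close> into \<open>U m\<close> would give the barrier
  \<open>(K + v) \<union> [x - v, x + v] \<union> (K - v)\<close>.\<close>

lemma E_near_U:
  assumes u: "u1 \<in> D" "u2 \<in> D" "cross2 u1 v < 0" "cross2 u2 v > 0"
    and free: "\<And>m z. m \<ge> n \<Longrightarrow> z \<in> U m \<Longrightarrow> z + v \<notin> U m" and x: "x \<in> U n"
    and nonempty: "\<And>m. U m \<noteq> {}"
  obtains e where "e \<in> E" "norm (e - x) \<le> norm v"
proof -
  let ?S = "closed_segment (x - v) (x + v)"
  have meet: "U m \<inter> ?S \<noteq> {}" if m: "m \<ge> n" for m
  proof
    assume disj: "U m \<inter> ?S = {}"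
    obtain b where b: "b \<in> U m" using nonempty by blast
    have "b \<in> U n" using b U_mono[OF m] by blast
    then obtain K where K: "compact K" "path_connected K" "{x, b} \<subseteq> K" "K \<subseteq> U n"
      using finite_subset_compact_path_connected[OF U_connected, of "{x, b}"] x by auto
    define A where "A = ((\<lambda>z. z + v) ` K \<union> ?S) \<union> (\<lambda>z. z - v) ` K"
    have "compact A" unfolding A_def using K(1)
      by (intro compact_Un compact_continuous_image compact_segment continuous_intros)
    have "path_connected A" unfolding A_def
    proof (intro path_connected_Un)
      show "path_connected ((\<lambda>z. z + v) ` K)" "path_connected ((\<lambda>z. z - v) ` K)"
        by (intro path_connected_continuous_image K continuous_intros)+
      show "(\<lambda>z. z + v) ` K \<inter> ?S \<noteq> {}" "((\<lambda>z. z + v) ` K \<union> ?S) \<inter> (\<lambda>z. z - v) ` K \<noteq> {}"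
        using K(3) by (auto simp: disjoint_iff)
    qed simp
    have "A \<inter> U m = {}"
    proof -
      \<comment> \<open>\<open>K\<close> and \<open>U m\<close> both lie in \<open>U n\<close>,
        which contains no chord \<open>v\<close>.\<close>
      have "z + v \<notin> U m" "z - v \<notin> U m" if "z \<in> K" for z
        using free[of n z] free[of n "z - v"] K(4) that U_mono[OF m] by auto
      then show ?thesis using disj unfolding A_def by blast
    qed
    have "bounded ((\<lambda>z. cross2 z v) ` A)"
      using \<open>compact A\<close> continuous_on_cross2 by (intro compact_imp_bounded compact_continuous_image) auto
    then obtain B where B: "\<And>z. z \<in> A \<Longrightarrow> \<bar>cross2 z v\<bar> \<le> B" unfolding bounded_iff by auto
    obtain y' where y': "y' \<in> U m" "B < cross2 y' v"
      using boundary_at_infinity_unbounded[OF D_boundary[OF u(2)], of "vector [v$2, - v$1]" m B] u(4)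
      unfolding cross2_eq_inner by blast
    have "(- vector [v$2, - v$1]) \<bullet> u1 > 0" using u(3) by (simp add: cross2_eq_inner)
    then obtain y where y: "y \<in> U m" "B < - cross2 y v"
      using boundary_at_infinity_unbounded[OF D_boundary[OF u(1)], of "- vector [v$2, - v$1]" m B]
      unfolding cross2_eq_inner inner_minus_left by blast
    show False
    proof (rule translation_barrier[OF U_connected _ \<open>compact A\<close> \<open>path_connected A\<close> \<open>A \<inter> U m = {}\<close> y(1) _ y'(1)])
      show "z + v \<notin> U m" if "z \<in> U m" for z using free that m by blast
      show "cross2 y v < cross2 z v" "cross2 z v < cross2 y' v" if "z \<in> A" for z
        using B[OF that] y(2) y'(2) by linarith+
      \<comment> \<open>\<open>b\<close> lies in both \<open>K\<close> and \<open>U m\<close>, and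
        \<open>A\<close> contains its forward and its backward translate, so it fills both
        roles.\<close>
      show "b \<in> U m" "b \<in> U m" by (fact b)+
      show "b + real 1 *\<^sub>R v \<in> A" "b - real 1 *\<^sub>R v \<in> A" using K(3) unfolding A_def by auto
    qed
  qed
  have "?S \<inter> E \<noteq> {}"
  proof
    assume "?S \<inter> E = {}"
    from eventually_disjoint_compact[OF compact_segment this]
    obtain N where N: "\<And>m. m \<ge> N \<Longrightarrow> ?S \<inter> closure (U m) = {}" by metis
    have "?S \<inter> closure (U (max n N)) = {}" by (rule N) simp
    moreover have "U (max n N) \<inter> ?S \<noteq> {}" by (rule meet) simp
    ultimately show False using closure_subset[of "U (max n N)"] by blast
  qed
  then obtain e where e: "e \<in> E" "e \<in> ?S" by blast
  have "?S \<subseteq> cball x (norm v)" by (rule closed_segment_subset) (auto simp: dist_norm)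
  then show ?thesis using that[of e] e by (auto simp: dist_norm norm_minus_commute)
qed

end

lemma cross2_minus_commute: "cross2 z w = - cross2 w z"
  by (simp add: cross2_def)

section \<open>No two independent common directions\<close>

context dense_free_chain
begin

text \<open>Apply the support criterion to \<open>E\<close>. If \<open>a\<close> is positive on
  \<open>u1\<close> or \<open>u2\<close>, then \<open>E\<close> is unbounded along \<open>a\<close>
  because it stays near \<open>U n\<close>. Otherwise the ball, far out along \<open>v\<close>, lies
  below a fixed point \<open>e0\<close> of \<open>E\<close>.\<close>

lemma far_balls_in_hull:
  assumes u: "u1 \<in> D" "u2 \<in> D" "cross2 u1 u2 \<noteq> 0"
    and v: "v = \<alpha> *\<^sub>R u1 + \<beta> *\<^sub>R u2" "\<alpha> > 0" "\<beta> > 0"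
    and free: "\<And>m z. m \<ge> n \<Longrightarrow> z \<in> U m \<Longrightarrow> z + v \<notin> U m"
    and nonempty: "\<And>m. U m \<noteq> {}"
  obtains J :: nat where "\<And>j q. j \<ge> J \<Longrightarrow> norm q \<le> L \<Longrightarrow> ball (q + real j *\<^sub>R v) r \<subseteq> convex hull E"
proof -
  define \<delta> where "\<delta> = cross2 u1 u2"
  have c: "cross2 u1 v = \<beta> * \<delta>" "cross2 u2 v = - (\<alpha> * \<delta>)"
    using cross2_minus_commute[of u2 u1] unfolding v \<delta>_def by (simp_all add: cross2_simps)
  \<comment> \<open>\<open>E_near_U\<close> wants its two directions on prescribed sides of
    \<open>v\<close>, so they are exchanged according to the sign of
    \<open>\<delta>\<close>.\<close>
  have near: "\<exists>e\<in>E. norm (e - x) \<le> norm v" if x: "x \<in> U n" for x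
  proof (cases "\<delta> < 0")
    case True
    then show ?thesis using E_near_U[OF u(1,2) _ _ free x nonempty] v(2,3) c
      by (metis mult_pos_neg neg_0_less_iff_less)
  next
    case False
    then have "\<delta> > 0" using u(3) by (simp add: \<delta>_def)
    then show ?thesis using E_near_U[OF u(2,1) _ _ free x nonempty] v(2,3) c
      by (metis mult_pos_pos neg_less_0_iff_less)
  qed
  have unb: "\<exists>e\<in>E. B \<le> a \<bullet> e" if w: "a \<bullet> w > 0" "w \<in> D" for a w B
  proof -
    obtain x where x: "x \<in> U n" "B + norm a * norm v < a \<bullet> x"
      using boundary_at_infinity_unbounded[OF D_boundary[OF w(2)] w(1)] by blast
    obtain e where e: "e \<in> E" "norm (e - x) \<le> norm v" using near[OF x(1)] by blast
    have "\<bar>a \<bullet> (e - x)\<bar> \<le> norm a * norm v"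
      using Cauchy_Schwarz_ineq2[of a "e - x"] e(2) by (smt (verit) mult_left_mono norm_ge_zero)
    then show ?thesis using x(2) e(1) by (intro bexI[of _ e]) (auto simp: inner_diff_right)
  qed
  obtain x0 where "x0 \<in> U n" using nonempty by blast
  then obtain e0 where e0: "e0 \<in> E" using near by blast
  \<comment> \<open>For unit \<open>a\<close> that is positive on neither direction,
    \<open>a \<bullet> v \<le> - \<kappa>\<close>; this bound is uniform in \<open>a\<close>, so one
    \<open>J\<close> suffices.\<close>
  define \<kappa> where "\<kappa> = min \<alpha> \<beta> * \<bar>\<delta>\<bar>"
  have \<kappa>: "\<kappa> > 0" using v u(3) by (simp add: \<kappa>_def \<delta>_def)
  obtain J :: nat where J: "(L + r + norm e0) / \<kappa> < real J" using reals_Archimedean2 by blast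
  have "ball (q + real j *\<^sub>R v) r \<subseteq> convex hull E" if j: "j \<ge> J" and q: "norm q \<le> L" for j q
  proof (rule ball_subset_convex_hull)
    fix a :: "real^2" assume a: "norm a = 1"
    show "\<exists>x\<in>E. a \<bullet> (q + real j *\<^sub>R v) + r \<le> a \<bullet> x"
    proof (cases "a \<bullet> u1 > 0 \<or> a \<bullet> u2 > 0")
      case True
      then show ?thesis using unb u(1,2) by blast
    next
      case False
      have "\<bar>\<delta>\<bar> \<le> \<bar>a \<bullet> u1\<bar> + \<bar>a \<bullet> u2\<bar>"
        using norm_le_inner_independent[OF D_norm[OF u(1)] D_norm[OF u(2)], of a] a by (simp add: \<delta>_def)
      then have "min \<alpha> \<beta> * \<bar>\<delta>\<bar> \<le> min \<alpha> \<beta> * (\<bar>a \<bullet> u1\<bar> + \<bar>a \<bullet> u2\<bar>)" using v by (intro mult_left_mono) auto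
      also have "\<dots> = min \<alpha> \<beta> * \<bar>a \<bullet> u1\<bar> + min \<alpha> \<beta> * \<bar>a \<bullet> u2\<bar>" by (rule distrib_left)
      also have "\<dots> \<le> \<alpha> * \<bar>a \<bullet> u1\<bar> + \<beta> * \<bar>a \<bullet> u2\<bar>" by (intro add_mono mult_right_mono) auto
      also have "\<dots> = - (a \<bullet> v)" using False by (simp add: v inner_add_right)
      finally have "real j * (a \<bullet> v) \<le> real j * (- \<kappa>)" by (intro mult_left_mono) (auto simp: \<kappa>_def)
      moreover have "L + r + norm e0 < real j * \<kappa>"
      proof -
        have "(L + r + norm e0) / \<kappa> < real j" using J j by linarith
        then show ?thesis using \<kappa> by (simp add: field_simps)
      qed
      moreover have "a \<bullet> q \<le> L" using norm_cauchy_schwarz[of a q] a q by simp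
      moreover have "- norm e0 \<le> a \<bullet> e0" using Cauchy_Schwarz_ineq2[of a e0] a by simp
      ultimately have "a \<bullet> q + real j * (a \<bullet> v) + r \<le> a \<bullet> e0" by simp
      then show ?thesis using e0 by (intro bexI[of _ e0]) (simp_all add: inner_add_right)
    qed
  qed
  then show ?thesis using that by blast
qed

text \<open>The order of choices matters: the chords and the continuum \<open>K\<close> come from
  \<open>U n\<close>, the index \<open>m\<close> from the chords, the grid size \<open>N\<close>
  from \<open>K\<close>, and the shift \<open>j\<close> along \<open>v\<close> comes last, once the
  extent of the grid is known.\<close>

lemma D_collinear:
  assumes unb: "\<And>n. \<not> bounded (U n)"
    and not_free: "\<And>n w. w \<in> \<Sigma> \<Longrightarrow> \<not> free (\<Sigma> - range (\<lambda>t::real. t *\<^sub>R w)) (U n)"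
    and u: "u1 \<in> D" "u2 \<in> D"
  shows "cross2 u1 u2 = 0"
proof (rule ccontr)
  assume indep: "cross2 u1 u2 \<noteq> 0"
  have nonempty: "U m \<noteq> {}" for m using unb[of m] by auto
  obtain v \<alpha> \<beta> where v: "v \<in> \<Sigma>" "v = \<alpha> *\<^sub>R u1 + \<beta> *\<^sub>R u2" "\<alpha> > 0" "\<beta> > 0"
    using \<Sigma>_in_cone[OF u indep] by blast
  obtain n where n: "\<And>m z. m \<ge> n \<Longrightarrow> z \<in> U m \<Longrightarrow> z + v \<notin> U m" using ex_free_index[OF v(1)] by blast
  have "v \<noteq> 0" using n[of n] nonempty[of n] by auto
  \<comment> \<open>Failure of alternative (1) for \<open>v\<close> gives a nonzero chord
    \<open>w1\<close>, and its failure for \<open>w1\<close> a chord \<open>w2\<close> independent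
    of \<open>w1\<close>.\<close>
  have chord: "\<exists>w' z. w' \<in> \<Sigma> \<and> w' \<notin> range (\<lambda>t. t *\<^sub>R w) \<and> z \<in> U n \<and> z + w' \<in> U n" if "w \<in> \<Sigma>" for w
    using not_free[OF that, of n] unfolding free_def translate_def by blast
  obtain w1 z1 where w1: "w1 \<in> \<Sigma>" "w1 \<notin> range (\<lambda>t. t *\<^sub>R v)" "z1 \<in> U n" "z1 + w1 \<in> U n" using chord[OF v(1)] by blast
  obtain w2 z2 where w2: "w2 \<in> \<Sigma>" "w2 \<notin> range (\<lambda>t. t *\<^sub>R w1)" "z2 \<in> U n" "z2 + w2 \<in> U n" using chord[OF w1(1)] by blast
  have w10: "w1 \<noteq> 0" using w1(2) by (metis rangeI scaleR_zero_left)
  have w20: "w2 \<noteq> 0" using w2(2) by (metis rangeI scaleR_zero_left)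
  have w12: "cross2 w1 w2 \<noteq> 0" using cross2_eq_0_imp_multiple w10 w2(2) by blast
  obtain n1 where n1: "\<And>m z. m \<ge> n1 \<Longrightarrow> z \<in> U m \<Longrightarrow> z + w1 \<notin> U m" using ex_free_index[OF w1(1)] by blast
  obtain n2 where n2: "\<And>m z. m \<ge> n2 \<Longrightarrow> z \<in> U m \<Longrightarrow> z + w2 \<notin> U m" using ex_free_index[OF w2(1)] by blast
  define m where "m = max n (max n1 n2)"
  have m: "m \<ge> n" "m \<ge> n1" "m \<ge> n2" by (simp_all add: m_def)
  obtain b where b: "b \<in> U m" using nonempty by blast
  then have "{b, z1, z1 + w1, z2, z2 + w2} \<subseteq> U n" using U_mono[OF m(1)] w1 w2 by blast
  then obtain K where K: "compact K" "path_connected K" "{b, z1, z1 + w1, z2, z2 + w2} \<subseteq> K" "K \<subseteq> U n"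
    using finite_subset_compact_path_connected[OF U_connected] by (metis finite.emptyI finite.insertI)
  obtain LK where LK: "\<And>z. z \<in> K \<Longrightarrow> norm z \<le> LK" using compact_imp_bounded[OF K(1)] unfolding bounded_iff by blast
  have bLK: "0 \<le> LK" using LK[of b] K(3) norm_ge_zero[of b] by (meson insert_subset order_trans)
  have chord_K: "\<exists>x. x \<in> K \<and> x + d \<in> K" if "z \<in> K" "z + w \<in> K" "d = w \<or> d = - w" for z w d
    using that by (elim disjE) (auto intro: exI[of _ "z + w"])
  define trap where "trap = (\<lambda>d1 d2 N. \<forall>W b'. path_connected W \<longrightarrow> \<not> bounded W \<longrightarrow>
     (\<forall>i\<le>4*N. \<forall>j\<le>4*N. W \<inter> (\<lambda>z. z + b' + real i *\<^sub>R d1 + real j *\<^sub>R d2) ` K = {}) \<longrightarrow>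
     W \<inter> ball (b + b' + real (2*N) *\<^sub>R (d1 + d2)) (R + 1) = {})"
  have ex_trap: "\<exists>N0::nat. \<forall>N\<ge>N0. trap d1 d2 N" if d: "d1 = w1 \<or> d1 = - w1" "d2 = w2 \<or> d2 = - w2" for d1 d2
  proof -
    obtain x1 where x1: "x1 \<in> K" "x1 + d1 \<in> K"
      using d(1) K(3) chord_K[of z1 w1 d1] by auto
    obtain x2 where x2: "x2 \<in> K" "x2 + d2 \<in> K"
      using d(2) K(3) chord_K[of z2 w2 d2] by auto
    have "cross2 d1 d2 \<noteq> 0" using d w12 by (auto simp: cross2_simps)
    from grid_trap[OF K(1,2) x1 x2 this] show ?thesis using K(3) unfolding trap_def by blast
  qed
  \<comment> \<open>The signs of \<open>w1\<close> and \<open>w2\<close> are decided only after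
    \<open>j\<close> is fixed, so \<open>N\<close> must be large enough for all four
    combinations.\<close>
  obtain Na Nb Nc Nd :: nat where "\<forall>N\<ge>Na. trap w1 w2 N" "\<forall>N\<ge>Nb. trap w1 (- w2) N"
      "\<forall>N\<ge>Nc. trap (- w1) w2 N" "\<forall>N\<ge>Nd. trap (- w1) (- w2) N"
    using ex_trap[of w1 w2] ex_trap[of w1 "- w2"] ex_trap[of "- w1" w2] ex_trap[of "- w1" "- w2"] by auto
  moreover define N where "N = Na + Nb + Nc + Nd"
  moreover have "Na \<le> N" "Nb \<le> N" "Nc \<le> N" "Nd \<le> N" by (simp_all add: N_def)
  ultimately have N: "trap d1 d2 N" if "d1 = w1 \<or> d1 = - w1" "d2 = w2 \<or> d2 = - w2" for d1 d2
    using that by blast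
  \<comment> \<open>\<open>LA\<close> bounds the distance from \<open>j v\<close> to the first row
    of the grid, and \<open>LQ\<close> the offset of the grid's centre from
    \<open>j v\<close>.\<close>
  define LA where "LA = LK + real (4*N) * norm w1"
  define LQ where "LQ = LK + real (2*N) * (norm w1 + norm w2)"
  define perp :: "real^2 \<Rightarrow> real^2" where "perp = (\<lambda>w. vector [w$2, - w$1])"
  have perp: "perp w \<bullet> z = cross2 z w" "perp w = 0 \<longleftrightarrow> w = 0" for w z
    by (auto simp: perp_def cross2_eq_inner vec_eq_iff forall_2)
  have below: "\<exists>J::nat. \<forall>j\<ge>J. \<exists>y\<in>U m. \<forall>z. norm (z - real j *\<^sub>R v) \<le> LA \<longrightarrow> cross2 y w < cross2 z w" if "w \<noteq> 0" for w
    using below_far_translates[OF D_boundary[OF u(1)] D_boundary[OF u(2)] indep v(2-4) _ b, of "perp w" LA] that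
    unfolding perp by metis
  have above: "\<exists>J::nat. \<forall>j\<ge>J. \<exists>y\<in>U m. \<forall>z. norm (z - real j *\<^sub>R v) \<le> LA \<longrightarrow> cross2 z w < cross2 y w" if "w \<noteq> 0" for w
    using below[of "- w"] that by (simp add: cross2_simps)
  obtain J1 :: nat where J1: "\<And>j. j \<ge> J1 \<Longrightarrow> \<exists>y\<in>U m. \<forall>z. norm (z - real j *\<^sub>R v) \<le> LA \<longrightarrow> cross2 y w1 < cross2 z w1"
    using below[OF w10] by auto
  obtain J2 :: nat where J2: "\<And>j. j \<ge> J2 \<Longrightarrow> \<exists>y\<in>U m. \<forall>z. norm (z - real j *\<^sub>R v) \<le> LA \<longrightarrow> cross2 z w1 < cross2 y w1"
    using above[OF w10] by auto
  obtain J3 :: nat where J3: "\<And>j. j \<ge> J3 \<Longrightarrow> \<exists>y\<in>U m. \<forall>z. norm (z - real j *\<^sub>R v) \<le> LA \<longrightarrow> cross2 y w2 < cross2 z w2"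
    using below[OF w20] by auto
  obtain J4 :: nat where J4: "\<And>j. j \<ge> J4 \<Longrightarrow> \<exists>y\<in>U m. \<forall>z. norm (z - real j *\<^sub>R v) \<le> LA \<longrightarrow> cross2 z w2 < cross2 y w2"
    using above[OF w20] by auto
  obtain J5 where J5: "\<And>j q. j \<ge> J5 \<Longrightarrow> norm q \<le> LQ \<Longrightarrow> ball (q + real j *\<^sub>R v) (R + 1) \<subseteq> convex hull E"
    using far_balls_in_hull[OF u indep v(2-4) n nonempty] by blast
  define j where "j = 1 + J1 + J2 + J3 + J4 + J5"
  have j: "j \<ge> 1" "j \<ge> J1" "j \<ge> J2" "j \<ge> J3" "j \<ge> J4" "j \<ge> J5" by (simp_all add: j_def)
  define A where "A = (\<lambda>z. z + real j *\<^sub>R v) ` K"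
  have A: "compact A" "path_connected A" unfolding A_def
    by (intro compact_continuous_image path_connected_continuous_image K continuous_intros)+
  have AU: "A \<inter> U m = {}"
  proof -
    have "z + real j *\<^sub>R v \<notin> U n" if "z \<in> K" for z
      using free_multiple[OF U_connected \<open>v \<noteq> 0\<close> j(1) n[OF order_refl], of z] K(4) that by blast
    then show ?thesis using U_mono[OF m(1)] unfolding A_def by blast
  qed
  have LAz: "norm (z - real j *\<^sub>R v) \<le> LK" if "z \<in> A" for z using that LK unfolding A_def by auto
  have "LK \<le> LA" by (simp add: LA_def)
  obtain d1 where d1: "d1 = w1 \<or> d1 = - w1" "\<And>(k::nat) z. z \<in> A \<Longrightarrow> z + real k *\<^sub>R d1 \<notin> U m"
  proof -
    obtain y where y: "y \<in> U m" "\<And>z. z \<in> A \<Longrightarrow> cross2 y w1 < cross2 z w1"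
      using J1[OF j(2)] LAz \<open>LK \<le> LA\<close> by (meson order_trans)
    obtain y' where y': "y' \<in> U m" "\<And>z. z \<in> A \<Longrightarrow> cross2 z w1 < cross2 y' w1"
      using J2[OF j(3)] LAz \<open>LK \<le> LA\<close> by (meson order_trans)
    show ?thesis using barrier_dichotomy[OF U_connected n1[OF m(2)] A AU y y'] that by blast
  qed
  have n1d: "norm d1 = norm w1" using d1(1) by auto
  \<comment> \<open>The row of translates along \<open>d1\<close> is one continuum disjoint from
    \<open>U m\<close>. Applying the dichotomy for \<open>w2\<close> to the whole row gives one sign
    \<open>d2\<close> for the entire grid.\<close>
  define B where "B = (\<Union>k\<le>4*N. (\<lambda>z. z + 0 + real k *\<^sub>R d1) ` A)"
  obtain d2 where d2: "d2 = w2 \<or> d2 = - w2" "\<And>(k::nat) z. z \<in> B \<Longrightarrow> z + real k *\<^sub>R d2 \<notin> U m"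
  proof -
    have "compact B" unfolding B_def by (intro compact_UN compact_continuous_image A continuous_intros) auto
    obtain x where x: "x \<in> K" "x + d1 \<in> K" using d1(1) K(3) chord_K[of z1 w1 d1] by auto
    have "x + real j *\<^sub>R v \<in> A" "(x + real j *\<^sub>R v) + d1 \<in> A"
      using x unfolding A_def by (auto intro!: image_eqI[of _ _ "x + d1"] simp: add_ac)
    then have "path_connected B" unfolding B_def by (rule path_connected_Union_translates[OF A(2)])
    have "B \<inter> U m = {}" using d1(2) unfolding B_def by auto
    have LB: "norm (z - real j *\<^sub>R v) \<le> LA" if zB: "z \<in> B" for z
    proof -
      obtain k a where k: "k \<le> 4*N" "a \<in> A" "z = a + real k *\<^sub>R d1" using zB unfolding B_def by auto
      have "norm (z - real j *\<^sub>R v) = norm ((a - real j *\<^sub>R v) + real k *\<^sub>R d1)" by (simp add: k(3) algebra_simps)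
      also have "\<dots> \<le> norm (a - real j *\<^sub>R v) + real k * norm d1" by (metis abs_of_nat norm_scaleR norm_triangle_ineq)
      also have "\<dots> \<le> LK + real (4*N) * norm w1"
        using LAz[OF k(2)] k(1) n1d by (intro add_mono mult_mono) auto
      finally show ?thesis by (simp add: LA_def)
    qed
    obtain y where y: "y \<in> U m" "\<And>z. z \<in> B \<Longrightarrow> cross2 y w2 < cross2 z w2" using J3[OF j(4)] LB by blast
    obtain y' where y': "y' \<in> U m" "\<And>z. z \<in> B \<Longrightarrow> cross2 z w2 < cross2 y' w2" using J4[OF j(5)] LB by blast
    show ?thesis
      using barrier_dichotomy[OF U_connected n2[OF m(3)] \<open>compact B\<close> \<open>path_connected B\<close> \<open>B \<inter> U m = {}\<close> y y'] that by blast
  qed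
  have n2d: "norm d2 = norm w2" using d2(1) by auto
  have grid: "U m \<inter> (\<lambda>z. z + real j *\<^sub>R v + real i *\<^sub>R d1 + real k *\<^sub>R d2) ` K = {}" if ik: "i \<le> 4*N" "k \<le> 4*N" for i k
  proof -
    have "z + real j *\<^sub>R v + real i *\<^sub>R d1 \<in> B" if "z \<in> K" for z
      using that ik(1) unfolding B_def A_def by auto
    then show ?thesis using d2(2) by blast
  qed
  have "U m \<inter> ball (b + real j *\<^sub>R v + real (2*N) *\<^sub>R (d1 + d2)) (R + 1) = {}"
    by (rule N[OF d1(1) d2(1), unfolded trap_def, rule_format, OF U_connected unb grid])
  moreover define q where "q = b + real (2*N) *\<^sub>R (d1 + d2)"
  ultimately have disj: "U m \<inter> ball (q + real j *\<^sub>R v) (R + 1) = {}" by (simp add: add_ac)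
  have "norm q \<le> norm b + norm (real (2*N) *\<^sub>R (d1 + d2))" unfolding q_def by (rule norm_triangle_ineq)
  also have "norm (real (2*N) *\<^sub>R (d1 + d2)) = real (2*N) * norm (d1 + d2)" by simp
  also have "norm b + \<dots> \<le> LK + real (2*N) * (norm w1 + norm w2)"
    using LK[of b] K(3) norm_triangle_ineq[of d1 d2] n1d n2d by (intro add_mono mult_left_mono) auto
  finally have "ball (q + real j *\<^sub>R v) (R + 1) \<subseteq> convex hull E" using J5[OF j(6)] by (simp add: LQ_def)
  \<comment> \<open>\<open>E\<close> meets the ball by quasiconvexity; as the ball is open,
    \<open>U m\<close> itself then meets it, against the trap.\<close>
  then have "E \<inter> ball (q + real j *\<^sub>R v) (R + 1) \<noteq> {}" using quasiconvex_E[of "R + 1"] unfolding quasiconvex_def by auto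
  then have "closure (U m) \<inter> ball (q + real j *\<^sub>R v) (R + 1) \<noteq> {}" unfolding E_def by blast
  then show False using disj open_Int_closure_eq_empty[OF open_ball] by (metis Int_commute)
qed

end

section \<open>Two opposite directions\<close>

text \<open>Since \<open>u\<close> is transverse to \<open>w\<close> and \<open>X\<close> is
  asymptotic to both \<open>u\<close> and \<open>- u\<close>, it extends beyond any compact
  \<open>A\<close> on both sides. The transverse hypotheses of \<open>translation_barrier\<close>
  thus hold automatically.\<close>

lemma two_ended_barrier:
  fixes X A :: "(real^2) set" and k l :: nat
  assumes X: "path_connected X" "\<And>z. z \<in> X \<Longrightarrow> z + w \<notin> X"
    and u: "u \<in> boundary_at_infinity X" "- u \<in> boundary_at_infinity X" "cross2 u w \<noteq> 0"
    and A: "compact A" "path_connected A" "A \<inter> X = {}"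
    and p: "p \<in> X" "p + real k *\<^sub>R w \<in> A" and q: "q \<in> X" "q - real l *\<^sub>R w \<in> A"
  shows False
proof -
  define a :: "real^2" where "a = vector [w$2, - w$1]"
  have a: "cross2 z w = a \<bullet> z" for z by (simp add: a_def cross2_eq_inner)
  have unb: "\<exists>y\<in>X. B < b \<bullet> y" if "b \<bullet> u \<noteq> 0" for b B
    using that boundary_at_infinity_unbounded[OF u(1), of b B] boundary_at_infinity_unbounded[OF u(2), of b B]
    by (metis inner_minus_right neg_0_less_iff_less linorder_neqE_linordered_idom)
  obtain C where C: "\<And>z. z \<in> A \<Longrightarrow> \<bar>cross2 z w\<bar> \<le> C"
    using compact_imp_bounded[OF compact_continuous_image[OF continuous_on_cross2 A(1)], of w] unfolding bounded_iff by auto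
  obtain y' where y': "y' \<in> X" "C < cross2 y' w" using unb[of a C] u(3) unfolding a by blast
  obtain y where y: "y \<in> X" "C < (- a) \<bullet> y" using unb[of "- a" C] u(3) unfolding a by auto
  have "cross2 y w < - C" using y(2) by (simp add: a)
  show False
    by (rule translation_barrier[OF X A y(1) _ y'(1) _ p q])
      (use C \<open>cross2 y w < - C\<close> y'(2) in fastforce)+
qed

lemma ex_small_slope:
  fixes a b :: real
  assumes "a > 0"
  obtains \<epsilon> where "\<epsilon> > 0" "\<epsilon> * b < a"
proof
  have pos: "\<bar>b\<bar> + 1 > 0" by linarith
  show "a / (\<bar>b\<bar> + 1) > 0" using assms pos by simp
  have "a * b < a * (\<bar>b\<bar> + 1)" using assms by (intro mult_strict_left_mono) auto
  then show "a / (\<bar>b\<bar> + 1) * b < a" unfolding times_divide_eq_left pos_divide_less_eq[OF pos] .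
qed

text \<open>Each further step \<open>w\<close> gains at least \<open>g > 0\<close> in the difference
  of the two sides.\<close>

lemma eventually_in_cone:
  fixes u \<nu> w b :: "real^2"
  assumes "\<epsilon> * \<bar>u \<bullet> w\<bar> < \<nu> \<bullet> w" "\<epsilon> > 0"
  obtains l0 :: nat where "\<And>l. l \<ge> l0 \<Longrightarrow> \<epsilon> * \<bar>u \<bullet> (b + real l *\<^sub>R w)\<bar> + B < \<nu> \<bullet> (b + real l *\<^sub>R w)"
proof -
  define g where "g = \<nu> \<bullet> w - \<epsilon> * \<bar>u \<bullet> w\<bar>"
  have g: "g > 0" using assms by (simp add: g_def)
  obtain l0 :: nat where l0: "(\<epsilon> * \<bar>u \<bullet> b\<bar> + B - \<nu> \<bullet> b) / g < real l0" using reals_Archimedean2 by blast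
  have "\<epsilon> * \<bar>u \<bullet> (b + real l *\<^sub>R w)\<bar> + B < \<nu> \<bullet> (b + real l *\<^sub>R w)" if "l \<ge> l0" for l
  proof -
    have "(\<epsilon> * \<bar>u \<bullet> b\<bar> + B - \<nu> \<bullet> b) / g < real l" using l0 that by linarith
    then have "\<epsilon> * \<bar>u \<bullet> b\<bar> + B - \<nu> \<bullet> b < real l * g" using g by (simp add: field_simps)
    moreover have "\<bar>u \<bullet> (b + real l *\<^sub>R w)\<bar> \<le> \<bar>u \<bullet> b\<bar> + real l * \<bar>u \<bullet> w\<bar>"
      using abs_triangle_ineq[of "u \<bullet> b" "real l * (u \<bullet> w)"] by (simp add: inner_add_right abs_mult)
    then have "\<epsilon> * \<bar>u \<bullet> (b + real l *\<^sub>R w)\<bar> \<le> \<epsilon> * (\<bar>u \<bullet> b\<bar> + real l * \<bar>u \<bullet> w\<bar>)"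
      using assms(2) by (intro mult_left_mono) auto
    ultimately show ?thesis by (simp add: g_def inner_add_right algebra_simps)
  qed
  then show ?thesis using that by blast
qed

lemma convex_cone_above:
  fixes u \<nu> :: "'a::real_inner"
  assumes "\<epsilon> > 0"
  shows "convex {z. \<epsilon> * \<bar>u \<bullet> z\<bar> + B < \<nu> \<bullet> z}"
proof -
  have abs: "\<epsilon> * \<bar>x\<bar> + B < c \<longleftrightarrow> \<epsilon> * x - c < - B \<and> - (\<epsilon> * x) - c < - B" for x c
  proof -
    have "\<epsilon> * \<bar>x\<bar> = \<bar>\<epsilon> * x\<bar>" using assms by (simp add: abs_mult)
    then show ?thesis by linarith
  qed
  have "{z. \<epsilon> * \<bar>u \<bullet> z\<bar> + B < \<nu> \<bullet> z} = {z. (\<epsilon> *\<^sub>R u - \<nu>) \<bullet> z < - B} \<inter> {z. (- \<epsilon> *\<^sub>R u - \<nu>) \<bullet> z < - B}"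
    using abs by (auto simp: inner_diff_left)
  then show ?thesis by (simp add: convex_Int convex_halfspace_lt)
qed

lemma closed_segment_uminus: "closed_segment (- a) (- b) = uminus ` closed_segment a (b :: 'a::real_vector)"
  using closed_segment_linear_image[of uminus a b] by (simp add: linear_uminus)

section \<open>Boundedness and separation for two opposite directions\<close>

context dense_free_chain
begin

text \<open>Otherwise points \<open>x n\<close> of \<open>U n\<close> violate the bound with
  \<open>B = n\<close>. They tend to infinity and have a limit direction in \<open>D\<close>, so
  \<open>u\<close> or \<open>- u\<close>; but the violated bound passes to the limit and fails
  there, as \<open>\<nu>\<close> is orthogonal to \<open>u\<close>.\<close>

lemma cone_bound:
  assumes D: "D \<subseteq> {u, - u}" and u: "norm u = 1" "\<nu> \<bullet> u = 0" "norm \<nu> = 1" and \<epsilon>: "\<epsilon> > 0"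
  obtains n B where "\<And>m z. m \<ge> n \<Longrightarrow> z \<in> U m \<Longrightarrow> \<bar>\<nu> \<bullet> z\<bar> \<le> \<epsilon> * \<bar>u \<bullet> z\<bar> + B"
proof -
  have "\<exists>n::nat. \<forall>z\<in>U n. \<bar>\<nu> \<bullet> z\<bar> \<le> \<epsilon> * \<bar>u \<bullet> z\<bar> + real n"
  proof (rule ccontr)
    assume "\<not> ?thesis"
    then have "\<forall>n::nat. \<exists>z\<in>U n. \<epsilon> * \<bar>u \<bullet> z\<bar> + real n < \<bar>\<nu> \<bullet> z\<bar>" by (meson not_le)
    then obtain x where x: "\<And>n. x n \<in> U n" "\<And>n. \<epsilon> * \<bar>u \<bullet> x n\<bar> + real n < \<bar>\<nu> \<bullet> x n\<bar>" by metis
    have \<nu>x: "\<bar>\<nu> \<bullet> z\<bar> \<le> norm z" for z using Cauchy_Schwarz_ineq2[of \<nu> z] u(3) by simp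
    have "real n \<le> norm (x n)" for n
    proof -
      have "0 \<le> \<epsilon> * \<bar>u \<bullet> x n\<bar>" using \<epsilon> by simp
      then show ?thesis using x(2)[of n] \<nu>x[of "x n"] by linarith
    qed
    then have "filterlim (\<lambda>n. norm (x n)) at_top sequentially"
      by (intro filterlim_at_top_mono[OF filterlim_real_sequentially]) auto
    with x(1) obtain v s where v: "v \<in> D" "strict_mono (s :: nat \<Rightarrow> nat)" "(\<lambda>k. x (s k) /\<^sub>R norm (x (s k))) \<longlonglongrightarrow> v"
      using unbounded_sequence_direction[of x] by metis
    have le: "\<epsilon> * \<bar>u \<bullet> (x (s k) /\<^sub>R norm (x (s k)))\<bar> \<le> \<bar>\<nu> \<bullet> (x (s k) /\<^sub>R norm (x (s k)))\<bar>" for k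
    proof -
      have "inverse (norm (x (s k))) * (\<epsilon> * \<bar>u \<bullet> x (s k)\<bar>) \<le> inverse (norm (x (s k))) * \<bar>\<nu> \<bullet> x (s k)\<bar>"
        using x(2)[of "s k"] by (intro mult_left_mono) auto
      then show ?thesis by (simp add: abs_mult mult.left_commute)
    qed
    have "(\<lambda>k. \<epsilon> * \<bar>u \<bullet> (x (s k) /\<^sub>R norm (x (s k)))\<bar>) \<longlonglongrightarrow> \<epsilon> * \<bar>u \<bullet> v\<bar>"
      "(\<lambda>k. \<bar>\<nu> \<bullet> (x (s k) /\<^sub>R norm (x (s k)))\<bar>) \<longlonglongrightarrow> \<bar>\<nu> \<bullet> v\<bar>"
      by (intro tendsto_intros v(3))+
    from LIMSEQ_le[OF this] le have "\<epsilon> * \<bar>u \<bullet> v\<bar> \<le> \<bar>\<nu> \<bullet> v\<bar>" by blast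
    moreover have "v = u \<or> v = - u" using v(1) D by blast
    ultimately show False using u \<epsilon> by (auto simp: dot_square_norm)
  qed
  then obtain n :: nat where "\<forall>z\<in>U n. \<bar>\<nu> \<bullet> z\<bar> \<le> \<epsilon> * \<bar>u \<bullet> z\<bar> + real n" by blast
  then show ?thesis using that[of n "real n"] U_mono by blast
qed

text \<open>If \<open>q\<close> in \<open>E\<close> is very high, some \<open>w\<close> in \<Sigma>
  brings a nearby point \<open>q'\<close> of \<open>U n\<close> down to \<open>q' - w\<close> at
  height about \<open>H\<close>, close to the axis spanned by \<open>\<nu>\<close>. From there a
  vertical segment \<open>S\<close> above \<open>U n\<close> leads into the cone \<open>P\<close>,
  and a segment in \<open>P\<close> on to \<open>q' + l w\<close>. This curve contradicts
  \<open>two_ended_barrier\<close>.\<close>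

lemma E_bounded_above:
  assumes D: "D = {u, - u}" and \<nu>: "\<nu> = vector [u$2, - u$1]" and nonempty: "\<And>m. U m \<noteq> {}"
  obtains M where "\<And>q. q \<in> E \<Longrightarrow> \<nu> \<bullet> q \<le> M"
proof -
  have h: "\<nu> \<bullet> z = cross2 z u" for z by (simp add: \<nu> cross2_eq_inner)
  have uD: "u \<in> D" "- u \<in> D" using D by auto
  have u1: "norm u = 1" using uD D_norm by blast
  have \<nu>u: "\<nu> \<bullet> u = 0" "u \<bullet> \<nu> = 0" by (simp_all add: h cross2_simps inner_commute)
  have \<nu>1: "norm \<nu> = 1" using u1 by (simp add: \<nu> norm_vec_def L2_set_def sum_2 add.commute)
  have cone: "\<exists>n B. \<forall>m\<ge>n. \<forall>z\<in>U m. \<bar>\<nu> \<bullet> z\<bar> \<le> \<epsilon> * \<bar>u \<bullet> z\<bar> + B" if "\<epsilon> > 0" for \<epsilon>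
    using cone_bound[OF equalityD1[OF D] u1 \<nu>u(1) \<nu>1 that] by metis
  have cs: "\<bar>\<nu> \<bullet> z\<bar> \<le> norm z" "\<bar>u \<bullet> z\<bar> \<le> norm z" for z
    using Cauchy_Schwarz_ineq2[of \<nu> z] Cauchy_Schwarz_ineq2[of u z] \<nu>1 u1 by simp_all
  obtain n0 B0 where n0: "\<And>m z. m \<ge> n0 \<Longrightarrow> z \<in> U m \<Longrightarrow> \<bar>\<nu> \<bullet> z\<bar> \<le> 1 * \<bar>u \<bullet> z\<bar> + B0"
    using cone[of 1] by auto
  \<comment> \<open>The points of \<open>S\<close> have height above \<open>H - (R + 1)\<close> and
    horizontal coordinate below \<open>R + 1\<close> in size, so this \<open>H\<close> puts them
    above the cone of slope 1.\<close>
  define H where "H = 2 * (R + 1) + B0 + 1"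
  have "\<nu> \<bullet> q \<le> H + R" if q: "q \<in> E" for q
  proof (rule ccontr)
    assume "\<not> ?thesis"
    then have hq: "\<nu> \<bullet> q > H + R" by simp
    \<comment> \<open>Since \<open>\<nu> \<bullet> q\<close> exceeds \<open>H + R\<close>, every
      vector within \<open>R\<close> of \<open>q - H *\<^sub>R \<nu>\<close> points upwards.\<close>
    obtain w where w: "w \<in> \<Sigma>" "norm (w - (q - H *\<^sub>R \<nu>)) < R" by (rule \<Sigma>_near)
    have "\<bar>\<nu> \<bullet> (w - (q - H *\<^sub>R \<nu>))\<bar> < R" using cs(1) w(2) by (rule le_less_trans)
    then have hw: "\<nu> \<bullet> w > 0" using hq \<nu>1 by (simp add: inner_diff_right dot_square_norm)
    obtain \<epsilon> where \<epsilon>: "\<epsilon> > 0" and \<epsilon>w: "\<epsilon> * \<bar>u \<bullet> w\<bar> < \<nu> \<bullet> w" using ex_small_slope[OF hw] by blast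
    obtain n1 B1 where n1: "\<And>m z. m \<ge> n1 \<Longrightarrow> z \<in> U m \<Longrightarrow> \<bar>\<nu> \<bullet> z\<bar> \<le> \<epsilon> * \<bar>u \<bullet> z\<bar> + B1"
      using cone[OF \<epsilon>] by auto
    obtain n2 where n2: "\<And>m z. m \<ge> n2 \<Longrightarrow> z \<in> U m \<Longrightarrow> z + w \<notin> U m" using ex_free_index[OF w(1)] by blast
    define n where "n = max n0 (max n1 n2)"
    have n: "n0 \<le> n" "n1 \<le> n" "n2 \<le> n" by (simp_all add: n_def)
    have "q \<in> closure (U n)" using q unfolding E_def by blast
    then obtain q' where q': "q' \<in> U n" "dist q' q < 1" unfolding closure_approachable by (metis zero_less_one)
    define P where "P = {z. \<epsilon> * \<bar>u \<bullet> z\<bar> + B1 < \<nu> \<bullet> z}"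
    have P: "convex P" "P \<inter> U n = {}" using convex_cone_above[OF \<epsilon>] n1[OF n(2)] unfolding P_def by force+
    obtain l :: nat where l: "q' + real l *\<^sub>R w \<in> P" using eventually_in_cone[OF \<epsilon>w \<epsilon>, of q' B1] unfolding P_def by auto
    define e where "e = q' - w - H *\<^sub>R \<nu>"
    have e: "norm e < R + 1"
    proof -
      have "e = (q' - q) - (w - (q - H *\<^sub>R \<nu>))" by (simp add: e_def)
      then show ?thesis using norm_triangle_ineq4[of "q' - q" "w - (q - H *\<^sub>R \<nu>)"] q'(2) w(2) by (simp add: dist_norm)
    qed
    have eb: "\<bar>\<nu> \<bullet> e\<bar> < R + 1" "\<bar>u \<bullet> e\<bar> < R + 1" using cs[of e] e by linarith+
    define s where "s = \<bar>\<epsilon> * \<bar>u \<bullet> e\<bar> + B1 - \<nu> \<bullet> e - H\<bar> + 1"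
    define t where "t = q' - w + s *\<^sub>R \<nu>"
    have te: "t = e + (H + s) *\<^sub>R \<nu>" by (simp add: t_def e_def scaleR_add_left)
    have "t \<in> P" using \<nu>1 by (simp add: te P_def inner_add_right \<nu>u s_def dot_square_norm)
    define S where "S = closed_segment (q' - w) t"
    define S' where "S' = closed_segment t (q' + real l *\<^sub>R w)"
    have "S \<inter> U n = {}"
    proof -
      have "z \<notin> U n" if zS: "z \<in> S" for z
      proof
        assume z: "z \<in> U n"
        obtain c where c0: "0 \<le> c" "z = (1 - c) *\<^sub>R (q' - w) + c *\<^sub>R t"
          using zS unfolding S_def in_segment by blast
        then have c: "0 \<le> c" "z = e + (H + c * s) *\<^sub>R \<nu>" by (simp_all add: t_def e_def algebra_simps)
        have "0 \<le> c * s" using c(1) by (simp add: s_def)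
        have "\<nu> \<bullet> z = \<nu> \<bullet> e + (H + c * s)" "u \<bullet> z = u \<bullet> e"
          using \<nu>1 by (simp_all add: c(2) inner_add_right \<nu>u dot_square_norm)
        then show False using n0[OF n(1) z] eb \<open>0 \<le> c * s\<close> by (simp add: H_def)
      qed
      then show ?thesis by blast
    qed
    moreover have "S' \<subseteq> P" unfolding S'_def using \<open>t \<in> P\<close> l P(1) by (simp add: closed_segment_subset)
    ultimately have AU: "(S \<union> S') \<inter> U n = {}" using P(2) by blast
    have "path_connected (S \<union> S')" "compact (S \<union> S')"
      unfolding S_def S'_def by (auto intro!: path_connected_Un)
    moreover have "cross2 u w \<noteq> 0" using hw h[of w] by (simp add: cross2_def algebra_simps)
    ultimately show False
      using two_ended_barrier[OF U_connected n2[OF n(3)] D_boundary[OF uD(1)] D_boundary[OF uD(2)] _ _ _ AU q'(1) _ q'(1), of l 1]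
      by (auto simp: S_def S'_def)
  qed
  then show ?thesis using that by blast
qed

text \<open>Otherwise a path outside \<open>E\<close> joins the half-planes. Prolonged vertically
  into the cones above and below \<open>U n\<close>, and inside these cones to
  \<open>b + l w\<close> and \<open>b - l w\<close> for some \<open>b\<close> in \<open>U n\<close>,
  it contradicts \<open>two_ended_barrier\<close>.\<close>

lemma E_separates:
  assumes D: "D = {u, - u}" and \<nu>: "\<nu> = vector [u$2, - u$1]" and nonempty: "\<And>m. U m \<noteq> {}"
    and M: "M > 0" "\<And>q. q \<in> E \<Longrightarrow> \<bar>\<nu> \<bullet> q\<bar> < M"
  shows "separates E {z. z \<bullet> \<nu> \<ge> M} {z. z \<bullet> \<nu> \<le> - M}"
proof -
  have h: "\<nu> \<bullet> z = cross2 z u" for z by (simp add: \<nu> cross2_eq_inner)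
  have uD: "u \<in> D" "- u \<in> D" using D by auto
  have u1: "norm u = 1" using uD D_norm by blast
  have \<nu>u: "\<nu> \<bullet> u = 0" "u \<bullet> \<nu> = 0" by (simp_all add: h cross2_simps inner_commute)
  have \<nu>1: "norm \<nu> = 1" using u1 by (simp add: \<nu> norm_vec_def L2_set_def sum_2 add.commute)
  have \<nu>\<nu>: "\<nu> \<bullet> \<nu> = 1" using \<nu>1 by (simp add: dot_square_norm)
  let ?H = "{z. z \<bullet> \<nu> \<ge> M}" and ?H' = "{z. z \<bullet> \<nu> \<le> - M}"
  have conv: "convex ?H" "convex ?H'"
    using convex_halfspace_ge[of M \<nu>] convex_halfspace_le[of \<nu> "- M"] by (simp_all add: inner_commute)
  have inH: "M *\<^sub>R \<nu> \<in> ?H" "- (M *\<^sub>R \<nu>) \<in> ?H'" using \<nu>\<nu> by simp_all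
  have HE: "?H \<subseteq> - E" "?H' \<subseteq> - E" using M(2) by (force simp: inner_commute)+
  have "closed E" unfolding E_def by auto
  define C where "C = connected_component_set (- E) (M *\<^sub>R \<nu>)"
  define C' where "C' = connected_component_set (- E) (- (M *\<^sub>R \<nu>))"
  have sub: "?H \<subseteq> C" "?H' \<subseteq> C'"
    unfolding C_def C'_def
    by (rule connected_component_maximal[OF inH(1) convex_connected[OF conv(1)] HE(1)],
        rule connected_component_maximal[OF inH(2) convex_connected[OF conv(2)] HE(2)])
  have comp: "C \<in> components (- E)" "C' \<in> components (- E)"
    unfolding C_def C'_def
    by (rule componentsI[OF subsetD[OF HE(1) inH(1)]], rule componentsI[OF subsetD[OF HE(2) inH(2)]])
  have "C \<noteq> C'"
  proof
    assume "C = C'"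
    then have "- (M *\<^sub>R \<nu>) \<in> C" using sub(2) inH(2) by blast
    also have "C = path_component_set (- E) (M *\<^sub>R \<nu>)"
      unfolding C_def using \<open>closed E\<close> by (simp add: path_component_eq_connected_component_set open_imp_locally_path_connected open_Compl)
    finally have "path_component (- E) (M *\<^sub>R \<nu>) (- (M *\<^sub>R \<nu>))" by simp
    then obtain g where g: "path g" "path_image g \<subseteq> - E" "pathstart g = M *\<^sub>R \<nu>" "pathfinish g = - (M *\<^sub>R \<nu>)"
      unfolding path_component_def by blast
    obtain w where w: "w \<in> \<Sigma>" "norm (w - (2 * R) *\<^sub>R \<nu>) < R" by (rule \<Sigma>_near)
    have "\<bar>\<nu> \<bullet> (w - (2 * R) *\<^sub>R \<nu>)\<bar> < R"
      using Cauchy_Schwarz_ineq2[of \<nu> "w - (2 * R) *\<^sub>R \<nu>"] \<nu>1 w(2) by simp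
    then have hw: "\<nu> \<bullet> w > 0" using R by (simp add: inner_diff_right \<nu>\<nu>)
    obtain \<epsilon> where \<epsilon>: "\<epsilon> > 0" and \<epsilon>w: "\<epsilon> * \<bar>u \<bullet> w\<bar> < \<nu> \<bullet> w" using ex_small_slope[OF hw] by blast
    obtain n1 B where n1: "\<And>m z. m \<ge> n1 \<Longrightarrow> z \<in> U m \<Longrightarrow> \<bar>\<nu> \<bullet> z\<bar> \<le> \<epsilon> * \<bar>u \<bullet> z\<bar> + B"
      using cone_bound[OF equalityD1[OF D] u1 \<nu>u(1) \<nu>1 \<epsilon>] by metis
    obtain n2 where n2: "\<And>m z. m \<ge> n2 \<Longrightarrow> z \<in> U m \<Longrightarrow> z + w \<notin> U m" using ex_free_index[OF w(1)] by blast
    define P where "P = {z. \<epsilon> * \<bar>u \<bullet> z\<bar> + B < \<nu> \<bullet> z}"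
    \<comment> \<open>At least \<open>M\<close>, so that the vertical segments stay in the
      half-planes and off \<open>E\<close>; above \<open>B\<close>, so that they end in the cones.
      Being fixed before \<open>n3\<close>, they can be included in the compact set that late
      members of the chain avoid.\<close>
    define s where "s = max M (B + 1)"
    have s: "M \<le> s" "s *\<^sub>R \<nu> \<in> P" by (simp_all add: s_def P_def \<nu>u \<nu>\<nu>)
    define S where "S = closed_segment (M *\<^sub>R \<nu>) (s *\<^sub>R \<nu>)"
    define S' where "S' = closed_segment (- (M *\<^sub>R \<nu>)) (- (s *\<^sub>R \<nu>))"
    have "S \<subseteq> ?H" unfolding S_def using s(1) inH(1) conv(1) by (intro closed_segment_subset) (auto simp: \<nu>\<nu>)
    moreover have "S' \<subseteq> ?H'" unfolding S'_def using s(1) inH(2) conv(2) by (intro closed_segment_subset) (auto simp: \<nu>\<nu>)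
    ultimately have "(path_image g \<union> S \<union> S') \<inter> E = {}" using HE g(2) by blast
    moreover have "compact (path_image g \<union> S \<union> S')"
      unfolding S_def S'_def using g(1) by (intro compact_Un compact_path_image compact_segment)
    ultimately obtain n3 where n3: "\<And>m. m \<ge> n3 \<Longrightarrow> (path_image g \<union> S \<union> S') \<inter> closure (U m) = {}"
      using eventually_disjoint_compact by metis
    define n where "n = max n1 (max n2 n3)"
    have n: "n1 \<le> n" "n2 \<le> n" "n3 \<le> n" by (simp_all add: n_def)
    have P: "convex P" "P \<inter> U n = {}" "uminus ` P \<inter> U n = {}"
      using convex_cone_above[OF \<epsilon>] n1[OF n(1)] unfolding P_def by force+
    obtain b where b: "b \<in> U n" using nonempty by blast
    obtain l1 where l1: "\<And>l. l \<ge> l1 \<Longrightarrow> b + real l *\<^sub>R w \<in> P" using eventually_in_cone[OF \<epsilon>w \<epsilon>, of b B] unfolding P_def by auto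
    \<comment> \<open>The cone bound is symmetric, so \<open>U n\<close> also misses the reflected
      cone; \<open>- b + l w\<close> in \<open>P\<close> means that \<open>b - l w\<close> lies in
      that reflection.\<close>
    obtain l2 where l2: "\<And>l. l \<ge> l2 \<Longrightarrow> - b + real l *\<^sub>R w \<in> P" using eventually_in_cone[OF \<epsilon>w \<epsilon>, of "- b" B] unfolding P_def by auto
    define l where "l = max l1 l2"
    define T where "T = closed_segment (s *\<^sub>R \<nu>) (b + real l *\<^sub>R w)"
    define T' where "T' = closed_segment (- (s *\<^sub>R \<nu>)) (b - real l *\<^sub>R w)"
    have T: "T \<inter> U n = {}" using closed_segment_subset[OF s(2) l1[of l] P(1)] P(2) unfolding T_def l_def by auto
    have "T' = uminus ` closed_segment (s *\<^sub>R \<nu>) (- b + real l *\<^sub>R w)"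
      unfolding T'_def closed_segment_uminus[symmetric] by simp
    then have T': "T' \<inter> U n = {}" using closed_segment_subset[OF s(2) l2[of l] P(1)] P(3) unfolding l_def by auto
    define A where "A = ((path_image g \<union> (S \<union> T)) \<union> (S' \<union> T'))"
    have "compact A" unfolding A_def S_def S'_def T_def T'_def using g(1)
      by (intro compact_Un compact_path_image compact_segment)
    have ends: "M *\<^sub>R \<nu> \<in> path_image g" "- (M *\<^sub>R \<nu>) \<in> path_image g"
      using g(3,4) pathstart_in_path_image pathfinish_in_path_image by metis+
    have "path_connected A" unfolding A_def
    proof (intro path_connected_Un)
      show "path_connected (path_image g)" using g(1) by (rule path_connected_path_image)
      show "S \<inter> T \<noteq> {}" "S' \<inter> T' \<noteq> {}" "path_image g \<inter> (S \<union> T) \<noteq> {}" "(path_image g \<union> (S \<union> T)) \<inter> (S' \<union> T') \<noteq> {}"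
        using ends by (auto simp: S_def T_def S'_def T'_def)
    qed (simp_all add: S_def T_def S'_def T'_def)
    have "A \<inter> U n = {}" using n3[OF n(3)] closure_subset[of "U n"] T T' unfolding A_def by blast
    moreover have "cross2 u w \<noteq> 0" using hw h[of w] by (simp add: cross2_def algebra_simps)
    moreover have "b + real l *\<^sub>R w \<in> A" "b - real l *\<^sub>R w \<in> A" by (simp_all add: A_def T_def T'_def)
    ultimately show False
      using two_ended_barrier[OF U_connected n2[OF n(2)] D_boundary[OF uD(1)] D_boundary[OF uD(2)]
          _ \<open>compact A\<close> \<open>path_connected A\<close> _ b _ b, of l l] by simp
  qed
  then show ?thesis unfolding separates_def using comp sub by blast
qed

end

section \<open>The three alternatives\<close>

theorem theorem3p2:
  fixes \<Sigma> :: "(real^2) set" and R :: real and U :: "nat \<Rightarrow> (real^2) set"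
  assumes "R > 0" and "closed \<Sigma>" and "discrete \<Sigma>" and "R_dense R \<Sigma>"
    and "chain U" and "eventually_free \<Sigma> U"
  shows "(\<forall>r>R. eventually_quasiconvex r U) \<and>
    ((\<exists>n. \<exists>w\<in>\<Sigma>. free (\<Sigma> - range (\<lambda>t::real. t *\<^sub>R w)) (U n)) \<or>
     has_asymptotic_direction U \<or>
     (\<exists>v. v \<noteq> 0 \<and> bounded_deviation v U \<and>
        (\<exists>M>0. separates (\<Inter>n. closure (U n)) {z. z \<bullet> v \<ge> M} {z. z \<bullet> v \<le> - M})))"
proof -
  interpret dense_free_chain \<Sigma> R U by unfold_locales (fact assms)+
  let ?alternatives = "(\<exists>n. \<exists>w\<in>\<Sigma>. free (\<Sigma> - range (\<lambda>t::real. t *\<^sub>R w)) (U n)) \<or>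
     has_asymptotic_direction U \<or>
     (\<exists>v. v \<noteq> 0 \<and> bounded_deviation v U \<and>
        (\<exists>M>0. separates (\<Inter>n. closure (U n)) {z. z \<bullet> v \<ge> M} {z. z \<bullet> v \<le> - M}))"
  have ?alternatives
  proof (cases "\<exists>n. \<exists>w\<in>\<Sigma>. free (\<Sigma> - range (\<lambda>t::real. t *\<^sub>R w)) (U n)")
    case False
    then have not_free: "\<not> free (\<Sigma> - range (\<lambda>t::real. t *\<^sub>R w)) (U n)" if "w \<in> \<Sigma>" for n w
      using that by blast
    \<comment> \<open>A bounded member would make some \<open>U m\<close> free for all of \<Sigma>,
      which is alternative (1) with any \<open>w\<close> in \<Sigma>.\<close>
    have unb: "\<not> bounded (U n)" for n
    proof
      assume "bounded (U n)"
      then obtain m where m: "\<And>v z. v \<in> \<Sigma> \<Longrightarrow> z \<in> U m \<Longrightarrow> z + v \<notin> U m" using bounded_imp_free by blast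
      obtain w where "w \<in> \<Sigma>" using \<Sigma>_near by blast
      then show False using not_free[of w m] m unfolding free_def translate_def by blast
    qed
    have nonempty: "U m \<noteq> {}" for m using unb[of m] by auto
    obtain u where u: "u \<in> D" using D_nonempty unb by blast
    have u1: "norm u = 1" using u D_norm by blast
    then have "u \<noteq> 0" by auto
    have D_sub: "D \<subseteq> {u, - u}"
    proof
      fix v assume v: "v \<in> D"
      have "cross2 u v = 0" using D_collinear unb not_free u v by blast
      then obtain t :: real where t: "v = t *\<^sub>R u" using cross2_eq_0_imp_multiple[of u v] \<open>u \<noteq> 0\<close> by blast
      have "\<bar>t\<bar> = 1" using D_norm[OF v] u1 by (simp add: t)
      then show "v \<in> {u, - u}" using t by (auto simp: abs_if split: if_splits)
    qed
    show ?thesis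
    proof (cases "D = {u}")
      case True
      then have "has_asymptotic_direction U" using u1 unfolding has_asymptotic_direction_def D_def by auto
      then show ?thesis by blast
    next
      case False
      then have Du: "D = {u, - u}" using D_sub u by auto
      define \<nu> :: "real^2" where "\<nu> = vector [u$2, - u$1]"
      have "\<nu> \<noteq> 0" using \<open>u \<noteq> 0\<close> by (auto simp: \<nu>_def vec_eq_iff forall_2)
      obtain M1 where M1: "\<And>q. q \<in> E \<Longrightarrow> \<nu> \<bullet> q \<le> M1" using E_bounded_above[OF Du \<nu>_def nonempty] by blast
      \<comment> \<open>The lower bound is the upper bound for \<open>- u\<close>, whose normal is
        \<open>- \<nu>\<close>.\<close>
      have "D = {- u, - (- u)}" using Du by auto
      then obtain M2 where "\<And>q. q \<in> E \<Longrightarrow> vector [(- u)$2, - (- u)$1] \<bullet> q \<le> M2"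
        using E_bounded_above[OF _ refl nonempty] by blast
      moreover have "vector [(- u)$2, - (- u)$1] = - \<nu>" by (simp add: \<nu>_def vec_eq_iff forall_2)
      ultimately have M2: "- (\<nu> \<bullet> q) \<le> M2" if "q \<in> E" for q using that by (metis inner_minus_left)
      \<comment> \<open>The added 1 makes \<open>M\<close> positive and the bounds strict, so that
        the closed half-planes miss \<open>E\<close>.\<close>
      define M where "M = \<bar>M1\<bar> + \<bar>M2\<bar> + 1"
      have M: "\<bar>\<nu> \<bullet> q\<bar> < M" if "q \<in> E" for q using M1[OF that] M2[OF that] unfolding M_def by linarith
      have "M > 0" by (simp add: M_def)
      have "- M \<le> q \<bullet> \<nu> \<and> q \<bullet> \<nu> \<le> M" if "q \<in> E" for q
        using M[OF that] unfolding inner_commute[of q] by linarith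
      then have "bounded_deviation \<nu> U"
        unfolding bounded_deviation_def E_def[symmetric] using \<open>\<nu> \<noteq> 0\<close> by blast
      moreover have "separates (\<Inter>n. closure (U n)) {z. z \<bullet> \<nu> \<ge> M} {z. z \<bullet> \<nu> \<le> - M}"
        using E_separates[OF Du \<nu>_def nonempty \<open>M > 0\<close> M] unfolding E_def .
      ultimately show ?thesis using \<open>\<nu> \<noteq> 0\<close> \<open>M > 0\<close> by blast
    qed
  qed simp
  moreover have "\<forall>r>R. eventually_quasiconvex r U"
    using quasiconvex_E unfolding eventually_quasiconvex_def E_def by blast
  ultimately show ?thesis by blast
qed

end
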